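(* Let $u$ be the entropy solution of $u_t+f(u)_x=0$, $u|_{t=0}=\varphi\in L^\infty(\mathbb{R})$, and (when $\bar\Phi>-\infty$) let $\tilde u$ be the entropy solution of $\tilde u_t+f(\tilde u)_x=0$, $\tilde u|_{t=0}=\bar\Phi'$. Assume $\overline u_r=\underline u_r$, $\overline u_l=\underline u_l$ and that for some $\gamma_r,\gamma_l\in[0,1)$ $$\int_y^{y+x}\varphi\,d\xi=\underline u_r\,x+O(1)\,x^{\gamma_r}\ \text{ as }x\to\infty,\text{ uniformly in }y\ge0;\qquad\int_y^{y+x}\varphi\,d\xi=\overline u_l\,x+O(1)\,(-x)^{\gamma_l}\ \text{ as }x\to-\infty,\text{ uniformly in }y\le0.$$ Let $\alpha,\beta\ge0$ satisfy $\lim_{u\to\underline u_r}\frac{f''(u)}{|u-\underline u_r|^\alpha}=N_r>0$ and $\lim_{u\to\overline u_l}\frac{f''(u)}{|u-\overline u_l|^\beta}=N_l>0$. (i) Suppose $\overline u_l<\underline u_r$, or $\overline u_l=\underline u_r$ with $\mathcal{K}_0\ne\varnothing$. With $\mathbb{R}\times\mathbb{R}^+=\mathcal{K}\cup(\bigcup_n\mathcal{H}_{(e_n,h_n)})$: (a) On $\mathcal{K}$, $u(x,t)=\tilde u(x,t)=(f')^{-1}\big(\frac{x-x_0}{t}\big)$ with $x_0\in\mathcal{K}_0$ (for $(x,t)$ on a divide emitting from $x_0$); in particular $u-\tilde u\equiv0$ on $\mathcal K$. (b) If there exists $\mathcal{H}_{(e_n,h_n)}$ with finite $e_n,h_n$,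 and $\alpha_n\ge0$ satisfies $\lim_{u\to c_n}\frac{f''(u)}{|u-c_n|^{\alpha_n}}=N_n>0$, then with $C_n=\big(\frac{1+\alpha_n}{N_n}\big)^{\frac1{1+\alpha_n}}$, as $t\to\infty$, $$|u(x,t)-\tilde u(x,t)|=|u(x,t)-c_n|\lessapprox C_n\Big(\frac{h_n-e_n}{2}\Big)^{\frac1{1+\alpha_n}}t^{-\frac1{1+\alpha_n}}$$ uniformly in $x$ with $(x,t)\in\mathcal{H}_{(e_n,h_n)}$. (c) If there exists $\mathcal{H}_{(e_n,h_n)}$ with finite $e_n$ and $h_n=\infty$, then, as $t\to\infty$, $|u(x,t)-\tilde u(x,t)|=|u(x,t)-\underline u_r|\lesssim t^{-\frac{1-\gamma_r}{2-\gamma_r+\alpha(1-\gamma_r)}}$ uniformly in $x$ with $(x,t)\in\mathcal{H}_\infty$. (d) If there exists $\mathcal{H}_{(e_n,h_n)}$ with finite $h_n$ and $e_n=-\infty$, then, as $t\to\infty$, $|u(x,t)-\tilde u(x,t)|=|u(x,t)-\overline u_l|\lesssim t^{-\frac{1-\gamma_l}{2-\gamma_l+\beta(1-\gamma_l)}}$ uniformly in $x$ with $(x,t)\in\mathcal{H}_{-\infty}$. (ii) Suppose $\overline u_l>\underline u_r$, or $\overline u_l=\underline u_r$ with $\mathcal{K}_0=\varnothing$. (a) If $\overline u_l=\underline u_r$, then, as $t\to\infty$, $|u(x,t)-\underline u_r|\lesssim t^{-\frac{1-\gamma}{2-\gamma+\alpha(1-\gamma)}}$ uniformly in $x\in\mathbb{R}$,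 where $\gamma=\max\{\gamma_r,\gamma_l\}$. (b) If $\overline u_l>\underline u_r$, then, as $t\to\infty$, $|u(x,t)-\overline u_l|\lesssim t^{-\frac{1-\gamma_l}{2-\gamma_l+\beta(1-\gamma_l)}}$ uniformly for $x<x(t)$, and $|u(x,t)-\underline u_r|\lesssim t^{-\frac{1-\gamma_r}{2-\gamma_r+\alpha(1-\gamma_r)}}$ uniformly for $x>x(t)$, where $x=x(t)$, $t\in[0,\infty)$, is a forward generalized characteristic emitting from any point on the $x$-axis.
   Context: Setting: $f\in C^2(\mathbb{R})$, $f''\ge0$, $\mathcal{L}\{f''=0\}=0$, so $f'$ is strictly increasing; $\mathbb R^+=(0,\infty)$. For $t>0$: $E(u;x,t)=t\int_0^u f''(s)(\varphi(x-tf'(s))-s)\,ds$; $\mathcal{U}(x,t)$ is the (nonempty compact) set of maximizers of $E(\cdot\,;x,t)$; the entropy solution with data $\varphi$ is $u(x,t)=\inf\mathcal{U}(x,t)$, with $u(x-,t)=\sup\mathcal{U}(x,t)$, $u(x+,t)=\inf\mathcal{U}(x,t)$ (the same formula with data $\bar\Phi'$ gives $\tilde u$). $\Phi(x)=\int_0^x\varphi\,d\xi$; $\overline u_l,\underline u_l$ are the limsup and liminf of $\Phi(x)/x$ as $x\to-\infty$; $\overline u_r,\underline u_r$ those as $x\to\infty$. $\bar\Phi(x)=\lim_{N\to\infty}\bar\Phi_N(x)\in[-\infty,\infty)$, where $\bar\Phi_N$ is the convex hull (largest convex minorant) of $\Phi|_{[-N,N]}$ on $[-N,N]$ and equals $\Phi$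 for $|x|\ge N$. $\mathcal{K}_0=\{x_0:\Phi(x_0)=\bar\Phi(x_0)\}$ (closed). $L_c(x_0)=\{(x,t):x=x_0+tf'(c),\ t>0\}$ is a divide emitting from $x_0$ if $\mathcal{U}(x,t)=\{c\}$ on all of it; $\mathcal{K}$ is the union of all divides. If $\mathcal{K}_0\ne\varnothing$: $\mathbb{R}\setminus\mathcal{K}_0=\bigcup_n(e_n,h_n)$ (components); for bounded $(e_n,h_n)$, $c_n=\frac{\Phi(h_n)-\Phi(e_n)}{h_n-e_n}$ and $\mathcal{H}_{(e_n,h_n)}=\{t>0,\ e_n+tf'(c_n)<x<h_n+tf'(c_n)\}$; if $h_n=\infty$ (i.e. $x_0^+=\sup\mathcal{K}_0<\infty$), $\mathcal{H}_{(e_n,h_n)}=\mathcal{H}_\infty=\{t>0,\ x>x_0^++tf'(\underline u_r)\}$; if $e_n=-\infty$ (i.e. $x_0^-=\inf\mathcal{K}_0>-\infty$), $\mathcal{H}_{(e_n,h_n)}=\mathcal{H}_{-\infty}=\{t>0,\ x<x_0^-+tf'(\overline u_l)\}$. Forward generalized characteristics: for $t>0$, $\Delta_I(x,t)=\{(\xi,\tau):\xi=x+(\tau-t)f'(v),\ 0<\tau<t,\ v\in[u(x+,t),u(x-,t)]\}$; the forward generalized characteristic of $(x_0,t_0)$, $t_0>0$, is the unique curve $x(t)$, $t\ge t_0$, $x(t_0)=x_0$, with $\Delta_I(x_0,t_0)\subset\Delta_I(x(t_1),t_1)\subset\Delta_I(x(t_2),t_2)$ for $t_2>t_1>t_0$.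 One emitting from a point $x_0$ of the $x$-axis is a continuous curve $x(t)$, $t\ge0$, $x(0)=x_0$, whose restriction to $[t_0,\infty)$ is the forward generalized characteristic of $(x(t_0),t_0)$ for every $t_0>0$. Notation: $A\lesssim B$ means $A\le O(1)B$; $A\lessapprox B$ means $A\le(1+o(1))B$. *)

theory Defs
  imports "HOL-Analysis.Analysis"
begin

text \<open>
  Conservation law \<open>u\<^sub>t + f(u)\<^sub>x = 0\<close> with data \<open>u(x,0) = \<phi>(x)\<close>, where \<open>\<phi>\<close> is a
  representative of an element of \<open>L\<^sup>\<infinity>\<close>. The derivatives \<open>f'\<close> and \<open>f''\<close> are written
  \<open>deriv f\<close> and \<open>deriv (deriv f)\<close>. Integrals are taken with respect to \<open>lebesgue\<close> (the
  completion), so that \<open>\<phi>\<close> need only be Lebesgue measurable; interval integrals are oriented.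
\<close>

definition C2 :: "(real \<Rightarrow> real) \<Rightarrow> bool" where
  "C2 f \<longleftrightarrow> f differentiable_on UNIV \<and> deriv f differentiable_on UNIV \<and>
     continuous_on UNIV (deriv (deriv f))"

definition L_infinity :: "(real \<Rightarrow> real) \<Rightarrow> bool" where
  "L_infinity \<phi> \<longleftrightarrow> \<phi> \<in> borel_measurable lebesgue \<and> (\<exists>M. AE x in lebesgue. \<bar>\<phi> x\<bar> \<le> M)"


subsection \<open>The solution formula\<close>

definition E_fun :: "(real \<Rightarrow> real) \<Rightarrow> (real \<Rightarrow> real) \<Rightarrow> real \<Rightarrow> real \<Rightarrow> real \<Rightarrow> real" where
  "E_fun f \<phi> u x t =
     t * (LINT s=ereal 0..ereal u|lebesgue. (deriv (deriv f) s * (\<phi> (x - t * deriv f s) - s)))"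

definition maximizers :: "(real \<Rightarrow> real) \<Rightarrow> (real \<Rightarrow> real) \<Rightarrow> real \<Rightarrow> real \<Rightarrow> real set" where
  "maximizers f \<phi> x t = {u. \<forall>v. E_fun f \<phi> v x t \<le> E_fun f \<phi> u x t}"

text \<open>The entropy solution is defined pointwise (not only almost everywhere) for \<open>t > 0\<close>.\<close>

definition entropy_sol :: "(real \<Rightarrow> real) \<Rightarrow> (real \<Rightarrow> real) \<Rightarrow> real \<Rightarrow> real \<Rightarrow> real" where
  "entropy_sol f \<phi> x t = Inf (maximizers f \<phi> x t)"

definition u_minus :: "(real \<Rightarrow> real) \<Rightarrow> (real \<Rightarrow> real) \<Rightarrow> real \<Rightarrow> real \<Rightarrow> real" where
  "u_minus f \<phi> x t = Sup (maximizers f \<phi> x t)"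

definition u_plus :: "(real \<Rightarrow> real) \<Rightarrow> (real \<Rightarrow> real) \<Rightarrow> real \<Rightarrow> real \<Rightarrow> real" where
  "u_plus f \<phi> x t = Inf (maximizers f \<phi> x t)"


subsection \<open>The primitive of the data, its mean limits and its convex hull\<close>

definition Phi :: "(real \<Rightarrow> real) \<Rightarrow> real \<Rightarrow> real" where
  "Phi \<phi> x = (LINT \<xi>=ereal 0..ereal x|lebesgue. (\<phi> \<xi>))"

text \<open>For \<open>\<phi>\<close> in \<open>L\<^sup>\<infinity>\<close> the quotient \<open>\<Phi>(x)/x\<close> is bounded, so the four extended-real limits
  below are finite and \<open>real_of_ereal\<close> loses nothing.\<close>

definition u_l_up :: "(real \<Rightarrow> real) \<Rightarrow> real" where
  "u_l_up \<phi> = real_of_ereal (Limsup at_bot (\<lambda>x. ereal (Phi \<phi> x / x)))"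

definition u_l_low :: "(real \<Rightarrow> real) \<Rightarrow> real" where
  "u_l_low \<phi> = real_of_ereal (Liminf at_bot (\<lambda>x. ereal (Phi \<phi> x / x)))"

definition u_r_up :: "(real \<Rightarrow> real) \<Rightarrow> real" where
  "u_r_up \<phi> = real_of_ereal (Limsup at_top (\<lambda>x. ereal (Phi \<phi> x / x)))"

definition u_r_low :: "(real \<Rightarrow> real) \<Rightarrow> real" where
  "u_r_low \<phi> = real_of_ereal (Liminf at_top (\<lambda>x. ereal (Phi \<phi> x / x)))"

definition convex_hull_fun :: "(real \<Rightarrow> real) \<Rightarrow> real set \<Rightarrow> real \<Rightarrow> real" where
  "convex_hull_fun F S x = (SUP g\<in>{g. convex_on S g \<and> (\<forall>y\<in>S. g y \<le> F y)}. g x)"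

definition Phi_bar_N :: "(real \<Rightarrow> real) \<Rightarrow> real \<Rightarrow> real \<Rightarrow> real" where
  "Phi_bar_N \<phi> N x = (if \<bar>x\<bar> < N then convex_hull_fun (Phi \<phi>) {-N..N} x else Phi \<phi> x)"

definition Phi_bar :: "(real \<Rightarrow> real) \<Rightarrow> real \<Rightarrow> ereal" where
  "Phi_bar \<phi> x = Lim at_top (\<lambda>N. ereal (Phi_bar_N \<phi> N x))"

text \<open>\<open>\<Phi>\<close>-bar is convex when finite, hence differentiable off a countable set; the value of
  \<open>deriv\<close> on that null set does not affect the solution formula.\<close>

definition phi_bar :: "(real \<Rightarrow> real) \<Rightarrow> real \<Rightarrow> real" where
  "phi_bar \<phi> = deriv (\<lambda>x. real_of_ereal (Phi_bar \<phi> x))"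

definition K0 :: "(real \<Rightarrow> real) \<Rightarrow> real set" where
  "K0 \<phi> = {x0. ereal (Phi \<phi> x0) = Phi_bar \<phi> x0}"


subsection \<open>Divides and the regions between them\<close>

definition ray :: "(real \<Rightarrow> real) \<Rightarrow> real \<Rightarrow> real \<Rightarrow> (real \<times> real) set" where
  "ray f c x0 = {(x, t). x = x0 + t * deriv f c \<and> t > 0}"

definition is_divide :: "(real \<Rightarrow> real) \<Rightarrow> (real \<Rightarrow> real) \<Rightarrow> real \<Rightarrow> real \<Rightarrow> bool" where
  "is_divide f \<phi> c x0 \<longleftrightarrow> (\<forall>(x, t) \<in> ray f c x0. maximizers f \<phi> x t = {c})"

definition K_set :: "(real \<Rightarrow> real) \<Rightarrow> (real \<Rightarrow> real) \<Rightarrow> (real \<times> real) set" where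
  "K_set f \<phi> = \<Union>{ray f c x0 | c x0. is_divide f \<phi> c x0}"

definition chord_slope :: "(real \<Rightarrow> real) \<Rightarrow> real \<Rightarrow> real \<Rightarrow> real" where
  "chord_slope \<phi> e h = (Phi \<phi> h - Phi \<phi> e) / (h - e)"

definition H_infty :: "(real \<Rightarrow> real) \<Rightarrow> (real \<Rightarrow> real) \<Rightarrow> (real \<times> real) set" where
  "H_infty f \<phi> = {(x, t). t > 0 \<and> x > Sup (K0 \<phi>) + t * deriv f (u_r_low \<phi>)}"

definition H_minus_infty :: "(real \<Rightarrow> real) \<Rightarrow> (real \<Rightarrow> real) \<Rightarrow> (real \<times> real) set" where
  "H_minus_infty f \<phi> = {(x, t). t > 0 \<and> x < Inf (K0 \<phi>) + t * deriv f (u_l_up \<phi>)}"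

definition H_bounded ::
  "(real \<Rightarrow> real) \<Rightarrow> (real \<Rightarrow> real) \<Rightarrow> real \<Rightarrow> real \<Rightarrow> (real \<times> real) set" where
  "H_bounded f \<phi> e h =
     {(x, t). t > 0 \<and> e + t * deriv f (chord_slope \<phi> e h) < x \<and>
        x < h + t * deriv f (chord_slope \<phi> e h)}"

text \<open>The gaps \<open>(e, h)\<close> are the connected components of the complement of \<open>\<K>\<^sub>0\<close>, with
  extended-real end points. They are used only for nonempty \<open>\<K>\<^sub>0\<close>, so at most one end point
  is infinite.\<close>

definition is_gap :: "(real \<Rightarrow> real) \<Rightarrow> ereal \<Rightarrow> ereal \<Rightarrow> bool" where
  "is_gap \<phi> e h \<longleftrightarrow> e < h \<and> einterval e h \<in> components (- K0 \<phi>)"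

definition H_region ::
  "(real \<Rightarrow> real) \<Rightarrow> (real \<Rightarrow> real) \<Rightarrow> ereal \<Rightarrow> ereal \<Rightarrow> (real \<times> real) set" where
  "H_region f \<phi> e h =
     (if h = \<infinity> then H_infty f \<phi>
      else if e = -\<infinity> then H_minus_infty f \<phi>
      else H_bounded f \<phi> (real_of_ereal e) (real_of_ereal h))"


subsection \<open>Forward generalized characteristics\<close>

definition Delta_I ::
  "(real \<Rightarrow> real) \<Rightarrow> (real \<Rightarrow> real) \<Rightarrow> real \<Rightarrow> real \<Rightarrow> (real \<times> real) set" where
  "Delta_I f \<phi> x t =
     {(\<xi>, \<tau>). 0 < \<tau> \<and> \<tau> < t \<and>
        (\<exists>v\<in>{u_plus f \<phi> x t..u_minus f \<phi> x t}. \<xi> = x + (\<tau> - t) * deriv f v)}"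

text \<open>Only the restriction of \<open>X\<close> to \<open>{t0..}\<close> matters.\<close>

definition fwd_gen_char ::
  "(real \<Rightarrow> real) \<Rightarrow> (real \<Rightarrow> real) \<Rightarrow> real \<Rightarrow> real \<Rightarrow> (real \<Rightarrow> real) \<Rightarrow> bool" where
  "fwd_gen_char f \<phi> x0 t0 X \<longleftrightarrow>
     continuous_on {t0..} X \<and> X t0 = x0 \<and>
     (\<forall>t1 t2. t0 < t1 \<and> t1 < t2 \<longrightarrow>
        Delta_I f \<phi> x0 t0 \<subseteq> Delta_I f \<phi> (X t1) t1 \<and>
        Delta_I f \<phi> (X t1) t1 \<subseteq> Delta_I f \<phi> (X t2) t2)"

definition fwd_gen_char_from_axis ::
  "(real \<Rightarrow> real) \<Rightarrow> (real \<Rightarrow> real) \<Rightarrow> real \<Rightarrow> (real \<Rightarrow> real) \<Rightarrow> bool" where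
  "fwd_gen_char_from_axis f \<phi> x0 X \<longleftrightarrow>
     continuous_on {0..} X \<and> X 0 = x0 \<and> (\<forall>t0>0. fwd_gen_char f \<phi> (X t0) t0 X)"

end

theory Submission
  imports Defs
begin

text \<open>
  Substituting \<open>y = x - t f' u\<close> turns the maximizers of \<open>E\<close> into minimizers of the Hopf-Lax functional
  \<open>\<Phi> (x - t f' u) + t (u f' u - f u)\<close>. Subtracting a line of slope \<open>c\<close> from \<open>\<Phi>\<close> replaces the
  second term by \<open>t B\<close>, where \<open>B\<close> is the Bregman divergence of \<open>f\<close> between \<open>u\<close> and \<open>c\<close>; comparing a
  maximizer \<open>u\<close> with the competitor \<open>c\<close> gives
  \<open>t B \<le> \<psi> (x - t f' c) - \<psi> (x - t f' u)\<close> for \<open>\<psi> y = \<Phi> y - c y\<close>. When the right-hand side is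
  \<open>O (1 + \<bar>t (f' u - f' c)\<bar> powr \<gamma>)\<close>, the power asymptotics of \<open>f''\<close> at \<open>c\<close> yield the rates. In a
  bounded gap the competitor is instead the characteristic through the nearer end point, which
  produces the factor \<open>(h - e) / 2\<close>. Divides are the supporting lines of \<open>\<Phi>\<close>, hence those of the
  convex hull at the points of \<open>\<K>\<^sub>0\<close>, and on the gaps the hull is affine.
\<close>

section \<open>The flux\<close>

text \<open>Only an upper bound for \<open>\<psi>\<close> at the competitor's foot minus
  \<open>\<psi>\<close> at the maximizer's foot is needed. This matters because the data have slopes
  \<open>l\<close> and \<open>r\<close> on the two half-lines, while the two feet may lie on
  different sides. In an unbounded gap the supporting line at its end deals with a maximizer's foot
  beyond that end. For \<open>l > r\<close> it is the competitor's foot that may stray across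
  \<open>x0\<close>; there \<open>\<psi>\<close> drops linearly, which outweighs the sublinear
  deviation. The exponents express a balance: with \<open>w = \<bar>u - c\<bar>\<close> the
  divergence is of order \<open>w powr (2 + a)\<close> and the shift of the foot of order
  \<open>t * w powr (1 + a)\<close>, so \<open>t * w powr (2 + a)\<close> is equated with
  \<open>(t * w powr (1 + a)) powr \<gamma>\<close>. In a bounded gap, where the deviation is merely
  bounded, this would give the exponent \<open>1 / (2 + a)\<close>, short of the asserted
  \<open>1 / (1 + a)\<close>; a competitor whose foot is an end point, where \<open>\<psi>\<close>
  is least, leaves only divergences to compare.\<close>

locale convex_flux =
  fixes f :: "real \<Rightarrow> real"
  assumes f_C2: "C2 f"
    and f_convex: "deriv (deriv f) s \<ge> 0"
    and f_null: "emeasure lebesgue {s. deriv (deriv f) s = 0} = 0"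
begin

abbreviation "df \<equiv> deriv f"
abbreviation "ddf \<equiv> deriv (deriv f)"

lemma DERIV_f: "(f has_real_derivative df x) (at x)"
  using f_C2 unfolding C2_def by (simp add: DERIV_deriv_iff_real_differentiable differentiable_on_def)

lemma DERIV_df: "(df has_real_derivative ddf x) (at x)"
  using f_C2 unfolding C2_def by (simp add: DERIV_deriv_iff_real_differentiable differentiable_on_def)

lemma continuous_on_ddf: "continuous_on S ddf"
  using f_C2 continuous_on_subset unfolding C2_def by blast

lemma isCont_df: "isCont df x"
  using DERIV_df DERIV_isCont by blast

lemma isCont_f: "isCont f x"
  using DERIV_f DERIV_isCont by blast

lemma continuous_on_df: "continuous_on S df"
  using isCont_df by (simp add: continuous_at_imp_continuous_on)

lemma continuous_on_f: "continuous_on S f"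
  using isCont_f by (simp add: continuous_at_imp_continuous_on)

lemma df_mono: "x \<le> y \<Longrightarrow> df x \<le> df y"
  using DERIV_nonneg_imp_nondecreasing[of x y df] DERIV_df f_convex by blast

text \<open>If \<open>df x = df y\<close>, monotonicity makes \<open>df\<close> constant on
  \<open>{x..y}\<close>, so \<open>ddf\<close> vanishes on an interval of positive measure, against
  \<open>f_null\<close>.\<close>

lemma df_strict_mono: assumes "x < y" shows "df x < df y"
proof (rule ccontr)
  assume "\<not> df x < df y"
  then have eq: "df z = df x" if "z \<in> {x..y}" for z
    using that df_mono[of x z] df_mono[of z y] by auto
  have "ddf z = 0" if z: "z \<in> {x<..<y}" for z
  proof -
    have "((\<lambda>_. df x) has_real_derivative ddf z) (at z)"
      by (rule has_field_derivative_transform_within_open[OF DERIV_df, where S = "{x<..<y}"])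
         (use z in \<open>auto intro: eq\<close>)
    then show ?thesis using DERIV_const DERIV_unique by blast
  qed
  then have sub: "{x<..<y} \<subseteq> {s. ddf s = 0}" by auto
  have "{s. ddf s = 0} \<in> sets lebesgue"
  proof -
    have "closed {s. ddf s = 0}"
      using continuous_closed_preimage_constant[of UNIV ddf 0] continuous_on_ddf by auto
    then show ?thesis by (simp add: borel_closed)
  qed
  then have "emeasure lebesgue {x<..<y} \<le> emeasure lebesgue {s. ddf s = 0}"
    by (rule emeasure_mono[OF sub])
  also have "\<dots> = 0" by (rule f_null)
  finally show False using assms by simp
qed

lemma df_less_iff: "df x < df y \<longleftrightarrow> x < y"
  using df_strict_mono by (metis less_asym' linorder_neqE_linordered_idom order_less_irrefl)

lemma df_le_iff: "df x \<le> df y \<longleftrightarrow> x \<le> y"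
  using df_less_iff by (metis not_le)

lemma df_eq_iff: "df x = df y \<longleftrightarrow> x = y"
  using df_le_iff by (metis order_antisym order_refl)

lemma df_inj: "inj df"
  using df_eq_iff by (simp add: inj_def)

text \<open>Replaces inverting \<open>df\<close>, whose range may be a proper interval: a speed
  between two attained speeds belongs to a state between the corresponding states.\<close>

lemma df_IVT:
  assumes "df a \<le> p" "p \<le> df b"
  obtains v where "a \<le> v" "v \<le> b" "df v = p"
proof -
  have "a \<le> b" using assms df_le_iff order_trans by blast
  then show ?thesis
    using IVT[of df a p b] assms isCont_df that by blast
qed

text \<open>The Bregman divergence of \<open>f\<close>: the Legendre transform of \<open>f\<close> at \<open>f' u\<close> minus its linearization
  at \<open>f' c\<close>.\<close>

definition breg :: "real \<Rightarrow> real \<Rightarrow> real" where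
  "breg c u = (u - c) * df u - f u + f c"

definition leg :: "real \<Rightarrow> real" where
  "leg u = u * df u - f u"

text \<open>With feet \<open>x - t * df u\<close>, \<open>t\<close> times the linear term is the
  change of \<open>c * y\<close> between the two feet, so it is absorbed when a line of slope
  \<open>c\<close> is subtracted from the primitive.\<close>

lemma leg_diff: "leg u - leg c = breg c u + c * (df u - df c)"
  unfolding leg_def breg_def by (simp add: algebra_simps)

text \<open>What remains after the \<open>df\<close> terms cancel is, up to the factor
  \<open>- t\<close>, the part of the integrand of \<open>E_fun\<close> that is free of the
  data.\<close>

lemma DERIV_leg: "(leg has_real_derivative u * ddf u) (at u)"
  unfolding leg_def [abs_def]
  by (rule derivative_eq_intros DERIV_f DERIV_df refl | simp)+

lemma DERIV_breg: "(breg c has_real_derivative (u - c) * ddf u) (at u)"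
  unfolding breg_def [abs_def]
  by (rule derivative_eq_intros DERIV_f DERIV_df refl | simp)+

lemma breg_self [simp]: "breg c c = 0"
  by (simp add: breg_def)

lemma breg_mono_right: "c \<le> u \<Longrightarrow> u \<le> v \<Longrightarrow> breg c u \<le> breg c v"
  by (rule DERIV_nonneg_imp_nondecreasing) (use DERIV_breg f_convex in \<open>force+\<close>)

lemma breg_mono_left: "v \<le> u \<Longrightarrow> u \<le> c \<Longrightarrow> breg c u \<le> breg c v"
  by (rule DERIV_nonpos_imp_nonincreasing)
     (use DERIV_breg f_convex in \<open>force simp: mult_nonpos_nonneg\<close>)+

lemma breg_pos: assumes "u \<noteq> c" shows "breg c u > 0"
proof (cases "c < u")
  case True
  then obtain z where z: "c < z" "z < u" "f u - f c = (u - c) * df z"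
    using MVT2[of c u f df] DERIV_f by blast
  have "breg c u = (u - c) * (df u - df z)" using z(3) by (simp add: breg_def algebra_simps)
  then show ?thesis using True df_strict_mono[OF z(2)] by simp
next
  case False
  with assms have "u < c" by simp
  then obtain z where z: "u < z" "z < c" "f c - f u = (c - u) * df z"
    using MVT2[of u c f df] DERIV_f by blast
  have "breg c u = (c - u) * (df z - df u)" using z(3) by (simp add: breg_def algebra_simps)
  then show ?thesis using \<open>u < c\<close> df_strict_mono[OF z(1)] by simp
qed

lemma breg_nonneg: "breg c u \<ge> 0"
  using breg_pos by (metis breg_self less_eq_real_def)

lemma breg_sum: "breg c u + breg u c = (u - c) * (df u - df c)"
  by (simp add: breg_def algebra_simps)

text \<open>\<open>breg_sum\<close> with the reversed divergence dropped. It shows that competitors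
  with state near \<open>c\<close> cost little relative to the shift of their foot.\<close>

lemma breg_le: "breg c u \<le> \<bar>u - c\<bar> * \<bar>df u - df c\<bar>"
proof -
  have "breg c u \<le> (u - c) * (df u - df c)"
    using breg_sum[of c u] breg_nonneg[of u c] by linarith
  also have "\<dots> \<le> \<bar>u - c\<bar> * \<bar>df u - df c\<bar>"
    by (metis abs_ge_self abs_mult)
  finally show ?thesis .
qed

end

section \<open>The primitive of bounded data\<close>

text \<open>Names the bound left existential in \<open>L_infinity\<close>: the same \<open>M\<close>
  is a Lipschitz constant of the primitive and bounds the maximizers and the slopes of the
  hull.\<close>

definition ess_bound :: "(real \<Rightarrow> real) \<Rightarrow> real \<Rightarrow> bool" where
  "ess_bound \<phi> M \<longleftrightarrow> \<phi> \<in> borel_measurable lebesgue \<and> (AE x in lebesgue. \<bar>\<phi> x\<bar> \<le> M)"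

lemma ess_bound_nonneg: assumes "ess_bound \<phi> M" shows "M \<ge> 0"
proof (rule ccontr)
  assume "\<not> M \<ge> 0"
  have "AE x in lebesgue. \<bar>\<phi> x\<bar> \<le> M" using assms unfolding ess_bound_def by blast
  moreover have "\<bar>\<phi> x\<bar> \<le> M \<longleftrightarrow> False" for x using \<open>\<not> M \<ge> 0\<close> by auto
  ultimately have "AE x in lebesgue :: real measure. False" by (simp only:)
  then show False by (simp add: eventually_False ae_filter_eq_bot_iff emeasure_lborel_UNIV)
qed

lemma ess_bound_absolutely_integrable:
  assumes "ess_bound \<phi> M" shows "\<phi> absolutely_integrable_on {a..b}"
proof -
  have "integrable lebesgue (\<lambda>x. indicat_real {a..b} x * M)"
    by (intro integrable_mult_left integrable_real_indicator) (auto simp: emeasure_lborel_Icc_eq)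
  then show ?thesis
    unfolding set_integrable_def
    by (rule Bochner_Integration.integrable_bound)
       (use assms in \<open>auto simp: ess_bound_def elim!: eventually_mono split: split_indicator
          intro!: borel_measurable_times borel_measurable_indicator\<close>)
qed

text \<open>Passes to the gauge integral, for which combination of intervals, change of variables
  and the fundamental theorem are applied.\<close>

lemma LINT_interval_eq_integral:
  fixes F :: "real \<Rightarrow> real"
  assumes "F absolutely_integrable_on {a..b}" "a \<le> b"
  shows "(LINT x=ereal a..ereal b|lebesgue. F x) = integral {a..b} F"
proof -
  have "(LINT x=ereal a..ereal b|lebesgue. F x) = (LINT x:{a<..<b}|lebesgue. F x)"
    using assms by (simp add: interval_lebesgue_integral_le_eq)
  also have "\<dots> = integral {a<..<b} F"
    by (rule set_lebesgue_integral_eq_integral(2))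
       (rule set_integrable_subset[OF assms(1)], auto)
  finally show ?thesis by (simp add: integral_open_interval_real)
qed

lemma LINT_interval_swap:
  fixes F :: "real \<Rightarrow> real"
  shows "(LINT x=ereal b..ereal a|lebesgue. F x) = - (LINT x=ereal a..ereal b|lebesgue. F x)"
  by (cases a b rule: linorder_cases)
     (auto simp: interval_lebesgue_integral_gt_eq' interval_lebesgue_integral_def einterval_same
        set_lebesgue_integral_def)

context
  fixes \<phi> :: "real \<Rightarrow> real" and M :: real
  assumes bound: "ess_bound \<phi> M"
begin

lemma LINT_interval_eq_Phi:
  "(LINT x=ereal a..ereal b|lebesgue. \<phi> x) = Phi \<phi> b - Phi \<phi> a"
proof -
  have Icc: "(LINT x=ereal a..ereal b|lebesgue. \<phi> x) = integral {a..b} \<phi>" if "a \<le> b" for a b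
    using LINT_interval_eq_integral ess_bound_absolutely_integrable[OF bound] that by blast
  have comb: "integral {a..c} \<phi> = integral {a..b} \<phi> + integral {b..c} \<phi>" if "a \<le> b" "b \<le> c" for a b c
    using that ess_bound_absolutely_integrable[OF bound, of a c]
    by (intro Henstock_Kurzweil_Integration.integral_combine[symmetric])
       (auto simp: set_lebesgue_integral_eq_integral)
  have P: "Phi \<phi> x = (if 0 \<le> x then integral {0..x} \<phi> else - integral {x..0} \<phi>)" for x
    unfolding Phi_def using Icc LINT_interval_swap[of x 0 \<phi>] by auto
  have le: "(LINT x=ereal a..ereal b|lebesgue. \<phi> x) = Phi \<phi> b - Phi \<phi> a" if "a \<le> b" for a b
    using that comb[of 0 a b] comb[of a 0 b] comb[of a b 0] by (auto simp: P Icc)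
  show ?thesis
    using le[of a b] le[of b a] LINT_interval_swap[of a b \<phi>] by linarith
qed

text \<open>Center and radius are free: \<open>m = 0\<close> gives the Lipschitz bound, while the
  middle value of the hull slopes over an interval later identifies the primitive of
  \<open>phi_bar\<close>.\<close>

lemma Phi_diff_bound:
  assumes "x \<le> y" and ae: "AE z in lebesgue. z \<in> {x..y} \<longrightarrow> \<bar>\<phi> z - m\<bar> \<le> r"
  shows "\<bar>Phi \<phi> y - Phi \<phi> x - m * (y - x)\<bar> \<le> r * (y - x)"
proof -
  have ai: "\<phi> absolutely_integrable_on {x..y}" by (rule ess_bound_absolutely_integrable[OF bound])
  have aim: "(\<lambda>z. c) absolutely_integrable_on {x..y}" for c :: real
    by (intro absolutely_integrable_continuous_real continuous_intros)
  have ai2: "(\<lambda>z. \<phi> z - m) absolutely_integrable_on {x..y}"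
    using ai aim by (rule set_integral_diff)
  have "Phi \<phi> y - Phi \<phi> x - m * (y - x) = integral {x..y} \<phi> - integral {x..y} (\<lambda>z. m)"
    using LINT_interval_eq_Phi[of x y] LINT_interval_eq_integral[OF ai \<open>x \<le> y\<close>] \<open>x \<le> y\<close> by simp
  also have "\<dots> = integral {x..y} (\<lambda>z. \<phi> z - m)"
    using ai aim by (intro Henstock_Kurzweil_Integration.integral_diff[symmetric])
      (auto intro: set_lebesgue_integral_eq_integral(1))
  also have "\<dots> = (LINT z:{x..y}|lebesgue. \<phi> z - m)"
    by (rule set_lebesgue_integral_eq_integral(2)[OF ai2, symmetric])
  also have "\<bar>\<dots>\<bar> \<le> (LINT z:{x..y}|lebesgue. \<bar>\<phi> z - m\<bar>)"
    using set_integral_norm_bound[OF ai2] by simp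
  also have "\<dots> \<le> (LINT z:{x..y}|lebesgue. r)"
    unfolding set_lebesgue_integral_def
  proof (rule integral_mono_AE)
    show "integrable lebesgue (\<lambda>z. indicat_real {x..y} z *\<^sub>R \<bar>\<phi> z - m\<bar>)"
      using set_integrable_norm[OF ai2] by (simp add: set_integrable_def)
    show "integrable lebesgue (\<lambda>z. indicat_real {x..y} z *\<^sub>R r)"
      using aim[of r] by (simp add: set_integrable_def)
    show "AE z in lebesgue. indicat_real {x..y} z *\<^sub>R \<bar>\<phi> z - m\<bar> \<le> indicat_real {x..y} z *\<^sub>R r"
      using ae by (auto simp: indicator_def elim!: eventually_mono)
  qed
  also have "\<dots> = r * (y - x)"
    using \<open>x \<le> y\<close> by (simp add: set_lebesgue_integral_def)
  finally show ?thesis .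
qed

lemma Phi_lipschitz: "\<bar>Phi \<phi> y - Phi \<phi> x\<bar> \<le> M * \<bar>y - x\<bar>"
proof -
  have ae: "AE z in lebesgue. z \<in> A \<longrightarrow> \<bar>\<phi> z - 0\<bar> \<le> M" for A
    using bound by (auto simp: ess_bound_def elim!: eventually_mono)
  show ?thesis
    using Phi_diff_bound[OF _ ae, of x y] Phi_diff_bound[OF _ ae, of y x] by (cases "x \<le> y") auto
qed

lemma Phi_isCont: "isCont (Phi \<phi>) x"
proof -
  have "M-lipschitz_on UNIV (Phi \<phi>)"
    using Phi_lipschitz ess_bound_nonneg[OF bound]
    by (intro lipschitz_onI) (auto simp: dist_real_def abs_minus_commute)
  then have "continuous_on UNIV (Phi \<phi>)" by (rule lipschitz_on_continuous_on)
  then show ?thesis by (simp add: continuous_on_eq_continuous_at)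
qed

end

section \<open>Maximizers as minimizers of the Hopf-Lax functional\<close>

context convex_flux
begin

text \<open>Parametrized by the state \<open>u\<close> instead of the foot, so that no inverse of
  \<open>df\<close> appears and the minimizers are the maximizers of \<open>E_fun\<close>
  themselves.\<close>

definition hopf_lax :: "(real \<Rightarrow> real) \<Rightarrow> real \<Rightarrow> real \<Rightarrow> real \<Rightarrow> real" where
  "hopf_lax F x t u = F (x - t * df u) + t * leg u"

context
  fixes \<phi> :: "real \<Rightarrow> real" and M :: real
  assumes bound: "ess_bound \<phi> M"
begin

text \<open>The substitution \<open>y = x - t * df s\<close> turns the data term into an increment
  of \<open>Phi\<close>, and \<open>t * (s * ddf s)\<close> integrates to \<open>t * leg\<close>.
  The change of variables rests on injectivity of \<open>y\<close>, so zeros of \<open>ddf\<close>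
  do no harm, and it admits data that are merely bounded and measurable.\<close>

lemma E_fun_eq_aux:
  assumes "t > 0" "a \<le> b"
  shows "t * (LINT s=ereal a..ereal b|lebesgue. (ddf s * (\<phi> (x - t * df s) - s)))
    = hopf_lax (Phi \<phi>) x t a - hopf_lax (Phi \<phi>) x t b"
proof -
  define y where "y s = x - t * df s" for s
  have img: "y ` {a..b} = {y b..y a}"
  proof (intro equalityI subsetI)
    fix z assume "z \<in> y ` {a..b}"
    then show "z \<in> {y b..y a}" using assms df_mono by (auto simp: y_def mult_left_mono)
  next
    fix z assume "z \<in> {y b..y a}"
    then have "df a \<le> (x - z) / t" "(x - z) / t \<le> df b"
      using assms by (auto simp: y_def field_simps)
    then obtain v where "a \<le> v" "v \<le> b" "df v = (x - z) / t" by (rule df_IVT)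
    then show "z \<in> y ` {a..b}" using assms by (auto simp: y_def intro!: image_eqI[of _ _ v])
  qed
  have yba: "y b \<le> y a" using assms df_mono by (simp add: y_def mult_left_mono)
  have cov: "(\<lambda>s. \<bar>- (t * ddf s)\<bar> * \<phi> (y s)) absolutely_integrable_on {a..b} \<and>
     integral {a..b} (\<lambda>s. \<bar>- (t * ddf s)\<bar> * \<phi> (y s)) = integral {y b..y a} \<phi>"
  proof (rule has_absolute_integral_change_of_variables_1'
      [where g = y and f = \<phi> and S = "{a..b}" and g' = "\<lambda>s. - (t * ddf s)", THEN iffD2])
    show "(y has_real_derivative - (t * ddf s)) (at s within {a..b})" for s
      unfolding y_def [abs_def]
      by (rule derivative_eq_intros DERIV_df[THEN DERIV_subset] refl | simp)+
    show "inj_on y {a..b}" using assms by (auto simp: inj_on_def y_def df_eq_iff)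
    show "\<phi> absolutely_integrable_on y ` {a..b} \<and> integral (y ` {a..b}) \<phi> = integral {y b..y a} \<phi>"
      using ess_bound_absolutely_integrable[OF bound] by (simp add: img)
  qed simp
  have abs: "\<bar>- (t * ddf s)\<bar> * z = t * (ddf s * z)" for s z
    using assms f_convex[of s] by (simp add: abs_mult)
  have ai1: "(\<lambda>s. t * (ddf s * \<phi> (y s))) absolutely_integrable_on {a..b}"
    and int1: "integral {a..b} (\<lambda>s. t * (ddf s * \<phi> (y s))) = integral {y b..y a} \<phi>"
    using cov unfolding abs by blast+
  have ai2: "(\<lambda>s. t * (s * ddf s)) absolutely_integrable_on {a..b}"
    by (intro absolutely_integrable_continuous_real continuous_intros continuous_on_ddf)
  have int2: "integral {a..b} (\<lambda>s. t * (s * ddf s)) = t * leg b - t * leg a"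
    by (intro integral_unique fundamental_theorem_of_calculus assms)
       (auto simp flip: has_real_derivative_iff_has_vector_derivative
         intro!: DERIV_cmult DERIV_leg[THEN DERIV_subset])
  have "t * (LINT s=ereal a..ereal b|lebesgue. (ddf s * (\<phi> (x - t * df s) - s)))
     = (LINT s=ereal a..ereal b|lebesgue. (t * (ddf s * \<phi> (y s)) - t * (s * ddf s)))"
    by (subst interval_lebesgue_integral_mult_right[symmetric]) (simp add: y_def algebra_simps)
  also have "\<dots> = integral {a..b} (\<lambda>s. t * (ddf s * \<phi> (y s)) - t * (s * ddf s))"
    using assms ai1 ai2 by (intro LINT_interval_eq_integral set_integral_diff) auto
  also have "\<dots> = integral {y b..y a} \<phi> - (t * leg b - t * leg a)"
    by (subst Henstock_Kurzweil_Integration.integral_diff)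
       (auto simp only: int1 int2 intro: set_lebesgue_integral_eq_integral(1) ai1 ai2)
  also have "integral {y b..y a} \<phi> = Phi \<phi> (y a) - Phi \<phi> (y b)"
    using LINT_interval_eq_Phi[OF bound] LINT_interval_eq_integral[OF _ yba, of \<phi>]
      ess_bound_absolutely_integrable[OF bound] by metis
  finally show ?thesis by (simp add: hopf_lax_def y_def)
qed

lemma E_fun_eq:
  assumes "t > 0"
  shows "E_fun f \<phi> u x t = hopf_lax (Phi \<phi>) x t 0 - hopf_lax (Phi \<phi>) x t u"
proof (cases "0 \<le> u")
  case True
  then show ?thesis unfolding E_fun_def by (rule E_fun_eq_aux[OF assms])
next
  case False
  then show ?thesis unfolding E_fun_def
    using E_fun_eq_aux[OF assms, of u 0 x] LINT_interval_swap[of 0 u] by simp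
qed

lemma mem_maximizers_iff:
  assumes "t > 0"
  shows "u \<in> maximizers f \<phi> x t
    \<longleftrightarrow> (\<forall>v. hopf_lax (Phi \<phi>) x t u \<le> hopf_lax (Phi \<phi>) x t v)"
  using assms by (auto simp: maximizers_def E_fun_eq)

text \<open>Returning from \<open>u\<close> to the nearer of \<open>M\<close> and \<open>- M\<close>
  changes \<open>Phi\<close> by at most \<open>M\<close> times the shift of the foot, which is
  exactly the linear part in \<open>leg_diff\<close>; the strict gain is the divergence.\<close>

lemma hopf_lax_gt_bound:
  assumes "t > 0"
  shows "u > M \<Longrightarrow> hopf_lax (Phi \<phi>) x t M < hopf_lax (Phi \<phi>) x t u"
    and "u < -M \<Longrightarrow> hopf_lax (Phi \<phi>) x t (-M) < hopf_lax (Phi \<phi>) x t u"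
proof -
  show "hopf_lax (Phi \<phi>) x t M < hopf_lax (Phi \<phi>) x t u" if "u > M"
  proof -
    have "\<bar>(x - t * df u) - (x - t * df M)\<bar> = t * (df u - df M)"
      using assms df_strict_mono[OF that] by (simp add: abs_if algebra_simps)
    then have "Phi \<phi> (x - t * df M) - Phi \<phi> (x - t * df u) \<le> t * (M * (df u - df M))"
      using Phi_lipschitz[OF bound, of "x - t * df u" "x - t * df M"]
      by (simp add: mult.left_commute)
    also have "\<dots> < t * (leg u - leg M)"
      using assms breg_pos[of u M] that by (simp add: leg_diff)
    finally show ?thesis by (simp add: hopf_lax_def algebra_simps)
  qed
  show "hopf_lax (Phi \<phi>) x t (-M) < hopf_lax (Phi \<phi>) x t u" if "u < -M"
  proof -
    have "\<bar>(x - t * df u) - (x - t * df (-M))\<bar> = t * (df (-M) - df u)"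
      using assms df_strict_mono[OF that] by (simp add: abs_if algebra_simps)
    then have "Phi \<phi> (x - t * df (-M)) - Phi \<phi> (x - t * df u) \<le> t * (-M * (df u - df (-M)))"
      using Phi_lipschitz[OF bound, of "x - t * df u" "x - t * df (-M)"]
      by (simp add: algebra_simps)
    also have "\<dots> < t * (leg u - leg (-M))"
      by (rule mult_strict_left_mono[OF _ assms]) (use breg_pos[of u "-M"] that in \<open>simp add: leg_diff\<close>)
    finally show ?thesis by (simp add: hopf_lax_def algebra_simps)
  qed
qed

lemma maximizers_bounded:
  assumes "t > 0" "u \<in> maximizers f \<phi> x t"
  shows "\<bar>u\<bar> \<le> M"
  using hopf_lax_gt_bound[OF assms(1), of u x] assms
  by (simp add: mem_maximizers_iff) (smt (verit))

lemma continuous_on_hopf_lax: "continuous_on S (hopf_lax (Phi \<phi>) x t)"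
proof -
  have "continuous_on S (\<lambda>u. Phi \<phi> (x - t * df u))"
  proof (rule continuous_on_compose2[where g = "Phi \<phi>" and f = "\<lambda>u. x - t * df u" and t = UNIV])
    show "continuous_on UNIV (Phi \<phi>)"
      by (simp add: continuous_at_imp_continuous_on Phi_isCont[OF bound])
    show "continuous_on S (\<lambda>u. x - t * df u)"
      by (intro continuous_intros continuous_on_df)
  qed simp
  moreover have "continuous_on S (\<lambda>u. t * leg u)"
    unfolding leg_def [abs_def] by (intro continuous_intros continuous_on_df continuous_on_f)
  ultimately show ?thesis
    unfolding hopf_lax_def [abs_def] by (rule continuous_on_add)
qed

lemma maximizers_nonempty:
  assumes "t > 0" shows "maximizers f \<phi> x t \<noteq> {}"
proof -
  have "compact {-M..M}" "{-M..M} \<noteq> {}" using ess_bound_nonneg[OF bound] by auto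
  then obtain u where u: "u \<in> {-M..M}"
    "\<forall>v\<in>{-M..M}. hopf_lax (Phi \<phi>) x t u \<le> hopf_lax (Phi \<phi>) x t v"
    using continuous_attains_inf[OF _ _ continuous_on_hopf_lax] by metis
  have "hopf_lax (Phi \<phi>) x t u \<le> hopf_lax (Phi \<phi>) x t v" for v
  proof -
    have "-M \<le> M" using ess_bound_nonneg[OF bound] by simp
    then consider "v \<in> {-M..M}" | "v < -M" "-M \<in> {-M..M}" | "v > M" "M \<in> {-M..M}"
      by fastforce
    then show ?thesis
      using u(2) hopf_lax_gt_bound[OF assms, of v x] by cases (blast intro: less_imp_le order_trans)+
  qed
  then show ?thesis using mem_maximizers_iff[OF assms] by blast
qed

lemma closed_maximizers:
  assumes "t > 0" shows "closed (maximizers f \<phi> x t)"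
proof -
  have "maximizers f \<phi> x t = (\<Inter>v. {u. hopf_lax (Phi \<phi>) x t u \<le> hopf_lax (Phi \<phi>) x t v})"
    using mem_maximizers_iff[OF assms] by auto
  moreover have "closed {u. hopf_lax (Phi \<phi>) x t u \<le> c}" for c
    by (intro closed_Collect_le continuous_on_hopf_lax continuous_on_const)
  ultimately show ?thesis by auto
qed

lemma Inf_mem_maximizers:
  assumes "t > 0" shows "Inf (maximizers f \<phi> x t) \<in> maximizers f \<phi> x t"
  using maximizers_bounded[OF assms]
  by (intro closed_contains_Inf maximizers_nonempty closed_maximizers assms bdd_belowI[of _ "-M"])
     (smt (verit))

lemma Sup_mem_maximizers:
  assumes "t > 0" shows "Sup (maximizers f \<phi> x t) \<in> maximizers f \<phi> x t"
  using maximizers_bounded[OF assms]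
  by (intro closed_contains_Sup maximizers_nonempty closed_maximizers assms bdd_aboveI[of _ M])
     (smt (verit))

lemma entropy_sol_mem: "t > 0 \<Longrightarrow> entropy_sol f \<phi> x t \<in> maximizers f \<phi> x t"
  unfolding entropy_sol_def by (rule Inf_mem_maximizers)

text \<open>The free competitor \<open>v\<close> has two uses: \<open>v = c\<close> makes its
  divergence vanish, and in a bounded gap \<open>v\<close> is aimed at an end point, where
  \<open>Phi \<phi> y - c * y\<close> is least.\<close>

lemma breg_le_of_maximizer:
  assumes "t > 0" "u \<in> maximizers f \<phi> x t"
  shows "t * breg c u \<le> t * breg c v + (Phi \<phi> (x - t * df v) - c * (x - t * df v))
    - (Phi \<phi> (x - t * df u) - c * (x - t * df u))"
proof -
  have "hopf_lax (Phi \<phi>) x t u \<le> hopf_lax (Phi \<phi>) x t v"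
    using assms mem_maximizers_iff by blast
  moreover have "leg u = leg c + breg c u + c * (df u - df c)"
    "leg v = leg c + breg c v + c * (df v - df c)"
    using leg_diff[of u c] leg_diff[of v c] by auto
  ultimately show ?thesis by (simp add: hopf_lax_def algebra_simps)
qed

text \<open>Backward characteristics do not cross: otherwise exchanging the two feet would contradict
  the strict convexity of the Legendre transform.\<close>

lemma maximizers_feet_mono:
  assumes t: "t > 0" and "x1 < x2"
    and u1: "u1 \<in> maximizers f \<phi> x1 t" and u2: "u2 \<in> maximizers f \<phi> x2 t"
  shows "x1 - t * df u1 \<le> x2 - t * df u2"
proof (rule ccontr)
  assume "\<not> ?thesis"
  then have gt: "x2 - t * df u2 < x1 - t * df u1" by simp
  define \<delta> where "\<delta> = (x2 - x1) / t"
  have \<delta>: "\<delta> > 0" "t * \<delta> = x2 - x1" using assms by (auto simp: \<delta>_def)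
  have "t * (df u1 + \<delta>) < t * df u2" using gt \<delta> by (simp add: algebra_simps)
  then have lt: "df u1 + \<delta> < df u2" using t by simp
  \<comment> \<open>\<open>v\<close> aims the characteristic from \<open>(x2, t)\<close> at the foot
    of \<open>u1\<close>, and \<open>w\<close> the one from \<open>(x1, t)\<close> at the foot of
    \<open>u2\<close>. In the sum of the two minimality inequalities all values of
    \<open>Phi\<close> then cancel.\<close>
  obtain v where v: "u1 \<le> v" "v \<le> u2" "df v = df u1 + \<delta>"
    using df_IVT[of u1 "df u1 + \<delta>" u2] lt \<delta> by auto
  obtain w where w: "u1 \<le> w" "w \<le> u2" "df w = df u2 - \<delta>"
    using df_IVT[of u1 "df u2 - \<delta>" u2] lt \<delta> by auto
  have eq: "x2 - t * df v = x1 - t * df u1" "x1 - t * df w = x2 - t * df u2"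
    using \<delta> by (auto simp: v w algebra_simps)
  have "hopf_lax (Phi \<phi>) x1 t u1 \<le> hopf_lax (Phi \<phi>) x1 t w"
    "hopf_lax (Phi \<phi>) x2 t u2 \<le> hopf_lax (Phi \<phi>) x2 t v"
    using u1 u2 mem_maximizers_iff[OF t] by auto
  then have "t * (leg u1 + leg u2) \<le> t * (leg v + leg w)"
    unfolding hopf_lax_def eq distrib_left by linarith
  then have le: "leg u1 + leg u2 \<le> leg v + leg w" using t by simp
  have ne: "v \<noteq> u1" "v \<noteq> u2" "w \<noteq> u1" "w \<noteq> u2" using v w lt \<delta> by auto
  show False
  \<comment> \<open>Each inner speed is compared with the outer speed next to it. The speed
    differences within the two pairs are equal, so the strict tangent inequalities for
    \<open>leg\<close> add up with a favourable sign.\<close>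
  proof (cases "v \<le> w")
    case True
    have "leg u2 - leg w > w * \<delta>" using leg_diff[of u2 w] breg_pos[of u2 w] ne w by simp
    moreover have "leg u1 - leg v > - (v * \<delta>)" using leg_diff[of u1 v] breg_pos[of u1 v] ne v by simp
    moreover have "v * \<delta> \<le> w * \<delta>" using True \<delta> by (simp add: mult_right_mono)
    ultimately show False using le by simp
  next
    case False
    define \<eta> where "\<eta> = df u2 - df v"
    have "\<eta> > 0" using lt v by (simp add: \<eta>_def)
    have "leg u2 - leg v > v * \<eta>" using leg_diff[of u2 v] breg_pos[of u2 v] ne by (simp add: \<eta>_def)
    moreover have "leg u1 - leg w > - (w * \<eta>)"
      using leg_diff[of u1 w] breg_pos[of u1 w] ne v w by (simp add: \<eta>_def algebra_simps)
    moreover have "w * \<eta> \<le> v * \<eta>" using False \<open>\<eta> > 0\<close> by (simp add: mult_right_mono)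
    ultimately show False using le by simp
  qed
qed

end

end

section \<open>Supporting lines\<close>

definition supports :: "(real \<Rightarrow> real) \<Rightarrow> real \<Rightarrow> real \<Rightarrow> bool" where
  "supports F c x \<longleftrightarrow> (\<forall>y. F x + c * (y - x) \<le> F y)"

lemma supportsD: "supports F c x \<Longrightarrow> F x + c * (y - x) \<le> F y"
  by (simp add: supports_def)

text \<open>With this and its analogues for deviations, statements at left ends follow from those at
  right ends.\<close>

lemma supports_reflect: "supports (\<lambda>x. F (- x)) c x \<longleftrightarrow> supports F (- c) (- x)"
proof -
  have "(\<forall>y. F (- x) + c * (y - x) \<le> F (- y)) \<longleftrightarrow> (\<forall>y. F (- x) + c * (- y - x) \<le> F y)"
    by (metis minus_minus)
  then show ?thesis by (simp add: supports_def algebra_simps)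
qed

lemma supports_shift: "supports F c x \<Longrightarrow> F y = F x + c * (y - x) \<Longrightarrow> supports F c y"
  unfolding supports_def
proof
  fix z assume F: "\<forall>y. F x + c * (y - x) \<le> F y" "F y = F x + c * (y - x)"
  have "F y + c * (z - y) = F x + c * (z - x)" unfolding F(2) by (simp add: algebra_simps)
  then show "F y + c * (z - y) \<le> F z" using F(1) by metis
qed

lemma supports_mono:
  assumes "supports F c x" "supports F d y" "x < y"
  shows "c \<le> d"
proof -
  have "c * (y - x) \<le> d * (y - x)"
    using supportsD[OF assms(1), of y] supportsD[OF assms(2), of x] by (simp add: algebra_simps)
  then show ?thesis using assms(3) by simp
qed

text \<open>The slope is the supremum of the chord slopes from the left, each of which is at most
  every chord slope to the right. Only chords over the one point \<open>x\<close> are involved, so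
  the lemma serves \<open>Phi\<close> at contact points as well as the hull everywhere.\<close>

lemma ex_supports_of_chords:
  assumes "\<And>a b. a < x \<Longrightarrow> x < b \<Longrightarrow> (b - a) * F x \<le> (b - x) * F a + (x - a) * F b"
  shows "\<exists>c. supports F c x"
proof -
  define s where "s a = (F x - F a) / (x - a)" for a
  have s_le: "s a \<le> s b" if "a < x" "x < b" for a b
    using assms[OF that] that by (simp add: s_def field_simps)
  define c where "c = (SUP a\<in>{..<x}. s a)"
  have bdd: "bdd_above (s ` {..<x})"
    by (rule bdd_aboveI[of _ "s (x + 1)"]) (use s_le in auto)
  have "F x + c * (y - x) \<le> F y" for y
  proof (rule linorder_cases[of x y])
    assume "x < y"
    then have "c \<le> s y" unfolding c_def by (intro cSUP_least) (auto simp: s_le lessThan_empty_iff)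
    then show ?thesis using \<open>x < y\<close> by (simp add: s_def field_simps)
  next
    assume "y < x"
    then have "s y \<le> c" unfolding c_def by (intro cSUP_upper bdd) auto
    then show ?thesis using \<open>y < x\<close> by (simp add: s_def field_simps)
  qed simp
  then show ?thesis unfolding supports_def by blast
qed

lemma affine_minorant_slope_bound:
  fixes F :: "real \<Rightarrow> real"
  assumes lip: "\<And>x y. \<bar>F y - F x\<bar> \<le> M * \<bar>y - x\<bar>" and le: "\<And>y. l + c * y \<le> F y"
  shows "\<bar>c\<bar> \<le> M"
proof (rule ccontr)
  assume "\<not> \<bar>c\<bar> \<le> M"
  then have pos: "\<bar>c\<bar> - M > 0" by simp
  have "F 0 - l \<ge> 0" using le[of 0] by simp
  \<comment> \<open>At this distance, in the direction in which the line rises, it exceeds what the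
    Lipschitz bound allows by 1.\<close>
  define z where "z = (F 0 - l + 1) / (\<bar>c\<bar> - M)"
  have "z > 0" using \<open>F 0 - l \<ge> 0\<close> pos by (simp add: z_def)
  have "l + \<bar>c\<bar> * z = l + c * (sgn c * z)" by (simp add: abs_sgn mult.assoc)
  also have "\<dots> \<le> F (sgn c * z)" by (rule le)
  also have "\<dots> \<le> F 0 + M * \<bar>sgn c * z\<bar>" using lip[of "sgn c * z" 0] by simp
  also have "\<bar>sgn c * z\<bar> = z"
    using pos \<open>z > 0\<close> lip[of 0 1] by (auto simp: abs_mult sgn_if)
  finally have "(\<bar>c\<bar> - M) * z \<le> F 0 - l" by (simp add: algebra_simps)
  moreover have "(\<bar>c\<bar> - M) * z = F 0 - l + 1" using pos by (simp add: z_def)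
  ultimately show False by simp
qed

lemma attains_min_minus_linear:
  fixes F :: "real \<Rightarrow> real"
  assumes "continuous_on UNIV F" "a \<le> b"
  obtains m where "m \<in> {a..b}" "\<And>y. y \<in> {a..b} \<Longrightarrow> F m - c * m \<le> F y - c * y"
proof -
  have "continuous_on {a..b} (\<lambda>y. F y - c * y)"
    by (intro continuous_intros continuous_on_subset[OF assms(1)]) auto
  then show ?thesis
    using continuous_attains_inf[of "{a..b}" "\<lambda>y. F y - c * y"] assms(2) that by auto
qed

text \<open>A minimum of \<open>F - c y\<close> over the closed gap is a global minimum, hence an end point.\<close>

lemma supports_chord:
  assumes cont: "continuous_on UNIV F" and "e < h"
    and e: "supports F ce e" and h: "supports F ch h"
    and gap: "\<And>x c. e < x \<Longrightarrow> x < h \<Longrightarrow> \<not> supports F c x"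
    and c: "c = (F h - F e) / (h - e)"
  shows "supports F c e" "supports F c h"
proof -
  have Fh: "F h = F e + c * (h - e)" using \<open>e < h\<close> c by simp
  have "ce * (h - e) \<le> c * (h - e)" "c * (h - e) \<le> ch * (h - e)"
    using supportsD[OF e, of h] supportsD[OF h, of e] Fh by (auto simp: algebra_simps)
  then have slopes: "ce \<le> c" "c \<le> ch" using \<open>e < h\<close> by auto
  \<comment> \<open>The chord slope lies between the slopes at the two ends, so outside the gap the
    supporting line at the nearer end keeps \<open>F y - c * y\<close> above its value at that
    end.\<close>
  obtain m where m: "m \<in> {e..h}" "\<And>y. y \<in> {e..h} \<Longrightarrow> F m - c * m \<le> F y - c * y"
    using attains_min_minus_linear[OF cont, of e h c] \<open>e < h\<close> by auto
  have "F m - c * m \<le> F y - c * y" for y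
  proof -
    consider "y < e" | "y \<in> {e..h}" | "y > h" by fastforce
    then show ?thesis
    proof cases
      case 1
      then have "c * (y - e) \<le> ce * (y - e)" using slopes by (intro mult_right_mono_neg) auto
      then have "F e - c * e \<le> F y - c * y"
        using supportsD[OF e, of y] by (simp add: algebra_simps)
      then show ?thesis using m(2) \<open>e < h\<close> by (meson atLeastAtMost_iff less_imp_le order_refl order_trans)
    next
      case 2
      then show ?thesis using m(2) by auto
    next
      case 3
      then have "c * (y - h) \<le> ch * (y - h)" using slopes by (intro mult_right_mono) auto
      then have "F h - c * h \<le> F y - c * y"
        using supportsD[OF h, of y] by (simp add: algebra_simps)
      then show ?thesis using m(2) \<open>e < h\<close> by (meson atLeastAtMost_iff less_imp_le order_refl order_trans)
    qed
  qed
  then have sm: "supports F c m" by (simp add: supports_def algebra_simps)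
  then have "\<not> (e < m \<and> m < h)" using gap by blast
  then have "m = e \<or> m = h" using m(1) by auto
  then show "supports F c e" "supports F c h"
    using sm supports_shift[OF sm] Fh by (auto simp: algebra_simps)
qed

lemma tendsto_quotient_minus_linear:
  fixes F :: "real \<Rightarrow> real"
  assumes "((\<lambda>y. F y / y) \<longlongrightarrow> d) at_top" "c < d"
  shows "filterlim (\<lambda>y. F y - c * y) at_top at_top"
proof -
  have "filterlim (\<lambda>y. (F y / y - c) * y) at_top at_top"
    by (rule filterlim_tendsto_pos_mult_at_top[where c = "d - c"])
       (use assms in \<open>auto intro!: tendsto_intros filterlim_ident\<close>)
  moreover have "\<forall>\<^sub>F y in at_top. (F y / y - c) * y = F y - c * y"
    using eventually_gt_at_top[of 0] by eventually_elim (simp add: field_simps)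
  ultimately show ?thesis by (simp cong: filterlim_cong)
qed

text \<open>For \<open>d < c\<close> the function \<open>F y - d * y\<close> tends to infinity on
  the right, so it has a minimum over \<open>{e..}\<close>, which is global if
  \<open>ce \<le> d\<close>; the gap excludes every point but \<open>e\<close>. For
  \<open>d = c\<close> coercivity may fail, hence the passage to the limit.\<close>

lemma supports_right_gap:
  assumes cont: "continuous_on UNIV F" and lim: "((\<lambda>y. F y / y) \<longlongrightarrow> c) at_top"
    and e: "supports F ce e" and gap: "\<And>x c. e < x \<Longrightarrow> \<not> supports F c x"
  shows "supports F c e"
proof -
  have lower: "supports F d e" if "ce \<le> d" "d < c" for d
  proof -
    have "eventually (\<lambda>y. F e - d * e \<le> F y - d * y) at_top"
      using tendsto_quotient_minus_linear[OF lim \<open>d < c\<close>] by (simp add: filterlim_at_top)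
    then obtain R where R: "\<And>y. y \<ge> R \<Longrightarrow> F e - d * e \<le> F y - d * y"
      by (auto simp: eventually_at_top_linorder)
    obtain m where m: "m \<in> {e..max e R}" "\<And>y. y \<in> {e..max e R} \<Longrightarrow> F m - d * m \<le> F y - d * y"
      using attains_min_minus_linear[OF cont, of e "max e R" d] by auto
    have me: "F m - d * m \<le> F e - d * e" using m by auto
    have "F m - d * m \<le> F y - d * y" for y
    proof -
      consider "y < e" | "y \<in> {e..max e R}" | "y \<ge> R" by fastforce
      then show ?thesis
      proof cases
        case 1
        then have "d * (y - e) \<le> ce * (y - e)" using that by (intro mult_right_mono_neg) auto
        then have "F e - d * e \<le> F y - d * y"
          using supportsD[OF e, of y] by (simp add: algebra_simps)
        then show ?thesis using me by simp
      qed (use m(2) R me in force)+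
    qed
    then have sm: "supports F d m" by (simp add: supports_def algebra_simps)
    then have "\<not> e < m" using gap by blast
    then have "m = e" using m(1) by auto
    then show ?thesis using sm by simp
  qed
  \<comment> \<open>The supporting line at \<open>e\<close> has mean slope \<open>ce\<close> at
    infinity and stays below \<open>F\<close>.\<close>
  have "ce \<le> c"
  proof (rule tendsto_le[OF _ lim])
    have "((\<lambda>y. F e * inverse y + ce * (1 - e * inverse y)) \<longlongrightarrow> F e * 0 + ce * (1 - e * 0)) at_top"
      by (intro tendsto_intros tendsto_inverse_0_at_top filterlim_ident)
    then show "((\<lambda>y. F e / y + ce * (1 - e / y)) \<longlongrightarrow> ce) at_top"
      by (simp add: divide_inverse)
    show "\<forall>\<^sub>F y in at_top. F e / y + ce * (1 - e / y) \<le> F y / y"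
      using eventually_gt_at_top[of 0]
    proof eventually_elim
      case (elim y)
      then have "F e / y + ce * (1 - e / y) = (F e + ce * (y - e)) / y" by (simp add: field_simps)
      also have "\<dots> \<le> F y / y" using elim supportsD[OF e] by (intro divide_right_mono) auto
      finally show ?case .
    qed
  qed simp
  show ?thesis
  proof (cases "ce = c")
    case False
    then have "ce < c" using \<open>ce \<le> c\<close> by simp
    show ?thesis unfolding supports_def
    proof
      fix y
      have "((\<lambda>d. F e + d * (y - e)) \<longlongrightarrow> F e + c * (y - e)) (at_left c)"
        by (intro tendsto_intros)
      moreover have "\<forall>\<^sub>F d in at_left c. F e + d * (y - e) \<le> F y"
        using eventually_at_left_real[OF \<open>ce < c\<close>]
        by eventually_elim (use lower supportsD in auto)
      ultimately show "F e + c * (y - e) \<le> F y"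
        by (rule tendsto_upperbound) simp
    qed
  qed (use e in simp)
qed

lemma filterlim_at_bot_reflect:
  fixes F :: "real \<Rightarrow> real"
  assumes "((\<lambda>y. F y / y) \<longlongrightarrow> c) at_bot"
  shows "((\<lambda>y. F (- y) / y) \<longlongrightarrow> - c) at_top"
proof -
  have "((\<lambda>y. F (- y) / (- y)) \<longlongrightarrow> c) at_top"
    using assms by (simp add: filterlim_at_bot_mirror)
  then show ?thesis using tendsto_minus by fastforce
qed

lemma supports_left_gap:
  assumes cont: "continuous_on UNIV F" and lim: "((\<lambda>y. F y / y) \<longlongrightarrow> c) at_bot"
    and h: "supports F ch h" and gap: "\<And>x c. x < h \<Longrightarrow> \<not> supports F c x"
  shows "supports F c h"
proof -
  have "supports (\<lambda>y. F (- y)) (- c) (- h)"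
  proof (rule supports_right_gap)
    show "continuous_on UNIV (\<lambda>y. F (- y))"
      by (rule continuous_on_compose2[OF cont]) (auto intro: continuous_intros)
    show "((\<lambda>y. F (- y) / y) \<longlongrightarrow> - c) at_top"
      using lim by (rule filterlim_at_bot_reflect)
    show "supports (\<lambda>y. F (- y)) (- ch) (- h)" using h by (simp add: supports_reflect)
    show "\<not> supports (\<lambda>y. F (- y)) c' x" if "- h < x" for x c'
      using gap[of "- x"] that by (simp add: supports_reflect)
  qed
  then show ?thesis by (simp add: supports_reflect)
qed

text \<open>For a slope strictly between the two mean slopes \<open>F y - c * y\<close> tends to
  infinity at both ends and so has a global minimum. This provides contact points when
  \<open>l < r\<close>.\<close>

lemma ex_supports_of_limits:
  assumes cont: "continuous_on UNIV F" and "l < r"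
    and lr: "((\<lambda>y. F y / y) \<longlongrightarrow> r) at_top" and ll: "((\<lambda>y. F y / y) \<longlongrightarrow> l) at_bot"
  shows "\<exists>c x. supports F c x"
proof -
  obtain c where c: "l < c" "c < r" using dense[OF \<open>l < r\<close>] by blast
  have "\<forall>\<^sub>F y in at_top. F 0 \<le> F y - c * y"
    using tendsto_quotient_minus_linear[OF lr c(2)] by (simp add: filterlim_at_top)
  moreover have "\<forall>\<^sub>F y in at_top. F 0 \<le> F (- y) - (- c) * y"
    using tendsto_quotient_minus_linear[OF filterlim_at_bot_reflect[OF ll], of "- c"] c
    by (simp add: filterlim_at_top)
  ultimately have "\<forall>\<^sub>F y in at_top. F 0 \<le> F y - c * y \<and> F 0 \<le> F (- y) + c * y \<and> y \<ge> 0"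
    using eventually_ge_at_top[of 0] by eventually_elim auto
  then obtain R where R: "\<And>y. y \<ge> R \<Longrightarrow> F 0 \<le> F y - c * y \<and> F 0 \<le> F (- y) + c * y \<and> y \<ge> 0"
    by (auto simp: eventually_at_top_linorder)
  have "R \<ge> 0" using R[of R] by simp
  obtain m where m: "m \<in> {-R..R}" "\<And>y. y \<in> {-R..R} \<Longrightarrow> F m - c * m \<le> F y - c * y"
    using attains_min_minus_linear[OF cont, of "-R" R c] \<open>R \<ge> 0\<close> by auto
  have "F m - c * m \<le> F y - c * y" for y
  proof (cases "y \<in> {-R..R}")
    case False
    then have "F 0 \<le> F y - c * y" using R[of y] R[of "- y"] by (cases "y \<ge> R") auto
    moreover have "F m - c * m \<le> F 0" using m(2)[of 0] \<open>R \<ge> 0\<close> by simp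
    ultimately show ?thesis by simp
  qed (use m in blast)
  then have "supports F c m" by (simp add: supports_def algebra_simps)
  then show ?thesis by blast
qed

section \<open>Divides and supporting lines\<close>

context convex_flux
begin

context
  fixes \<phi> :: "real \<Rightarrow> real" and M :: real
  assumes bound: "ess_bound \<phi> M"
begin

text \<open>The supporting inequality makes \<open>c\<close> beat \<open>v\<close> by at least
  \<open>t * breg c v\<close>, which is positive unless \<open>v = c\<close>.\<close>

lemma maximizers_supports:
  assumes "supports (Phi \<phi>) c x0" "t > 0"
  shows "maximizers f \<phi> (x0 + t * df c) t = {c}"
proof -
  have "hopf_lax (Phi \<phi>) (x0 + t * df c) t c + t * breg c v
      \<le> hopf_lax (Phi \<phi>) (x0 + t * df c) t v" for v
  proof -
    have "t * leg v = t * (leg c + breg c v + c * (df v - df c))" using leg_diff[of v c] by simp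
    then show ?thesis
      using supportsD[OF assms(1), of "x0 + t * df c - t * df v"]
      by (simp add: hopf_lax_def algebra_simps)
  qed
  then have le: "hopf_lax (Phi \<phi>) (x0 + t * df c) t c + t * breg c v
      \<le> hopf_lax (Phi \<phi>) (x0 + t * df c) t v" for v .
  show ?thesis
  proof (intro equalityI subsetI)
    fix v assume "v \<in> maximizers f \<phi> (x0 + t * df c) t"
    then have "hopf_lax (Phi \<phi>) (x0 + t * df c) t v \<le> hopf_lax (Phi \<phi>) (x0 + t * df c) t c"
      using mem_maximizers_iff[OF bound \<open>t > 0\<close>] by blast
    then have "t * breg c v \<le> 0" using le[of v] by simp
    then have "v = c" using breg_pos[of v c] \<open>t > 0\<close> by (metis mult_pos_pos not_less)
    then show "v \<in> {c}" by simp
  next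
    fix v assume "v \<in> {c}"
    moreover have "t * breg c w \<ge> 0" for w using breg_nonneg \<open>t > 0\<close> by simp
    ultimately show "v \<in> maximizers f \<phi> (x0 + t * df c) t"
      using le mem_maximizers_iff[OF bound \<open>t > 0\<close>] by (auto intro: order_trans[OF _ le])
  qed
qed

text \<open>The converse uses the divide for all times: a fixed foot \<open>y\<close> is reached
  from later and later points as the competitor's speed approaches \<open>df c\<close>, and the
  excess cost disappears in the limit.\<close>

lemma is_divide_iff: "is_divide f \<phi> c x0 \<longleftrightarrow> supports (Phi \<phi>) c x0"
proof
  assume "supports (Phi \<phi>) c x0"
  then show "is_divide f \<phi> c x0"
    using maximizers_supports by (auto simp: is_divide_def ray_def)
next
  assume div: "is_divide f \<phi> c x0"
  text \<open>For \<open>v\<close> near \<open>c\<close> the time \<open>t\<close> at which the characteristic of speed \<open>f' v\<close> from \<open>y\<close>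
    meets the divide makes the cost \<open>t * breg c v\<close> at most \<open>\<bar>v - c\<bar> * \<bar>y - x0\<bar>\<close>.\<close>
  have key: "Phi \<phi> x0 + c * (y - x0) \<le> Phi \<phi> y + \<bar>v - c\<bar> * \<bar>y - x0\<bar>"
    if "(y - x0) * (c - v) > 0" for y v
  proof -
    define t where "t = (y - x0) / (df c - df v)"
    have ne: "df c \<noteq> df v" using that df_eq_iff by auto
    have "(y - x0) * (df c - df v) > 0"
      using that df_strict_mono[of c v] df_strict_mono[of v c]
      by (auto simp: zero_less_mult_iff)
    then have t: "t > 0" by (auto simp: t_def zero_less_divide_iff zero_less_mult_iff)
    have y: "t * (df c - df v) = y - x0" using ne by (simp add: t_def)
    have "c \<in> maximizers f \<phi> (x0 + t * df c) t"
      using div t by (auto simp: is_divide_def ray_def)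
    then have "hopf_lax (Phi \<phi>) (x0 + t * df c) t c \<le> hopf_lax (Phi \<phi>) (x0 + t * df c) t v"
      using mem_maximizers_iff[OF bound t] by blast
    moreover have "x0 + t * df c - t * df v = y" using y by (simp add: algebra_simps)
    ultimately have "Phi \<phi> x0 \<le> Phi \<phi> y + t * (leg v - leg c)"
      by (simp add: hopf_lax_def algebra_simps)
    also have "t * (leg v - leg c) = t * breg c v - c * (t * (df c - df v))"
      by (simp add: leg_diff algebra_simps)
    also have "t * breg c v \<le> t * (\<bar>v - c\<bar> * \<bar>df v - df c\<bar>)"
      using t breg_le by (intro mult_left_mono) auto
    also have "\<dots> = \<bar>v - c\<bar> * \<bar>t * (df c - df v)\<bar>"
      using t by (simp add: abs_mult abs_minus_commute)
    finally show ?thesis unfolding y by simp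
  qed
  show "supports (Phi \<phi>) c x0"
    unfolding supports_def
  proof
    fix y
    show "Phi \<phi> x0 + c * (y - x0) \<le> Phi \<phi> y"
    proof (cases "y = x0")
      case False
      show ?thesis
      proof (rule tendsto_lowerbound)
        have "((\<lambda>\<epsilon>. Phi \<phi> y + \<epsilon> * \<bar>y - x0\<bar>) \<longlongrightarrow> Phi \<phi> y + 0 * \<bar>y - x0\<bar>) (at_right 0)"
          by (intro tendsto_intros)
        then show "((\<lambda>\<epsilon>. Phi \<phi> y + \<epsilon> * \<bar>y - x0\<bar>) \<longlongrightarrow> Phi \<phi> y) (at_right 0)" by simp
        show "\<forall>\<^sub>F \<epsilon> in at_right 0. Phi \<phi> x0 + c * (y - x0) \<le> Phi \<phi> y + \<epsilon> * \<bar>y - x0\<bar>"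
          using eventually_at_right_less[of "0::real"]
        proof eventually_elim
          case (elim \<epsilon>)
          \<comment> \<open>A slower competitor reaches feet to the right of \<open>x0\<close>, a
            faster one those to the left.\<close>
          show ?case
            using key[of y "c - \<epsilon>"] key[of y "c + \<epsilon>"] elim False
            by (cases "y < x0") (auto simp: mult_neg_pos)
        qed
      qed simp
    qed simp
  qed
qed

end

end

section \<open>The convex hull of the primitive\<close>

context
  fixes F :: "real \<Rightarrow> real" and S :: "real set" and b :: real
  assumes lower: "\<And>y. y \<in> S \<Longrightarrow> b \<le> F y" and S: "convex S"
begin

lemma convex_minorants_nonempty: "{g. convex_on S g \<and> (\<forall>y\<in>S. g y \<le> F y)} \<noteq> {}"
  using lower S by (auto intro!: exI[of _ "\<lambda>_. b"] simp: convex_on_const)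

lemma convex_hull_fun_le: "x \<in> S \<Longrightarrow> convex_hull_fun F S x \<le> F x"
  unfolding convex_hull_fun_def by (rule cSUP_least[OF convex_minorants_nonempty]) auto

lemma le_convex_hull_fun:
  assumes "convex_on S g" "\<And>y. y \<in> S \<Longrightarrow> g y \<le> F y" "x \<in> S"
  shows "g x \<le> convex_hull_fun F S x"
  unfolding convex_hull_fun_def
  by (rule cSUP_upper) (use assms in \<open>auto intro!: bdd_aboveI[of _ "F x"]\<close>)

text \<open>A supremum of convex functions is convex; the cross-multiplied form passes to the limit
  in \<open>N\<close> term by term.\<close>

lemma convex_hull_fun_chord:
  assumes "a \<in> S" "c \<in> S" "a < x" "x < c"
  shows "(c - a) * convex_hull_fun F S x
    \<le> (c - x) * convex_hull_fun F S a + (x - a) * convex_hull_fun F S c"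
proof -
  define u where "u = (x - a) / (c - a)"
  have u: "0 \<le> u" "u \<le> 1" "(c - a) * u = x - a" using assms by (auto simp: u_def field_simps)
  have x: "(1 - u) *\<^sub>R a + u *\<^sub>R c = x" using u(3) by (simp add: algebra_simps)
  have "convex_hull_fun F S x \<le> (1 - u) * convex_hull_fun F S a + u * convex_hull_fun F S c"
    unfolding convex_hull_fun_def [of _ _ x]
  proof (rule cSUP_least[OF convex_minorants_nonempty])
    fix g assume g: "g \<in> {g. convex_on S g \<and> (\<forall>y\<in>S. g y \<le> F y)}"
    then have "g x \<le> (1 - u) * g a + u * g c"
      using convex_onD[of S g u a c] u assms x by auto
    also have "\<dots> \<le> (1 - u) * convex_hull_fun F S a + u * convex_hull_fun F S c"
      using g assms u by (intro add_mono mult_left_mono le_convex_hull_fun) auto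
    finally show "g x \<le> (1 - u) * convex_hull_fun F S a + u * convex_hull_fun F S c" .
  qed
  then have "(c - a) * convex_hull_fun F S x
      \<le> (c - a) * ((1 - u) * convex_hull_fun F S a + u * convex_hull_fun F S c)"
    using assms by (intro mult_left_mono) auto
  also have "\<dots> = ((c - a) - (c - a) * u) * convex_hull_fun F S a
      + ((c - a) * u) * convex_hull_fun F S c"
    by (simp add: algebra_simps)
  also have "\<dots> = (c - x) * convex_hull_fun F S a + (x - a) * convex_hull_fun F S c"
    by (simp add: u(3))
  finally show ?thesis .
qed

lemma convex_hull_fun_antimono:
  assumes "T \<subseteq> S" "convex T" "x \<in> T"
  shows "convex_hull_fun F S x \<le> convex_hull_fun F T x"
  unfolding convex_hull_fun_def [of _ S]
proof (rule cSUP_least[OF convex_minorants_nonempty])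
  fix g assume g: "g \<in> {g. convex_on S g \<and> (\<forall>y\<in>S. g y \<le> F y)}"
  then have "g \<in> {g. convex_on T g \<and> (\<forall>y\<in>T. g y \<le> F y)}"
    using assms convex_on_subset by auto
  then show "g x \<le> convex_hull_fun F T x"
    unfolding convex_hull_fun_def
    by (intro cSUP_upper) (use assms in \<open>auto intro!: bdd_aboveI[of _ "F x"]\<close>)
qed

end

context
  fixes \<phi> :: "real \<Rightarrow> real" and M :: real
  assumes bound: "ess_bound \<phi> M"
begin

lemma Phi_lower_Icc: "y \<in> {-N..N} \<Longrightarrow> - (M * \<bar>N\<bar>) \<le> Phi \<phi> y"
proof -
  assume y: "y \<in> {-N..N}"
  have "Phi \<phi> 0 = 0" 
    by (simp add: Phi_def interval_lebesgue_integral_def einterval_same set_lebesgue_integral_def)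
  then have "\<bar>Phi \<phi> y\<bar> \<le> M * \<bar>y\<bar>" using Phi_lipschitz[OF bound, of y 0] by simp
  also have "\<dots> \<le> M * \<bar>N\<bar>" using y ess_bound_nonneg[OF bound] by (intro mult_left_mono) auto
  finally show ?thesis by simp
qed

lemma Phi_bar_N_le: "Phi_bar_N \<phi> N x \<le> Phi \<phi> x"
  unfolding Phi_bar_N_def
  using convex_hull_fun_le[where F = "Phi \<phi>" and b = "- (M * \<bar>N\<bar>)"
      and S = "{-N..N}" and x = x, OF Phi_lower_Icc]
  by (auto simp: abs_less_iff)

lemma Phi_bar_N_antimono:
  assumes "\<bar>x\<bar> < N" "N \<le> N'" shows "Phi_bar_N \<phi> N' x \<le> Phi_bar_N \<phi> N x"
  using assms convex_hull_fun_antimono[where F = "Phi \<phi>" and b = "- (M * \<bar>N'\<bar>)"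
      and S = "{-N'..N'}" and T = "{-N..N}", OF Phi_lower_Icc]
  by (auto simp: Phi_bar_N_def abs_less_iff)

lemma Phi_bar_N_chord:
  assumes "a < x" "x < c" "\<bar>a\<bar> < N" "\<bar>c\<bar> < N"
  shows "(c - a) * Phi_bar_N \<phi> N x \<le> (c - x) * Phi_bar_N \<phi> N a + (x - a) * Phi_bar_N \<phi> N c"
  using convex_hull_fun_chord[where F = "Phi \<phi>" and b = "- (M * \<bar>N\<bar>)"
      and S = "{-N..N}" and a = a and c = c and x = x, OF Phi_lower_Icc] assms
  by (auto simp: Phi_bar_N_def abs_less_iff)

lemma affine_le_Phi_bar_N:
  assumes "\<And>y. l + c * y \<le> Phi \<phi> y" shows "l + c * x \<le> Phi_bar_N \<phi> N x"
proof (cases "\<bar>x\<bar> < N")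
  case True
  have affine: "convex_on {-N..N} (\<lambda>y. l + c * y)"
    unfolding convex_on_def
  proof (intro conjI ballI allI impI)
    fix x y u v :: real assume "u + v = 1"
    then have "l = u * l + v * l" by (metis distrib_right mult_1)
    then show "l + c * (u *\<^sub>R x + v *\<^sub>R y) \<le> u * (l + c * x) + v * (l + c * y)"
      by (simp add: algebra_simps)
  qed simp
  then show ?thesis
    using True assms le_convex_hull_fun[where F = "Phi \<phi>" and b = "- (M * \<bar>N\<bar>)"
      and S = "{-N..N}" and x = x, OF Phi_lower_Icc _ affine]
    by (auto simp: Phi_bar_N_def abs_less_iff)
qed (simp add: Phi_bar_N_def assms)

text \<open>\<open>Phi_bar\<close> is defined by \<open>Lim\<close>, which says nothing before
  convergence is known. A larger interval leaves fewer minorants, so the values decrease once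
  \<open>N\<close> exceeds \<open>\<bar>x\<bar>\<close> and converge to their infimum, possibly
  \<open>-\<infinity>\<close>.\<close>

lemma Phi_bar_tendsto: "((\<lambda>N. ereal (Phi_bar_N \<phi> N x)) \<longlongrightarrow> Phi_bar \<phi> x) at_top"
proof -
  define L where "L = (INF N\<in>{\<bar>x\<bar><..}. ereal (Phi_bar_N \<phi> N x))"
  have "((\<lambda>N. ereal (Phi_bar_N \<phi> N x)) \<longlongrightarrow> L) at_top"
  proof (rule order_tendstoI)
    fix a assume "a < L"
    then have "a < ereal (Phi_bar_N \<phi> N x)" if "N > \<bar>x\<bar>" for N
      using that unfolding L_def by (metis INF_lower greaterThan_iff less_le_trans)
    then show "\<forall>\<^sub>F N in at_top. a < ereal (Phi_bar_N \<phi> N x)"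
      using eventually_gt_at_top by (rule eventually_mono[rotated])
  next
    fix a assume "L < a"
    then obtain N0 where N0: "N0 > \<bar>x\<bar>" "ereal (Phi_bar_N \<phi> N0 x) < a"
      unfolding L_def by (auto simp: INF_less_iff)
    show "\<forall>\<^sub>F N in at_top. ereal (Phi_bar_N \<phi> N x) < a"
      using eventually_ge_at_top[of N0]
    proof eventually_elim
      case (elim N)
      have "ereal (Phi_bar_N \<phi> N x) \<le> ereal (Phi_bar_N \<phi> N0 x)"
        using Phi_bar_N_antimono[OF N0(1) elim] by simp
      then show ?case using N0(2) by (rule le_less_trans)
    qed
  qed
  moreover from this have "L = Phi_bar \<phi> x" unfolding Phi_bar_def by (simp add: tendsto_Lim)
  ultimately show ?thesis by simp
qed

lemma Phi_bar_le: "Phi_bar \<phi> x \<le> ereal (Phi \<phi> x)"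
  by (rule tendsto_upperbound[OF Phi_bar_tendsto]) (auto simp: Phi_bar_N_le)

lemma affine_le_Phi_bar:
  assumes "\<And>y. l + c * y \<le> Phi \<phi> y" shows "ereal (l + c * x) \<le> Phi_bar \<phi> x"
  by (rule tendsto_lowerbound[OF Phi_bar_tendsto]) (auto simp: affine_le_Phi_bar_N[OF assms])

lemma supports_affine: "supports F c x \<Longrightarrow> (F x - c * x) + c * y \<le> F y"
  using supportsD[of F c x y] by (simp add: algebra_simps)

text \<open>A supporting line is a global affine minorant and so lies below every
  \<open>Phi_bar_N\<close>. Conversely the hull lies below all chords of \<open>Phi\<close>, so a
  value shared with the hull lies below all chords over \<open>x\<close>, which yields a slope.
  Finiteness of the hull is a later consequence of this lemma.\<close>

lemma mem_K0_iff: "x \<in> K0 \<phi> \<longleftrightarrow> (\<exists>c. supports (Phi \<phi>) c x)"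
proof
  assume "\<exists>c. supports (Phi \<phi>) c x"
  then obtain c where "supports (Phi \<phi>) c x" ..
  then have "ereal (Phi \<phi> x) \<le> Phi_bar \<phi> x"
    using affine_le_Phi_bar[OF supports_affine, of c x x] by simp
  then show "x \<in> K0 \<phi>" using Phi_bar_le by (simp add: K0_def order_antisym)
next
  assume x: "x \<in> K0 \<phi>"
  show "\<exists>c. supports (Phi \<phi>) c x"
  proof (rule ex_supports_of_chords)
    fix a b assume ab: "a < x" "x < b"
    have "Phi_bar \<phi> x \<le> ereal (((b - x) * Phi \<phi> a + (x - a) * Phi \<phi> b) / (b - a))"
    proof (rule tendsto_upperbound[OF Phi_bar_tendsto])
      show "\<forall>\<^sub>F N in at_top. ereal (Phi_bar_N \<phi> N x)
          \<le> ereal (((b - x) * Phi \<phi> a + (x - a) * Phi \<phi> b) / (b - a))"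
        using eventually_gt_at_top[of "max \<bar>a\<bar> \<bar>b\<bar>"]
      proof eventually_elim
        case (elim N)
        then have "(b - a) * Phi_bar_N \<phi> N x
            \<le> (b - x) * Phi_bar_N \<phi> N a + (x - a) * Phi_bar_N \<phi> N b"
          using ab by (intro Phi_bar_N_chord) auto
        also have "\<dots> \<le> (b - x) * Phi \<phi> a + (x - a) * Phi \<phi> b"
          using ab by (intro add_mono mult_left_mono Phi_bar_N_le) auto
        finally show ?case using ab by (simp add: field_simps)
      qed
    qed simp
    then have "Phi \<phi> x \<le> ((b - x) * Phi \<phi> a + (x - a) * Phi \<phi> b) / (b - a)"
      using x by (simp add: K0_def flip: ereal_less_eq(3))
    then show "(b - a) * Phi \<phi> x \<le> (b - x) * Phi \<phi> a + (x - a) * Phi \<phi> b"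
      using ab by (simp add: field_simps)
  qed
qed

text \<open>Below, the hull is finite because \<open>\<Phi>\<close> has at least one supporting line.\<close>

definition Phi_hull :: "real \<Rightarrow> real" where
  "Phi_hull x = real_of_ereal (Phi_bar \<phi> x)"

context
  assumes K0: "K0 \<phi> \<noteq> {}"
begin

lemma Phi_bar_eq_hull: "Phi_bar \<phi> x = ereal (Phi_hull x)"
proof -
  obtain z c where "supports (Phi \<phi>) c z" using K0 mem_K0_iff by blast
  then have "ereal ((Phi \<phi> z - c * z) + c * x) \<le> Phi_bar \<phi> x"
    by (rule affine_le_Phi_bar[OF supports_affine])
  then have "Phi_bar \<phi> x \<noteq> -\<infinity>" by auto
  moreover have "Phi_bar \<phi> x \<noteq> \<infinity>" using Phi_bar_le[of x] by auto
  ultimately show ?thesis unfolding Phi_hull_def by (cases "Phi_bar \<phi> x") auto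
qed

lemma hull_le: "Phi_hull x \<le> Phi \<phi> x"
  using Phi_bar_le[of x] by (simp add: Phi_bar_eq_hull)

lemma affine_le_hull: "(\<And>y. l + c * y \<le> Phi \<phi> y) \<Longrightarrow> l + c * x \<le> Phi_hull x"
  using affine_le_Phi_bar[of l c x] by (simp add: Phi_bar_eq_hull)

lemma mem_K0_iff_hull: "x \<in> K0 \<phi> \<longleftrightarrow> Phi_hull x = Phi \<phi> x"
  by (auto simp: K0_def Phi_bar_eq_hull)

lemma Phi_bar_N_tendsto_hull: "((\<lambda>N. Phi_bar_N \<phi> N x) \<longlongrightarrow> Phi_hull x) at_top"
  using Phi_bar_tendsto[of x] by (simp add: Phi_bar_eq_hull)

lemma hull_chord:
  assumes "a < x" "x < b"
  shows "(b - a) * Phi_hull x \<le> (b - x) * Phi_hull a + (x - a) * Phi_hull b"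
proof (rule tendsto_le)
  show "((\<lambda>N. (b - a) * Phi_bar_N \<phi> N x) \<longlongrightarrow> (b - a) * Phi_hull x) at_top"
    "((\<lambda>N. (b - x) * Phi_bar_N \<phi> N a + (x - a) * Phi_bar_N \<phi> N b)
      \<longlongrightarrow> (b - x) * Phi_hull a + (x - a) * Phi_hull b) at_top"
    by (intro tendsto_intros Phi_bar_N_tendsto_hull)+
  show "\<forall>\<^sub>F N in at_top. (b - a) * Phi_bar_N \<phi> N x
      \<le> (b - x) * Phi_bar_N \<phi> N a + (x - a) * Phi_bar_N \<phi> N b"
    using eventually_gt_at_top[of "max \<bar>a\<bar> \<bar>b\<bar>"]
    by eventually_elim (use assms Phi_bar_N_chord in auto)
qed simp

lemma ex_supports_hull: "\<exists>c. supports Phi_hull c x"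
  by (rule ex_supports_of_chords) (rule hull_chord)

text \<open>An affine minorant of \<open>Phi\<close> is one of the hull, so only contact at
  \<open>x\<close> has to be checked. At a contact point this is \<open>hull_le\<close>, inside a
  gap it is the estimate of the hull by chords.\<close>

lemma supports_hull_of_Phi:
  assumes "supports (Phi \<phi>) c x0" "Phi_hull x \<le> Phi \<phi> x0 + c * (x - x0)"
  shows "supports Phi_hull c x"
  unfolding supports_def
proof
  fix y
  have "(Phi \<phi> x0 - c * x0) + c * y \<le> Phi_hull y"
    by (rule affine_le_hull[OF supports_affine[OF assms(1)]])
  then show "Phi_hull x + c * (y - x) \<le> Phi_hull y"
    using assms(2) by (simp add: algebra_simps)
qed

lemma supports_Phi_of_hull:
  assumes "supports Phi_hull c x" "x \<in> K0 \<phi>"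
  shows "supports (Phi \<phi>) c x"
  unfolding supports_def
proof
  fix y show "Phi \<phi> x + c * (y - x) \<le> Phi \<phi> y"
    using supportsD[OF assms(1), of y] hull_le[of y] assms(2) by (simp add: mem_K0_iff_hull)
qed

text \<open>An arbitrary selection of subgradients. Every selection is monotone, hence measurable
  and continuous off a countable set, and so stands in for \<open>phi_bar\<close> almost
  everywhere.\<close>

definition hull_slope :: "real \<Rightarrow> real" where
  "hull_slope x = (SOME c. supports Phi_hull c x)"

lemma supports_hull_slope: "supports Phi_hull (hull_slope x) x"
  unfolding hull_slope_def by (rule someI_ex[OF ex_supports_hull])

lemma hull_slope_mono: "x \<le> y \<Longrightarrow> hull_slope x \<le> hull_slope y"
  using supports_mono[OF supports_hull_slope supports_hull_slope, of x y]
  by (cases "x = y") auto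

lemma hull_slope_bound: "\<bar>hull_slope x\<bar> \<le> M"
proof (rule affine_minorant_slope_bound[of "Phi \<phi>"])
  show "\<bar>Phi \<phi> y - Phi \<phi> x\<bar> \<le> M * \<bar>y - x\<bar>" for x y by (rule Phi_lipschitz[OF bound])
  show "(Phi_hull x - hull_slope x * x) + hull_slope x * y \<le> Phi \<phi> y" for y
    using supports_affine[OF supports_hull_slope, of x y] hull_le[of y] by (rule order_trans)
qed

lemma hull_diff_bounds:
  "hull_slope x * (y - x) \<le> Phi_hull y - Phi_hull x" "Phi_hull y - Phi_hull x \<le> hull_slope y * (y - x)"
  using supportsD[OF supports_hull_slope, of x y] supportsD[OF supports_hull_slope, of y x]
  by (auto simp: algebra_simps)

text \<open>The difference quotient lies between the slopes selected at its two end points, so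
  continuity of the selection at \<open>x\<close> squeezes it.\<close>

lemma phi_bar_eq_hull_slope:
  assumes "isCont hull_slope x" shows "phi_bar \<phi> x = hull_slope x"
proof -
  have "((\<lambda>y. (Phi_hull y - Phi_hull x) / (y - x)) \<longlongrightarrow> hull_slope x) (at x)"
  proof (rule tendsto_sandwich)
    have lim: "(hull_slope \<longlongrightarrow> hull_slope x) (at x)" using assms by (simp add: isCont_def)
    show "((\<lambda>y. min (hull_slope x) (hull_slope y)) \<longlongrightarrow> hull_slope x) (at x)"
      using tendsto_min[OF tendsto_const[of "hull_slope x"] lim] by simp
    show "((\<lambda>y. max (hull_slope x) (hull_slope y)) \<longlongrightarrow> hull_slope x) (at x)"
      using tendsto_max[OF tendsto_const[of "hull_slope x"] lim] by simp
    have "min (hull_slope x) (hull_slope y) \<le> (Phi_hull y - Phi_hull x) / (y - x)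
        \<and> (Phi_hull y - Phi_hull x) / (y - x) \<le> max (hull_slope x) (hull_slope y)" if "y \<noteq> x" for y
      using hull_diff_bounds[where x = x and y = y] that
      by (cases "x < y") (auto simp: field_simps min_le_iff_disj le_max_iff_disj)
    then show "\<forall>\<^sub>F y in at x. min (hull_slope x) (hull_slope y) \<le> (Phi_hull y - Phi_hull x) / (y - x)"
      "\<forall>\<^sub>F y in at x. (Phi_hull y - Phi_hull x) / (y - x) \<le> max (hull_slope x) (hull_slope y)"
      by (auto simp: eventually_at_filter)
  qed
  then have "(Phi_hull has_real_derivative hull_slope x) (at x)"
    by (simp add: has_field_derivative_iff)
  then show ?thesis unfolding phi_bar_def Phi_hull_def [abs_def, symmetric] by (rule DERIV_imp_deriv)
qed

lemma countable_hull_slope_discont: "countable {x. \<not> isCont hull_slope x}"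
  by (rule mono_ctble_discont) (simp add: mono_def hull_slope_mono)

lemma AE_phi_bar: "AE x in lebesgue. phi_bar \<phi> x = hull_slope x"
proof (rule AE_I')
  show "{x. \<not> isCont hull_slope x} \<in> null_sets lebesgue"
    using countable_imp_null_set_lborel[OF countable_hull_slope_discont]
    by (rule null_sets_completionI)
qed (use phi_bar_eq_hull_slope in auto)

lemma ess_bound_phi_bar: "ess_bound (phi_bar \<phi>) M"
  unfolding ess_bound_def
proof
  have "mono hull_slope" by (simp add: mono_def hull_slope_mono)
  then have "hull_slope \<in> borel_measurable borel" by (rule borel_measurable_mono)
  then have "hull_slope \<in> borel_measurable lebesgue"
    by (intro measurable_completion) simp
  then show "phi_bar \<phi> \<in> borel_measurable lebesgue"
    by (rule measurable_discrete_difference[OF _ countable_hull_slope_discont])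
       (auto simp: phi_bar_eq_hull_slope)
  show "AE x in lebesgue. \<bar>phi_bar \<phi> x\<bar> \<le> M"
  proof (rule eventually_mono[OF AE_phi_bar])
    fix x assume "phi_bar \<phi> x = hull_slope x"
    then show "\<bar>phi_bar \<phi> x\<bar> \<le> M" using hull_slope_bound[of x] by simp
  qed
qed

end

end

section \<open>The hull as a primitive of \<open>phi_bar\<close>\<close>

lemma constant_of_increment_bound:
  fixes H D :: "real \<Rightarrow> real"
  assumes "\<And>a b. a \<le> b \<Longrightarrow> \<bar>H b - H a\<bar> \<le> (D b - D a) * (b - a)"
  shows "H x = H y"
proof -
  have *: "H x = H y" if "x < y" for x y
  proof (rule ccontr)
    assume "H x \<noteq> H y"
    define d where "d = (D y - D x) * (y - x)"
    \<comment> \<open>On \<open>n\<close> equal pieces the increments of \<open>D\<close> telescope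
      while each length is \<open>(y - x) / n\<close>, so the increment of \<open>H\<close> is at
      most \<open>d / n\<close> for every \<open>n\<close>.\<close>
    have le: "real n * \<bar>H y - H x\<bar> \<le> d" if "n > 0" for n :: nat
    proof -
      define h where "h = (y - x) / n"
      define p where "p k = x + real k * h" for k :: nat
      have h: "h \<ge> 0" "n * h = y - x" using that \<open>x < y\<close> by (auto simp: h_def)
      have p: "p 0 = x" "p n = y" "p (Suc k) - p k = h" for k
        using h by (auto simp: p_def algebra_simps)
      have "H y - H x = (\<Sum>k<n. H (p (Suc k)) - H (p k))"
        using sum_lessThan_telescope[of "\<lambda>k. H (p k)" n] by (simp add: p)
      also have "\<bar>\<dots>\<bar> \<le> (\<Sum>k<n. \<bar>H (p (Suc k)) - H (p k)\<bar>)" by (rule sum_abs)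
      also have "\<dots> \<le> (\<Sum>k<n. (D (p (Suc k)) - D (p k)) * h)"
      proof (rule sum_mono)
        fix k
        show "\<bar>H (p (Suc k)) - H (p k)\<bar> \<le> (D (p (Suc k)) - D (p k)) * h"
          using assms[of "p k" "p (Suc k)"] p(3)[of k] h by simp
      qed
      also have "\<dots> = (D y - D x) * h"
        using sum_lessThan_telescope[of "\<lambda>k. D (p k)" n] by (simp add: p flip: sum_distrib_right)
      finally have "real n * \<bar>H y - H x\<bar> \<le> real n * ((D y - D x) * h)"
        by (intro mult_left_mono) auto
      also have "\<dots> = d" using h(2) by (simp add: d_def mult.left_commute)
      finally show ?thesis .
    qed
    obtain n :: nat where n: "d < real n * \<bar>H y - H x\<bar>"
      using reals_Archimedean3[of "\<bar>H y - H x\<bar>"] \<open>H x \<noteq> H y\<close>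
      by (metis right_minus_eq zero_less_abs_iff)
    have "d \<ge> 0" using le[of 1] by simp
    then have "n > 0" using n by (cases n) auto
    then show False using le[of n] n by simp
  qed
  show ?thesis using *[of x y] *[of y x] by (metis linorder_neqE)
qed

context
  fixes \<phi> :: "real \<Rightarrow> real" and M :: real
  assumes bound: "ess_bound \<phi> M" and K0: "K0 \<phi> \<noteq> {}"
begin

text \<open>On \<open>{a..b}\<close> both increments differ from \<open>m * (b - a)\<close> by at
  most \<open>r * (b - a)\<close>, with \<open>m\<close> the middle and \<open>r\<close> half the
  oscillation of \<open>hull_slope\<close>. The difference of the two functions thus changes by at
  most oscillation times length, which forces it to be constant.\<close>

lemma Phi_phi_bar: "Phi (phi_bar \<phi>) y - Phi (phi_bar \<phi>) x = Phi_hull \<phi> y - Phi_hull \<phi> x"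
proof -
  have "Phi (phi_bar \<phi>) x - Phi_hull \<phi> x = Phi (phi_bar \<phi>) y - Phi_hull \<phi> y"
  proof (rule constant_of_increment_bound[where H = "\<lambda>x. Phi (phi_bar \<phi>) x - Phi_hull \<phi> x"])
    fix a b :: real assume "a \<le> b"
    define m r where "m = (hull_slope \<phi> a + hull_slope \<phi> b) / 2"
      and "r = (hull_slope \<phi> b - hull_slope \<phi> a) / 2"
    have "\<bar>Phi (phi_bar \<phi>) b - Phi (phi_bar \<phi>) a - m * (b - a)\<bar> \<le> r * (b - a)"
    proof (rule Phi_diff_bound[OF ess_bound_phi_bar[OF bound K0] \<open>a \<le> b\<close>])
      show "AE z in lebesgue. z \<in> {a..b} \<longrightarrow> \<bar>phi_bar \<phi> z - m\<bar> \<le> r"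
        using AE_phi_bar[OF bound K0]
      proof (rule eventually_mono)
        fix z assume "phi_bar \<phi> z = hull_slope \<phi> z"
        then show "z \<in> {a..b} \<longrightarrow> \<bar>phi_bar \<phi> z - m\<bar> \<le> r"
          using hull_slope_mono[OF bound K0, of a z] hull_slope_mono[OF bound K0, of z b]
          by (auto simp: m_def r_def abs_le_iff field_simps)
      qed
    qed
    moreover have "\<bar>Phi_hull \<phi> b - Phi_hull \<phi> a - m * (b - a)\<bar> \<le> r * (b - a)"
      using hull_diff_bounds[OF bound K0, where x = a and y = b]
      by (simp add: m_def r_def abs_le_iff field_simps)
    ultimately have "\<bar>(Phi (phi_bar \<phi>) b - Phi_hull \<phi> b) - (Phi (phi_bar \<phi>) a - Phi_hull \<phi> a)\<bar>
        \<le> 2 * (r * (b - a))"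
      by linarith
    then show "\<bar>(Phi (phi_bar \<phi>) b - Phi_hull \<phi> b) - (Phi (phi_bar \<phi>) a - Phi_hull \<phi> a)\<bar>
        \<le> (hull_slope \<phi> b - hull_slope \<phi> a) * (b - a)"
      by (simp add: r_def)
  qed
  then show ?thesis by simp
qed

lemma supports_Phi_phi_bar: "supports (Phi (phi_bar \<phi>)) c x \<longleftrightarrow> supports (Phi_hull \<phi>) c x"
proof -
  have "Phi (phi_bar \<phi>) x + c * (y - x) \<le> Phi (phi_bar \<phi>) y
      \<longleftrightarrow> Phi_hull \<phi> x + c * (y - x) \<le> Phi_hull \<phi> y" for y
    using Phi_phi_bar[of y x] by linarith
  then show ?thesis unfolding supports_def by simp
qed

text \<open>Continuity of the hull comes from its being a primitive up to a constant;
  \<open>K0 \<phi>\<close> is then the set where two continuous functions agree.\<close>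

lemma closed_K0: "closed (K0 \<phi>)"
proof -
  have "K0 \<phi> = {x. Phi (phi_bar \<phi>) x - Phi (phi_bar \<phi>) 0 + Phi_hull \<phi> 0 = Phi \<phi> x}"
    using mem_K0_iff_hull[OF bound K0] Phi_phi_bar[of _ 0] by auto
  moreover have "continuous_on UNIV (Phi (phi_bar \<phi>))" "continuous_on UNIV (Phi \<phi>)"
    by (auto intro!: continuous_at_imp_continuous_on Phi_isCont[OF bound]
        Phi_isCont[OF ess_bound_phi_bar[OF bound K0]])
  ultimately show ?thesis by (auto intro!: closed_Collect_eq continuous_intros)
qed

end

section \<open>Gaps between the contact points\<close>

lemma gap_left_end:
  fixes K :: "real set"
  assumes "closed K" "x \<notin> K"
  obtains e :: ereal where "e < ereal x" "e = -\<infinity> \<or> e \<in> ereal ` K"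
    "\<And>y. e < ereal y \<Longrightarrow> y \<le> x \<Longrightarrow> y \<notin> K"
proof (cases "K \<inter> {..x} = {}")
  case True
  then show ?thesis using that[of "-\<infinity>"] by auto
next
  case False
  have bdd: "bdd_above (K \<inter> {..x})" by (rule bdd_aboveI[of _ x]) auto
  have mem: "Sup (K \<inter> {..x}) \<in> K \<inter> {..x}"
    by (rule closed_contains_Sup[OF False bdd]) (use assms(1) in auto)
  then have "Sup (K \<inter> {..x}) \<noteq> x" using assms(2) by auto
  then show ?thesis
    using mem that[of "ereal (Sup (K \<inter> {..x}))"] cSup_upper[OF _ bdd] by force
qed

lemma gap_right_end:
  fixes K :: "real set"
  assumes "closed K" "x \<notin> K"
  obtains h :: ereal where "ereal x < h" "h = \<infinity> \<or> h \<in> ereal ` K"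
    "\<And>y. ereal y < h \<Longrightarrow> x \<le> y \<Longrightarrow> y \<notin> K"
proof -
  have "closed (uminus ` K)" "- x \<notin> uminus ` K"
    using assms by (auto simp: closed_negations)
  then obtain e :: ereal where e: "e < ereal (- x)" "e = -\<infinity> \<or> e \<in> ereal ` uminus ` K"
    "\<And>y. e < ereal y \<Longrightarrow> y \<le> - x \<Longrightarrow> y \<notin> uminus ` K"
    using gap_left_end by blast
  show ?thesis
  proof (rule that[of "- e"])
    show "ereal x < - e" using e(1) by (metis ereal_less_uminus_reorder uminus_ereal.simps(1))
    show "- e = \<infinity> \<or> - e \<in> ereal ` K" using e(2) by auto
    show "y \<notin> K" if "ereal y < - e" "x \<le> y" for y
      using e(3)[of "- y"] that by (auto simp: ereal_less_uminus_reorder)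
  qed
qed

text \<open>A connected set leaving the interval would contain the segment from an inner point to an
  outer one, and with it an end point belonging to \<open>K\<close>.\<close>

lemma einterval_mem_components:
  fixes K :: "real set" and e h :: ereal
  assumes "e < h" and sub: "einterval e h \<inter> K = {}"
    and e: "e = -\<infinity> \<or> e \<in> ereal ` K" and h: "h = \<infinity> \<or> h \<in> ereal ` K"
  shows "einterval e h \<in> components (- K)"
  unfolding in_components_maximal
proof (intro conjI allI impI)
  obtain w where w: "w \<in> einterval e h" using einterval_nonempty[OF \<open>e < h\<close>] by blast
  then show "einterval e h \<noteq> {}" by blast
  show "einterval e h \<subseteq> - K" using sub by blast
  show "connected (einterval e h)"
    by (rule is_interval_connected, cases e; cases h) (auto simp: is_interval_1 einterval_iff)
  fix D assume D: "D \<noteq> {} \<and> einterval e h \<subseteq> D \<and> D \<subseteq> - K \<and> connected D"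
  have "z \<in> einterval e h" if "z \<in> D" for z
  proof (rule ccontr)
    assume "z \<notin> einterval e h"
    then consider "ereal z \<le> e" | "h \<le> ereal z" by (auto simp: einterval_iff not_less)
    then show False
    proof cases
      case 1
      then obtain a where a: "a \<in> K" "e = ereal a" using e by auto
      have "{z..w} \<subseteq> D" using D that w connected_contains_Icc by blast
      moreover have "a \<in> {z..w}" using a 1 w by (auto simp: einterval_iff)
      ultimately show False using a D by blast
    next
      case 2
      then obtain b where b: "b \<in> K" "h = ereal b" using h by auto
      have "{w..z} \<subseteq> D" using D that w connected_contains_Icc by blast
      moreover have "b \<in> {w..z}" using b 2 w by (auto simp: einterval_iff)
      ultimately show False using b D by blast
    qed
  qed
  then show "D = einterval e h" using D by blast
qed

lemma is_gap_disjoint: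
  assumes "is_gap \<phi> e h" "e < ereal x" "ereal x < h"
  shows "x \<notin> K0 \<phi>"
proof -
  have "einterval e h \<subseteq> - K0 \<phi>" using assms(1) in_components_subset unfolding is_gap_def by blast
  then show ?thesis using assms(2,3) by (auto simp: einterval_iff)
qed

lemma is_gap_maximal:
  assumes "is_gap \<phi> e h" "is_interval D" "einterval e h \<subseteq> D" "D \<inter> K0 \<phi> = {}"
  shows "D = einterval e h"
proof -
  have comp: "einterval e h \<in> components (- K0 \<phi>)" using assms(1) by (simp add: is_gap_def)
  then have "D \<noteq> {}" using assms(3) in_components_nonempty by blast
  moreover have "D \<subseteq> - K0 \<phi>" using assms(4) by blast
  moreover have "connected D" using assms(2) by (rule is_interval_connected)
  ultimately show ?thesis using comp assms(3) unfolding in_components_maximal by metis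
qed

text \<open>Otherwise adjoining \<open>e\<close> would enlarge the component.\<close>

lemma is_gap_left_mem:
  assumes gap: "is_gap \<phi> (ereal e) h" shows "e \<in> K0 \<phi>"
proof (rule ccontr)
  assume "e \<notin> K0 \<phi>"
  have "is_interval (insert e (einterval (ereal e) h))"
    unfolding is_interval_1 by (cases h) (auto simp: einterval_iff)
  then have "insert e (einterval (ereal e) h) = einterval (ereal e) h"
    using \<open>e \<notin> K0 \<phi>\<close> is_gap_disjoint[OF gap] by (intro is_gap_maximal[OF gap]) (auto simp: einterval_iff)
  then show False by (auto simp: einterval_iff)
qed

lemma is_gap_right_mem:
  assumes gap: "is_gap \<phi> e (ereal h)" shows "h \<in> K0 \<phi>"
proof (rule ccontr)
  assume "h \<notin> K0 \<phi>"
  have "is_interval (insert h (einterval e (ereal h)))"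
    unfolding is_interval_1 by (cases e) (auto simp: einterval_iff)
  then have "insert h (einterval e (ereal h)) = einterval e (ereal h)"
    using \<open>h \<notin> K0 \<phi>\<close> is_gap_disjoint[OF gap] by (intro is_gap_maximal[OF gap]) (auto simp: einterval_iff)
  then show False by (auto simp: einterval_iff)
qed

lemma is_gap_Sup:
  assumes gap: "is_gap \<phi> (ereal e) \<infinity>" shows "Sup (K0 \<phi>) = e"
  using is_gap_left_mem[OF gap] is_gap_disjoint[OF gap]
  by (intro cSup_eq_maximum) (auto simp: not_le[symmetric])

lemma is_gap_Inf:
  assumes gap: "is_gap \<phi> (-\<infinity>) (ereal h)" shows "Inf (K0 \<phi>) = h"
  using is_gap_right_mem[OF gap] is_gap_disjoint[OF gap]
  by (intro cInf_eq_minimum) (auto simp: not_le[symmetric])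

lemma supports_unique:
  assumes "supports F c x" "a < x" "F a = F x + d * (a - x)" "x < b" "F b = F x + d * (b - x)"
  shows "c = d"
proof -
  have "c * (b - x) \<le> d * (b - x)" "c * (a - x) \<le> d * (a - x)"
    using supportsD[OF assms(1), of b] supportsD[OF assms(1), of a] assms by auto
  then show ?thesis using assms(2,4) by (simp add: mult_le_cancel_right)
qed

text \<open>Where \<open>F\<close> is affine its slope is pinned from both sides. This identifies
  the state of a characteristic whose foot lies in a gap.\<close>

lemma supports_unique_on_affine:
  fixes e h :: ereal
  assumes "\<And>x. e < ereal x \<Longrightarrow> ereal x < h \<Longrightarrow> supports F d x"
    and c: "supports F c x" and x: "e < ereal x" "ereal x < h"
  shows "c = d"
proof -
  have affine: "F y = F x + d * (y - x)" if "e < ereal y" "ereal y < h" for y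
    using supportsD[OF assms(1)[OF x], of y] supportsD[OF assms(1)[OF that], of x]
    by (simp add: algebra_simps)
  obtain a where a: "e < ereal a" "ereal a < ereal x" using ereal_dense2[OF x(1)] by blast
  obtain b where b: "ereal x < ereal b" "ereal b < h" using ereal_dense2[OF x(2)] by blast
  have "ereal a < h" "e < ereal b" using a b x less_trans by blast+
  then show ?thesis
    using supports_unique[OF c, of a d b] affine[of a] affine[of b] a b by simp
qed

context
  fixes \<phi> :: "real \<Rightarrow> real" and M :: real
  assumes bound: "ess_bound \<phi> M"
begin

lemma continuous_on_Phi: "continuous_on UNIV (Phi \<phi>)"
  by (simp add: continuous_at_imp_continuous_on Phi_isCont[OF bound])

lemma gap_not_supports:
  assumes "is_gap \<phi> e h" "e < ereal x" "ereal x < h"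
  shows "\<not> supports (Phi \<phi>) c x"
  using is_gap_disjoint[OF assms] mem_K0_iff[OF bound] by blast

lemma gap_nonempty: "is_gap \<phi> (ereal e) h \<or> is_gap \<phi> h (ereal e) \<Longrightarrow> K0 \<phi> \<noteq> {}"
  using is_gap_left_mem is_gap_right_mem by blast

text \<open>On the gap the hull lies above the common supporting line of the two ends and, by
  convexity, below the chord joining them; these are the same line.\<close>

lemma bounded_gap_supports:
  assumes gap: "is_gap \<phi> (ereal e) (ereal h)"
  shows "e < h" "supports (Phi \<phi>) (chord_slope \<phi> e h) e" "supports (Phi \<phi>) (chord_slope \<phi> e h) h"
    and "\<And>x. e < x \<Longrightarrow> x < h \<Longrightarrow> supports (Phi_hull \<phi>) (chord_slope \<phi> e h) x"
proof -
  show "e < h" using gap by (simp add: is_gap_def)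
  obtain ce ch where s: "supports (Phi \<phi>) ce e" "supports (Phi \<phi>) ch h"
    using is_gap_left_mem[OF gap] is_gap_right_mem[OF gap] mem_K0_iff[OF bound] by blast
  show se: "supports (Phi \<phi>) (chord_slope \<phi> e h) e" "supports (Phi \<phi>) (chord_slope \<phi> e h) h"
    using supports_chord[OF continuous_on_Phi \<open>e < h\<close> s _ refl] gap_not_supports[OF gap]
    by (auto simp: chord_slope_def)
  fix x assume x: "e < x" "x < h"
  have K0: "K0 \<phi> \<noteq> {}" using gap_nonempty gap by blast
  define c where "c = chord_slope \<phi> e h"
  have Ph: "Phi \<phi> h = Phi \<phi> e + c * (h - e)" using \<open>e < h\<close> by (simp add: c_def chord_slope_def)
  have "(h - e) * Phi_hull \<phi> x \<le> (h - x) * Phi_hull \<phi> e + (x - e) * Phi_hull \<phi> h"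
    by (rule hull_chord[OF bound K0 x])
  also have "\<dots> \<le> (h - x) * Phi \<phi> e + (x - e) * Phi \<phi> h"
    using x by (intro add_mono mult_left_mono hull_le[OF bound K0]) auto
  also have "\<dots> = (h - e) * (Phi \<phi> e + c * (x - e))"
    unfolding Ph by (simp add: algebra_simps)
  finally have "Phi_hull \<phi> x \<le> Phi \<phi> e + c * (x - e)" using \<open>e < h\<close> by simp
  then show "supports (Phi_hull \<phi>) (chord_slope \<phi> e h) x"
    using supports_hull_of_Phi[OF bound K0 se(1)] by (simp add: c_def)
qed

text \<open>Beyond the last contact point \<open>e\<close> the hull lies below all chords from \<open>e\<close> to a point \<open>b\<close>
  further out, whose slopes tend to the mean limit of the data.\<close>

lemma hull_le_of_mean_limit:
  assumes K0: "K0 \<phi> \<noteq> {}" and "F \<noteq> bot" and inv: "(inverse \<longlongrightarrow> 0) F"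
    and lim: "((\<lambda>b. Phi \<phi> b / b) \<longlongrightarrow> r) F"
    and ev: "\<forall>\<^sub>F b in F. b \<noteq> 0 \<and> (e < x \<and> x < b \<or> b < x \<and> x < e)"
  shows "Phi_hull \<phi> x \<le> Phi \<phi> e + r * (x - e)"
proof -
  \<comment> \<open>The slope of the chord from \<open>e\<close> to \<open>b\<close>, with numerator
    and denominator divided by \<open>b\<close>. The general filter covers both infinities.\<close>
  have "((\<lambda>b. Phi \<phi> e + (Phi \<phi> b / b - Phi \<phi> e * inverse b) / (1 - e * inverse b) * (x - e))
      \<longlongrightarrow> Phi \<phi> e + (r - Phi \<phi> e * 0) / (1 - e * 0) * (x - e)) F"
    by (intro tendsto_intros inv lim) simp
  moreover have "\<forall>\<^sub>F b in F. Phi_hull \<phi> x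
      \<le> Phi \<phi> e + (Phi \<phi> b / b - Phi \<phi> e * inverse b) / (1 - e * inverse b) * (x - e)"
    using ev
  proof eventually_elim
    case (elim b)
    have le: "\<theta> * Phi_hull \<phi> e \<le> \<theta> * Phi \<phi> e" "\<theta> * Phi_hull \<phi> b \<le> \<theta> * Phi \<phi> b"
      if "\<theta> \<ge> 0" for \<theta>
      using that by (auto intro: mult_left_mono hull_le[OF bound K0])
    have "Phi_hull \<phi> x \<le> Phi \<phi> e + (Phi \<phi> b - Phi \<phi> e) / (b - e) * (x - e)"
    proof (cases "e < x")
      case True
      then have "(b - e) * Phi_hull \<phi> x \<le> (b - x) * Phi \<phi> e + (x - e) * Phi \<phi> b"
        using hull_chord[OF bound K0, of e x b] le(1)[of "b - x"] le(2)[of "x - e"] elim by linarith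
      then show ?thesis using True elim by (simp add: field_simps)
    next
      case False
      then have "(e - b) * Phi_hull \<phi> x \<le> (e - x) * Phi \<phi> b + (x - b) * Phi \<phi> e"
        using hull_chord[OF bound K0, of b x e] le(1)[of "x - b"] le(2)[of "e - x"] elim by linarith
      then show ?thesis using False elim by (simp add: field_simps)
    qed
    moreover have "(Phi \<phi> b / b - Phi \<phi> e * inverse b) / (1 - e * inverse b)
        = (Phi \<phi> b - Phi \<phi> e) / (b - e)"
    proof -
      have "Phi \<phi> b / b - Phi \<phi> e * inverse b = (Phi \<phi> b - Phi \<phi> e) / b"
        by (simp add: divide_inverse algebra_simps)
      moreover have "1 - e * inverse b = (b - e) / b" using elim by (simp add: field_simps)
      ultimately show ?thesis using elim by simp
    qed
    ultimately show ?case by simp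
  qed
  ultimately have "Phi_hull \<phi> x \<le> Phi \<phi> e + (r - Phi \<phi> e * 0) / (1 - e * 0) * (x - e)"
    by (rule tendsto_lowerbound[OF _ _ \<open>F \<noteq> bot\<close>])
  then show ?thesis by simp
qed

lemma right_gap_supports:
  assumes gap: "is_gap \<phi> (ereal e) \<infinity>" and lim: "((\<lambda>y. Phi \<phi> y / y) \<longlongrightarrow> r) at_top"
  shows "supports (Phi \<phi>) r e" and "\<And>x. e < x \<Longrightarrow> supports (Phi_hull \<phi>) r x"
proof -
  obtain ce where s: "supports (Phi \<phi>) ce e"
    using is_gap_left_mem[OF gap] mem_K0_iff[OF bound] by blast
  show se: "supports (Phi \<phi>) r e"
    by (rule supports_right_gap[OF continuous_on_Phi lim s]) (use gap_not_supports[OF gap] in auto)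
  fix x assume x: "e < x"
  have K0: "K0 \<phi> \<noteq> {}" using gap_nonempty gap by blast
  have "\<forall>\<^sub>F b in at_top. b \<noteq> 0 \<and> (e < x \<and> x < b \<or> b < x \<and> x < e)"
    using eventually_gt_at_top[of "max x 0"] by eventually_elim (use x in auto)
  then show "supports (Phi_hull \<phi>) r x"
    by (intro supports_hull_of_Phi[OF bound K0 se] hull_le_of_mean_limit[OF K0 _ _ lim]
        tendsto_inverse_0_at_top filterlim_ident) auto
qed

lemma left_gap_supports:
  assumes gap: "is_gap \<phi> (-\<infinity>) (ereal h)" and lim: "((\<lambda>y. Phi \<phi> y / y) \<longlongrightarrow> l) at_bot"
  shows "supports (Phi \<phi>) l h" and "\<And>x. x < h \<Longrightarrow> supports (Phi_hull \<phi>) l x"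
proof -
  obtain ch where s: "supports (Phi \<phi>) ch h"
    using is_gap_right_mem[OF gap] mem_K0_iff[OF bound] by blast
  show se: "supports (Phi \<phi>) l h"
    by (rule supports_left_gap[OF continuous_on_Phi lim s]) (use gap_not_supports[OF gap] in auto)
  fix x assume x: "x < h"
  have K0: "K0 \<phi> \<noteq> {}" using gap_nonempty gap by blast
  have "\<forall>\<^sub>F b in at_bot. b \<noteq> 0 \<and> (h < x \<and> x < b \<or> b < x \<and> x < h)"
    using eventually_gt_at_bot[of "min x 0"] by eventually_elim (use x in auto)
  moreover have "(inverse \<longlongrightarrow> (0::real)) at_bot"
    using tendsto_inverse_0 tendsto_mono[OF at_bot_le_at_infinity] by blast
  ultimately show "supports (Phi_hull \<phi>) l x"
    by (intro supports_hull_of_Phi[OF bound K0 se] hull_le_of_mean_limit[OF K0 _ _ lim]) auto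
qed

end

section \<open>The solution with the hull as data, and the covering of the half-plane\<close>

context convex_flux
begin

context
  fixes \<phi> :: "real \<Rightarrow> real" and M :: real
  assumes bound: "ess_bound \<phi> M"
begin

lemma entropy_sol_supports:
  assumes "supports (Phi \<phi>) c x0" "t > 0" shows "entropy_sol f \<phi> (x0 + t * df c) t = c"
  using maximizers_supports[OF bound assms] by (simp add: entropy_sol_def)

lemma entropy_sol_phi_bar:
  assumes K0: "K0 \<phi> \<noteq> {}" and s: "supports (Phi_hull \<phi>) c x0" "t > 0"
  shows "entropy_sol f (phi_bar \<phi>) (x0 + t * df c) t = c"
  using maximizers_supports[OF ess_bound_phi_bar[OF bound K0], of c x0 t] s
  by (simp add: entropy_sol_def supports_Phi_phi_bar[OF bound K0])

text \<open>A converse of \<open>maximizers_supports\<close> resting on convexity of the hull: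
  competitors near \<open>c\<close> bound the hull from below near the foot up to an error
  \<open>\<bar>v - c\<bar> * \<bar>z - x0\<bar>\<close>, whereas a violation of the line at some
  \<open>y\<close> propagates toward the foot with a fixed rate of loss
  \<open>\<epsilon>\<close>.\<close>

lemma supports_hull_of_maximizer:
  assumes K0: "K0 \<phi> \<noteq> {}" and t: "t > 0" and c: "c \<in> maximizers f (phi_bar \<phi>) x t"
  shows "supports (Phi_hull \<phi>) c (x - t * df c)"
  unfolding supports_def
proof
  fix y
  define x0 where "x0 = x - t * df c"
  define H where "H = Phi_hull \<phi>"
  have foot: "H z - H x0 \<ge> c * (z - x0) - \<bar>v - c\<bar> * \<bar>z - x0\<bar>"
    if "z = x - t * df v" for v z
  proof -
    have zx: "z - x0 = t * (df c - df v)" using that by (simp add: x0_def algebra_simps)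
    have "hopf_lax (Phi (phi_bar \<phi>)) x t c \<le> hopf_lax (Phi (phi_bar \<phi>)) x t v"
      using c mem_maximizers_iff[OF ess_bound_phi_bar[OF bound K0] t] by blast
    then have "H z - H x0 \<ge> t * (leg c - leg v)"
      unfolding H_def Phi_phi_bar[OF bound K0, symmetric] that x0_def
      by (simp add: hopf_lax_def algebra_simps)
    moreover have "t * (leg c - leg v) = c * (z - x0) - t * breg c v"
    proof -
      have "leg c - leg v = c * (df c - df v) - breg c v"
        using leg_diff[of v c] by (simp add: algebra_simps)
      then have "t * (leg c - leg v) = t * (c * (df c - df v) - breg c v)" by (rule arg_cong)
      then show ?thesis unfolding zx by (simp add: right_diff_distrib mult.left_commute)
    qed
    moreover have "t * breg c v \<le> t * (\<bar>v - c\<bar> * \<bar>df v - df c\<bar>)"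
      using t breg_le by (intro mult_left_mono) auto
    moreover have "t * (\<bar>v - c\<bar> * \<bar>df v - df c\<bar>) = \<bar>v - c\<bar> * \<bar>z - x0\<bar>"
      using t unfolding zx by (simp add: abs_mult abs_minus_commute)
    ultimately show ?thesis by linarith
  qed
  have "H x0 + c * (y - x0) \<le> H y"
  proof (rule ccontr)
    assume "\<not> ?thesis"
    then have lt: "H y < H x0 + c * (y - x0)" by simp
    then have "y \<noteq> x0" by auto
    define \<sigma> where "\<sigma> = sgn (y - x0)"
    define \<epsilon> where "\<epsilon> = (H x0 + c * (y - x0) - H y) / \<bar>y - x0\<bar>"
    have "\<epsilon> > 0" using lt \<open>y \<noteq> x0\<close> by (simp add: \<epsilon>_def)
    \<comment> \<open>\<open>\<eta>\<close> has to meet two demands: the foot of the competitor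
      stays between \<open>x0\<close> and \<open>y\<close>, and the error rate \<open>\<eta>\<close>
      is below \<open>\<epsilon>\<close>.\<close>
    have "((\<lambda>\<eta>. t * \<bar>df c - df (c - \<sigma> * \<eta>)\<bar>) \<longlongrightarrow> t * \<bar>df c - df (c - \<sigma> * 0)\<bar>) (at_right 0)"
      by (intro tendsto_intros isCont_tendsto_compose[OF isCont_df])
    then have "\<forall>\<^sub>F \<eta> in at_right 0. t * \<bar>df c - df (c - \<sigma> * \<eta>)\<bar> < \<bar>y - x0\<bar>"
      by (rule order_tendstoD) (use \<open>y \<noteq> x0\<close> in simp)
    moreover have "\<forall>\<^sub>F \<eta> in at_right 0. 0 < \<eta> \<and> \<eta> < \<epsilon>"
      using eventually_at_right_real[OF \<open>\<epsilon> > 0\<close>] by simp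
    ultimately have "\<forall>\<^sub>F \<eta> in at_right 0.
        t * \<bar>df c - df (c - \<sigma> * \<eta>)\<bar> < \<bar>y - x0\<bar> \<and> 0 < \<eta> \<and> \<eta> < \<epsilon>"
      by eventually_elim simp
    then obtain \<eta> where \<eta>: "t * \<bar>df c - df (c - \<sigma> * \<eta>)\<bar> < \<bar>y - x0\<bar>" "0 < \<eta>" "\<eta> < \<epsilon>"
      using eventually_happens[of _ "at_right (0::real)"] by fastforce
    define v where "v = c - \<sigma> * \<eta>"
    define z where "z = x - t * df v"
    have zx: "z - x0 = t * (df c - df v)" by (simp add: z_def x0_def algebra_simps)
    have "\<sigma> * (df c - df v) > 0"
      using \<open>y \<noteq> x0\<close> \<eta>(2) df_strict_mono[of v c] df_strict_mono[of c v]
      by (auto simp: v_def \<sigma>_def sgn_if)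
    then have "\<sigma> * (z - x0) > 0" using t unfolding zx by (metis mult.left_commute mult_pos_pos)
    define \<theta> where "\<theta> = (z - x0) / (y - x0)"
    have z: "z - x0 = \<theta> * (y - x0)" using \<open>y \<noteq> x0\<close> by (simp add: \<theta>_def)
    have "\<theta> > 0" using \<open>\<sigma> * (z - x0) > 0\<close> \<open>y \<noteq> x0\<close>
      by (auto simp: \<sigma>_def \<theta>_def sgn_if divide_neg_neg split: if_splits)
    have "\<bar>z - x0\<bar> < \<bar>y - x0\<bar>" using \<eta>(1) t unfolding zx v_def by (simp add: abs_mult)
    then have "\<theta> < 1" using \<open>\<theta> > 0\<close> \<open>y \<noteq> x0\<close> by (simp add: z abs_mult)
    \<comment> \<open>A supporting line at \<open>z\<close>, averaged over \<open>x0\<close> and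
      \<open>y\<close>, supplies the convexity inequality between them.\<close>
    obtain d where d: "supports H d z" unfolding H_def using ex_supports_hull[OF bound K0] by blast
    have "(1 - \<theta>) * (H z + d * (x0 - z)) + \<theta> * (H z + d * (y - z)) \<le> (1 - \<theta>) * H x0 + \<theta> * H y"
      using \<open>0 < \<theta>\<close> \<open>\<theta> < 1\<close> supportsD[OF d] by (intro add_mono mult_left_mono) auto
    moreover have "(1 - \<theta>) * (H z + d * (x0 - z)) + \<theta> * (H z + d * (y - z))
        = H z + d * (\<theta> * (y - x0) - (z - x0))"
      by (simp add: algebra_simps)
    ultimately have "H z - H x0 \<le> \<theta> * (H y - H x0)" unfolding z by (simp add: algebra_simps)
    also have "H y - H x0 = c * (y - x0) - \<epsilon> * \<bar>y - x0\<bar>" using \<open>y \<noteq> x0\<close> by (simp add: \<epsilon>_def)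
    also have "\<theta> * \<dots> = c * (z - x0) - \<epsilon> * \<bar>z - x0\<bar>"
      unfolding z using \<open>\<theta> > 0\<close> by (simp only: abs_mult abs_of_pos) (simp add: algebra_simps)
    finally have "\<epsilon> * \<bar>z - x0\<bar> \<le> \<bar>v - c\<bar> * \<bar>z - x0\<bar>" using foot[OF z_def] by linarith
    moreover have "\<bar>v - c\<bar> = \<eta>" using \<eta>(2) \<open>y \<noteq> x0\<close> by (simp add: v_def \<sigma>_def abs_mult)
    moreover have "\<bar>z - x0\<bar> > 0" using \<open>\<sigma> * (z - x0) > 0\<close> by auto
    ultimately show False using \<eta>(3) by simp
  qed
  then show "Phi_hull \<phi> (x - t * df c) + c * (y - (x - t * df c)) \<le> Phi_hull \<phi> y"
    by (simp add: x0_def H_def)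
qed

lemma mem_K_set:
  assumes "supports (Phi \<phi>) c x0" "t > 0" shows "(x0 + t * df c, t) \<in> K_set f \<phi>"
  using assms is_divide_iff[OF bound] unfolding K_set_def ray_def by blast

text \<open>A maximizer for the hull data at \<open>(x, t)\<close> supports the hull at its foot. A
  foot in \<open>K0 \<phi>\<close> emits a divide through the point, and a foot in a gap forces the
  slope of the hull there, which places the point in the region of this gap.\<close>

lemma cover:
  assumes K0: "K0 \<phi> \<noteq> {}" and t: "t > 0"
    and lr: "((\<lambda>y. Phi \<phi> y / y) \<longlongrightarrow> u_r_low \<phi>) at_top"
    and ll: "((\<lambda>y. Phi \<phi> y / y) \<longlongrightarrow> u_l_up \<phi>) at_bot"
  shows "(x, t) \<in> K_set f \<phi> \<union> \<Union>{H_region f \<phi> e h | e h. is_gap \<phi> e h}"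
proof -
  obtain c where c: "c \<in> maximizers f (phi_bar \<phi>) x t"
    using maximizers_nonempty[OF ess_bound_phi_bar[OF bound K0] t] by blast
  define x0 where "x0 = x - t * df c"
  have x: "x = x0 + t * df c" by (simp add: x0_def)
  have s: "supports (Phi_hull \<phi>) c x0"
    unfolding x0_def by (rule supports_hull_of_maximizer[OF K0 t c])
  show ?thesis
  proof (cases "x0 \<in> K0 \<phi>")
    case True
    then show ?thesis using mem_K_set[OF supports_Phi_of_hull[OF bound K0 s] t] x by simp
  next
    case False
    obtain e where e: "e < ereal x0" "e = -\<infinity> \<or> e \<in> ereal ` K0 \<phi>"
      "\<And>y. e < ereal y \<Longrightarrow> y \<le> x0 \<Longrightarrow> y \<notin> K0 \<phi>"
      using gap_left_end[OF closed_K0[OF bound K0] False] by metis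
    obtain h where h: "ereal x0 < h" "h = \<infinity> \<or> h \<in> ereal ` K0 \<phi>"
      "\<And>y. ereal y < h \<Longrightarrow> x0 \<le> y \<Longrightarrow> y \<notin> K0 \<phi>"
      using gap_right_end[OF closed_K0[OF bound K0] False] by metis
    have disj: "einterval e h \<inter> K0 \<phi> = {}"
      using e(3) h(3) by (auto simp: einterval_iff) (meson linear)
    have gap: "is_gap \<phi> e h"
      unfolding is_gap_def
      using einterval_mem_components[OF _ disj e(2) h(2)] less_trans[OF e(1) h(1)] by blast
    consider (bounded) e' h' where "e = ereal e'" "h = ereal h'"
      | (right) e' where "e = ereal e'" "h = \<infinity>"
      | (left) h' where "e = -\<infinity>" "h = ereal h'"
      | (all) "e = -\<infinity>" "h = \<infinity>"
      using e(2) h(2) by blast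
    then have "(x, t) \<in> H_region f \<phi> e h"
    proof cases
      case bounded
      have "c = chord_slope \<phi> e' h'"
        by (rule supports_unique_on_affine[OF _ s e(1) h(1)])
           (use bounded_gap_supports(4)[OF bound] gap bounded in auto)
      then show ?thesis using x t e(1) h(1) bounded by (simp add: H_region_def H_bounded_def)
    next
      case right
      have "c = u_r_low \<phi>"
        by (rule supports_unique_on_affine[OF _ s e(1) h(1)])
           (use right_gap_supports(2)[OF bound _ lr] gap right in auto)
      then show ?thesis using x t e(1) h(1) gap is_gap_Sup right
        by (simp add: H_region_def H_infty_def)
    next
      case left
      have "c = u_l_up \<phi>"
        by (rule supports_unique_on_affine[OF _ s e(1) h(1)])
           (use left_gap_supports(2)[OF bound _ ll] gap left in auto)
      then show ?thesis using x t e(1) h(1) gap is_gap_Inf left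
        by (simp add: H_region_def H_minus_infty_def)
    next
      case all
      then show ?thesis using disj K0 by (auto simp: einterval_def)
    qed
    then show ?thesis using gap by blast
  qed
qed

end

end

section \<open>Asymptotics of a flux with a degenerate point\<close>

lemma power_bound_of_deriv:
  fixes p :: "real \<Rightarrow> real"
  assumes "p 0 = 0" "m \<ge> 0" and der: "\<And>x. (p has_real_derivative p' x) (at x)"
    and le: "\<And>x. 0 < x \<Longrightarrow> x < \<delta> \<Longrightarrow> p' x \<le> K * x powr m"
    and s: "0 \<le> s" "s < \<delta>"
  shows "p s \<le> K / (1 + m) * s powr (1 + m)"
proof -
  define q where "q x = K / (1 + m) * x powr (1 + m) - p x" for x
  have "q 0 \<le> q s"
  proof (rule DERIV_nonneg_imp_increasing_open[OF s(1)])
    fix x assume x: "0 < x" "x < s"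
    have "(q has_real_derivative K * x powr m - p' x) (at x)"
      unfolding q_def [abs_def]
      by (rule derivative_eq_intros der refl | use x \<open>m \<ge> 0\<close> in simp)+
    moreover have "K * x powr m - p' x \<ge> 0" using le[of x] x s by simp
    ultimately show "\<exists>y. (q has_real_derivative y) (at x) \<and> y \<ge> 0" by blast
  next
    have "continuous_on {0..s} p"
      using der DERIV_isCont by (blast intro: continuous_at_imp_continuous_on)
    then show "continuous_on {0..s} q"
      unfolding q_def [abs_def] using \<open>m \<ge> 0\<close>
      by (intro continuous_intros continuous_on_powr') auto
  qed
  then show ?thesis using \<open>p 0 = 0\<close> by (simp add: q_def)
qed

lemma power_bounds_of_deriv:
  fixes p :: "real \<Rightarrow> real"
  assumes "p 0 = 0" "m \<ge> 0" and der: "\<And>x. (p has_real_derivative p' x) (at x)"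
    and le: "\<And>x. 0 < x \<Longrightarrow> x < \<delta> \<Longrightarrow> k * x powr m \<le> p' x \<and> p' x \<le> K * x powr m"
    and s: "0 \<le> s" "s < \<delta>"
  shows "k / (1 + m) * s powr (1 + m) \<le> p s" "p s \<le> K / (1 + m) * s powr (1 + m)"
proof -
  show "p s \<le> K / (1 + m) * s powr (1 + m)"
    by (rule power_bound_of_deriv[OF assms(1,2) der _ s]) (use le in blast)
  have "- p s \<le> (- k) / (1 + m) * s powr (1 + m)"
    by (rule power_bound_of_deriv[OF _ \<open>m \<ge> 0\<close> DERIV_minus[OF der] _ s])
       (use le \<open>p 0 = 0\<close> in auto)
  then show "k / (1 + m) * s powr (1 + m) \<le> p s" by simp
qed

context convex_flux
begin

text \<open>The asymptotics of \<open>ddf\<close> are integrated once for \<open>df\<close> and,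
  with the extra factor \<open>v - c\<close>, once for the divergence, which accounts for
  \<open>1 + a\<close> and \<open>2 + a\<close>. The sign \<open>\<sigma>\<close> treats both sides
  of \<open>c\<close> at once.\<close>

lemma flux_asymp:
  assumes a: "a \<ge> 0" and lim: "((\<lambda>v. ddf v / \<bar>v - c\<bar> powr a) \<longlongrightarrow> N) (at c)" and "\<eta> > 0"
  obtains \<delta> where "\<delta> > 0"
    "\<And>v. \<bar>v - c\<bar> < \<delta> \<Longrightarrow> (N - \<eta>) / (1 + a) * \<bar>v - c\<bar> powr (1 + a) \<le> \<bar>df v - df c\<bar>"
    "\<And>v. \<bar>v - c\<bar> < \<delta> \<Longrightarrow> \<bar>df v - df c\<bar> \<le> (N + \<eta>) / (1 + a) * \<bar>v - c\<bar> powr (1 + a)"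
    "\<And>v. \<bar>v - c\<bar> < \<delta> \<Longrightarrow> (N - \<eta>) / (2 + a) * \<bar>v - c\<bar> powr (2 + a) \<le> breg c v"
    "\<And>v. \<bar>v - c\<bar> < \<delta> \<Longrightarrow> breg c v \<le> (N + \<eta>) / (2 + a) * \<bar>v - c\<bar> powr (2 + a)"
proof -
  have "\<forall>\<^sub>F v in at c. dist (ddf v / \<bar>v - c\<bar> powr a) N < \<eta>"
    using lim \<open>\<eta> > 0\<close> by (rule tendstoD)
  then obtain \<delta> where \<delta>: "\<delta> > 0"
    and close: "\<And>v. v \<noteq> c \<Longrightarrow> dist v c < \<delta> \<Longrightarrow> dist (ddf v / \<bar>v - c\<bar> powr a) N < \<eta>"
    unfolding eventually_at by auto
  have ddf: "(N - \<eta>) * s powr a \<le> ddf (c + \<sigma> * s) \<and> ddf (c + \<sigma> * s) \<le> (N + \<eta>) * s powr a"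
    if "0 < s" "s < \<delta>" "\<bar>\<sigma>\<bar> = 1" for s \<sigma>
  proof -
    have "\<bar>\<sigma> * s\<bar> = s" using that by (simp add: abs_mult)
    then have "dist (ddf (c + \<sigma> * s) / s powr a) N < \<eta>"
      using close[of "c + \<sigma> * s"] that by (auto simp: dist_real_def)
    then have "N - \<eta> \<le> ddf (c + \<sigma> * s) / s powr a" "ddf (c + \<sigma> * s) / s powr a \<le> N + \<eta>"
      by (auto simp: dist_real_def)
    then show ?thesis using that by (simp add: field_simps)
  qed
  have *: "(N - \<eta>) / (1 + a) * \<bar>v - c\<bar> powr (1 + a) \<le> \<bar>df v - df c\<bar>
      \<and> \<bar>df v - df c\<bar> \<le> (N + \<eta>) / (1 + a) * \<bar>v - c\<bar> powr (1 + a)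
      \<and> (N - \<eta>) / (2 + a) * \<bar>v - c\<bar> powr (2 + a) \<le> breg c v
      \<and> breg c v \<le> (N + \<eta>) / (2 + a) * \<bar>v - c\<bar> powr (2 + a)"
    if "\<bar>v - c\<bar> < \<delta>" for v
  proof -
    define s \<sigma> where "s = \<bar>v - c\<bar>" and "\<sigma> = (if c \<le> v then 1 else - 1 :: real)"
    have \<sigma>: "\<bar>\<sigma>\<bar> = 1" "\<sigma> * \<sigma> = 1" and v: "c + \<sigma> * s = v" by (auto simp: s_def \<sigma>_def)
    have s: "0 \<le> s" "s < \<delta>" using that by (auto simp: s_def)
    have abs: "\<bar>df v - df c\<bar> = \<sigma> * (df (c + \<sigma> * s) - df c)"
      unfolding v using df_mono[of c v] df_mono[of v c] by (simp add: \<sigma>_def)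
    have "((\<lambda>s. df (c + \<sigma> * s)) has_real_derivative \<sigma> * ddf (c + \<sigma> * s)) (at s)" for s
      by (rule DERIV_chain2[OF DERIV_df, THEN DERIV_cong]) (auto intro!: derivative_eq_intros)
    then have d1: "((\<lambda>s. \<sigma> * (df (c + \<sigma> * s) - df c)) has_real_derivative ddf (c + \<sigma> * s)) (at s)" for s
    proof -
      have "((\<lambda>s. \<sigma> * (df (c + \<sigma> * s) - df c)) has_real_derivative
          \<sigma> * (\<sigma> * ddf (c + \<sigma> * s) - 0)) (at s)"
        by (intro DERIV_cmult DERIV_diff DERIV_const) fact
      then show ?thesis by (simp add: \<sigma>(2) flip: mult.assoc)
    qed
    have d2: "((\<lambda>s. breg c (c + \<sigma> * s)) has_real_derivative s * ddf (c + \<sigma> * s)) (at s)" for s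
    proof -
      have "((\<lambda>s. breg c (c + \<sigma> * s)) has_real_derivative
          ((c + \<sigma> * s - c) * ddf (c + \<sigma> * s)) * \<sigma>) (at s)"
        by (rule DERIV_chain2[OF DERIV_breg]) (auto intro!: derivative_eq_intros)
      then show ?thesis by (rule DERIV_cong) (use \<sigma>(2) in algebra)
    qed
    have bnd2: "(N - \<eta>) * s powr (1 + a) \<le> s * ddf (c + \<sigma> * s)
        \<and> s * ddf (c + \<sigma> * s) \<le> (N + \<eta>) * s powr (1 + a)" if "0 < s" "s < \<delta>" for s
    proof -
      have "s * ((N - \<eta>) * s powr a) \<le> s * ddf (c + \<sigma> * s)"
        "s * ddf (c + \<sigma> * s) \<le> s * ((N + \<eta>) * s powr a)"
        using ddf[OF that \<sigma>(1)] that by (auto intro: mult_left_mono)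
      moreover have "s powr (1 + a) = s * s powr a" using that by (simp add: powr_add)
      ultimately show ?thesis by (simp add: mult.left_commute)
    qed
    have "(N - \<eta>) / (1 + a) * s powr (1 + a) \<le> \<sigma> * (df (c + \<sigma> * s) - df c)"
      "\<sigma> * (df (c + \<sigma> * s) - df c) \<le> (N + \<eta>) / (1 + a) * s powr (1 + a)"
      using power_bounds_of_deriv[OF _ a d1 _ s, where k = "N - \<eta>" and K = "N + \<eta>"]
        ddf \<sigma>(1) by auto
    moreover have "(N - \<eta>) / (1 + (1 + a)) * s powr (1 + (1 + a)) \<le> breg c (c + \<sigma> * s)"
      "breg c (c + \<sigma> * s) \<le> (N + \<eta>) / (1 + (1 + a)) * s powr (1 + (1 + a))"
      using power_bounds_of_deriv[OF _ _ d2 bnd2 s] a by auto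
    ultimately show ?thesis unfolding abs by (simp add: v flip: s_def)
  qed
  show ?thesis by (rule that[OF \<delta>]) (use * in blast)+
qed

text \<open>At \<open>w = t powr - \<theta>\<close>, where \<open>\<theta>\<close> is the exponent of the claim, \<open>t * w powr (2 + a)\<close> and
  \<open>(t * w powr (1 + a)) powr \<gamma>\<close> are the same power \<open>\<kappa> \<ge> 0\<close> of \<open>t\<close>.\<close>

lemma rate_of_power_bound:
  fixes t w k K C a \<gamma> :: real
  assumes t: "t \<ge> 1" and w: "w \<ge> 0" and pos: "k > 0" "K \<ge> 0" "C \<ge> 0" and a: "a \<ge> 0"
    and \<gamma>: "0 \<le> \<gamma>" "\<gamma> < 1"
    and le: "t * (k * w powr (2 + a)) \<le> C * (1 + (t * (K * w powr (1 + a))) powr \<gamma>)"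
  shows "w \<le> max 1 (C * (1 + K powr \<gamma>) / k) * t powr - ((1 - \<gamma>) / (2 - \<gamma> + a * (1 - \<gamma>)))"
proof -
  define \<theta> where "\<theta> = (1 - \<gamma>) / (2 - \<gamma> + a * (1 - \<gamma>))"
  \<comment> \<open>\<open>w\<close> in units of the claimed rate; it remains to bound
    \<open>z\<close> independently of \<open>t\<close>.\<close>
  define z where "z = w * t powr \<theta>"
  define \<kappa> where "\<kappa> = 1 - \<theta> * (2 + a)"
  have den: "2 - \<gamma> + a * (1 - \<gamma>) > 0" using \<gamma> a by (intro add_pos_nonneg) auto
  have bal: "\<theta> * (2 - \<gamma> + a * (1 - \<gamma>)) = 1 - \<gamma>" using den by (simp add: \<theta>_def)
  \<comment> \<open>Equality of the two exponents of \<open>t\<close> is what determines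
    \<open>\<theta>\<close>.\<close>
  have \<kappa>2: "\<kappa> = \<gamma> * (1 - \<theta> * (1 + a))" using bal by (simp add: \<kappa>_def algebra_simps)
  have \<theta>0: "0 \<le> \<theta>" using den \<gamma> by (simp add: \<theta>_def)
  have "\<kappa> * (1 - \<gamma>) = \<gamma> * \<theta>" using \<kappa>2 by (simp add: \<kappa>_def algebra_simps)
  then have "\<kappa> \<ge> 0" using \<gamma> \<theta>0
    by (metis diff_gt_0_iff_gt mult_nonneg_nonneg zero_le_mult_iff not_less order_less_imp_le)
  have z0: "z \<ge> 0" using w by (simp add: z_def)
  have wz: "w = z * t powr - \<theta>" using t by (simp add: z_def powr_minus)
  have "z \<le> max 1 (C * (1 + K powr \<gamma>) / k)"
  proof (cases "z \<le> 1")
    case False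
    then have z1: "z > 1" by simp
    have t0: "t > 0" using t by simp
    have tw: "t * w powr e = z powr e * t powr (1 - \<theta> * e)" for e
    proof -
      have "w powr e = z powr e * t powr (- \<theta> * e)" unfolding wz using z0 by (simp add: powr_mult powr_powr)
      moreover have "t powr (1 - \<theta> * e) = t * t powr (- \<theta> * e)"
        using t0 powr_add[of t 1 "- \<theta> * e"] by simp
      ultimately show ?thesis by simp
    qed
    have l: "t * (k * w powr (2 + a)) = k * z powr (2 + a) * t powr \<kappa>"
      using tw[of "2 + a"] by (simp add: \<kappa>_def mult.left_commute)
    have "t * w powr (1 + a) = z powr (1 + a) * t powr (1 - \<theta> * (1 + a))" by (rule tw)
    then have Kw: "t * (K * w powr (1 + a)) = K * (z powr (1 + a) * t powr (1 - \<theta> * (1 + a)))"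
      by (simp add: mult.left_commute)
    have r: "(t * (K * w powr (1 + a))) powr \<gamma> = K powr \<gamma> * z powr ((1 + a) * \<gamma>) * t powr \<kappa>"
      unfolding Kw using t0 z0 pos by (simp add: powr_mult powr_powr \<kappa>2 mult.commute)
    have tk: "1 \<le> t powr \<kappa>" using t \<open>\<kappa> \<ge> 0\<close> by (rule ge_one_powr_ge_zero)
    \<comment> \<open>For \<open>z > 1\<close> the right-hand side grows at most like
      \<open>z powr (1 + a)\<close>, one power less than the left-hand side, so \<open>z\<close> is
      bounded. The 1 in the maximum covers \<open>z \<le> 1\<close>.\<close>
    have "(1 + a) * \<gamma> \<le> 1 + a" using \<gamma> a by (simp add: mult_left_le)
    then have zle: "z powr ((1 + a) * \<gamma>) \<le> z powr (1 + a)" using z1 by (intro powr_mono) auto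
    have z1': "1 \<le> z powr (1 + a)" using z1 a by (intro ge_one_powr_ge_zero) auto
    have "k * z powr (2 + a) * t powr \<kappa> \<le> C * (1 + K powr \<gamma> * z powr ((1 + a) * \<gamma>) * t powr \<kappa>)"
      using le by (simp only: l r)
    also have "\<dots> \<le> C * (t powr \<kappa> * z powr (1 + a) + K powr \<gamma> * z powr (1 + a) * t powr \<kappa>)"
      using pos zle tk z1' mult_mono[OF tk z1'] by (intro mult_left_mono add_mono mult_right_mono) auto
    also have "\<dots> = C * (1 + K powr \<gamma>) * z powr (1 + a) * t powr \<kappa>" by (simp add: algebra_simps)
    finally have "k * z powr (2 + a) \<le> C * (1 + K powr \<gamma>) * z powr (1 + a)"
      using t0 by (simp add: mult_le_cancel_right)
    moreover have "z powr (2 + a) = z * z powr (1 + a)"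
      using z1 powr_add[of z 1 "1 + a"] by (simp add: add.assoc[symmetric])
    ultimately have "(k * z) * z powr (1 + a) \<le> (C * (1 + K powr \<gamma>)) * z powr (1 + a)"
      by (simp add: mult.assoc)
    then have "k * z \<le> C * (1 + K powr \<gamma>)" using z1 by (simp add: mult_le_cancel_right)
    then show ?thesis using pos by (simp add: field_simps le_max_iff_disj)
  qed simp
  then have "w \<le> max 1 (C * (1 + K powr \<gamma>) / k) * t powr - \<theta>"
    unfolding wz by (intro mult_right_mono) auto
  then show ?thesis unfolding \<theta>_def .
qed

text \<open>Makes the local asymptotics uniform over the bounded range of the maximizers: off a
  neighbourhood of \<open>c\<close> the divergence is, by monotonicity, at least its smaller value
  \<open>m\<close> at the ends of that neighbourhood, and the remaining quantities are
  bounded.\<close>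

lemma flux_global_bounds:
  assumes a: "a \<ge> 0" and N: "N > 0" and lim: "((\<lambda>v. ddf v / \<bar>v - c\<bar> powr a) \<longlongrightarrow> N) (at c)"
  obtains k K where "k > 0" "K \<ge> 0"
    "\<And>v. \<bar>v\<bar> \<le> B \<Longrightarrow> k * \<bar>v - c\<bar> powr (2 + a) \<le> breg c v"
    "\<And>v. \<bar>v\<bar> \<le> B \<Longrightarrow> \<bar>df v - df c\<bar> \<le> K * \<bar>v - c\<bar> powr (1 + a)"
proof -
  obtain \<delta> where \<delta>: "\<delta> > 0"
    "\<And>v. \<bar>v - c\<bar> < \<delta> \<Longrightarrow> \<bar>df v - df c\<bar> \<le> (N + N / 2) / (1 + a) * \<bar>v - c\<bar> powr (1 + a)"
    "\<And>v. \<bar>v - c\<bar> < \<delta> \<Longrightarrow> (N - N / 2) / (2 + a) * \<bar>v - c\<bar> powr (2 + a) \<le> breg c v"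
    using flux_asymp[OF a lim, of "N / 2"] N by (metis half_gt_zero)
  define m where "m = min (breg c (c + \<delta>)) (breg c (c - \<delta>))"
  have m: "m > 0" using breg_pos \<delta>(1) by (simp add: m_def)
  define R where "R = \<bar>B\<bar> + \<bar>c\<bar> + 1"
  have R: "R > 0" "\<And>v. \<bar>v\<bar> \<le> B \<Longrightarrow> \<bar>v - c\<bar> \<le> R" by (auto simp: R_def)
  define D where "D = max \<bar>df B - df c\<bar> \<bar>df (-B) - df c\<bar>"
  have D: "\<bar>df v - df c\<bar> \<le> D" if "\<bar>v\<bar> \<le> B" for v
  proof -
    have "df v \<le> df B" "df (-B) \<le> df v" using df_mono that by auto
    then show ?thesis unfolding D_def by linarith
  qed
  have "D \<ge> 0" by (simp add: D_def)
  define k where "k = min ((N - N / 2) / (2 + a)) (m / R powr (2 + a))"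
  define K where "K = max ((N + N / 2) / (1 + a)) (D / \<delta> powr (1 + a))"
  have "k > 0" using N a m R by (auto simp: k_def)
  have "K \<ge> 0" using N a by (simp add: K_def le_max_iff_disj)
  moreover have "k * \<bar>v - c\<bar> powr (2 + a) \<le> breg c v" if v: "\<bar>v\<bar> \<le> B" for v
  proof (cases "\<bar>v - c\<bar> < \<delta>")
    case True
    have "k * \<bar>v - c\<bar> powr (2 + a) \<le> (N - N / 2) / (2 + a) * \<bar>v - c\<bar> powr (2 + a)"
      by (intro mult_right_mono) (auto simp: k_def)
    then show ?thesis using \<delta>(3)[OF True] by simp
  next
    case False
    have "k * \<bar>v - c\<bar> powr (2 + a) \<le> m / R powr (2 + a) * R powr (2 + a)"
      using R(2)[OF v] a \<open>k > 0\<close> m by (intro mult_mono powr_mono2) (auto simp: k_def)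
    also have "\<dots> = m" using R by simp
    also have "\<dots> \<le> breg c v"
    proof (cases "c \<le> v")
      case True
      then show ?thesis
        using False breg_mono_right[of c "c + \<delta>" v] \<delta>(1) by (simp add: m_def min_le_iff_disj)
    next
      case f: False
      then show ?thesis
        using False breg_mono_left[of v "c - \<delta>" c] \<delta>(1) by (simp add: m_def min_le_iff_disj)
    qed
    finally show ?thesis .
  qed
  moreover have "\<bar>df v - df c\<bar> \<le> K * \<bar>v - c\<bar> powr (1 + a)" if v: "\<bar>v\<bar> \<le> B" for v
  proof (cases "\<bar>v - c\<bar> < \<delta>")
    case True
    have "(N + N / 2) / (1 + a) * \<bar>v - c\<bar> powr (1 + a) \<le> K * \<bar>v - c\<bar> powr (1 + a)"
      by (intro mult_right_mono) (auto simp: K_def)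
    then show ?thesis using \<delta>(2)[OF True] by simp
  next
    case False
    have "D = D / \<delta> powr (1 + a) * \<delta> powr (1 + a)" using \<delta>(1) by simp
    also have "\<dots> \<le> K * \<bar>v - c\<bar> powr (1 + a)"
      using False \<delta>(1) a \<open>K \<ge> 0\<close> by (intro mult_mono powr_mono2) (auto simp: K_def)
    finally show ?thesis using D[OF v] by simp
  qed
  ultimately show ?thesis using that \<open>k > 0\<close> by blast
qed

lemma flux_rate:
  assumes a: "a \<ge> 0" "N > 0" "((\<lambda>v. ddf v / \<bar>v - c\<bar> powr a) \<longlongrightarrow> N) (at c)"
    and \<gamma>: "0 \<le> \<gamma>" "\<gamma> < 1" and C: "C \<ge> 0"
  shows "\<exists>C'. \<forall>t\<ge>1. \<forall>v. \<bar>v\<bar> \<le> B \<longrightarrow>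
      t * breg c v \<le> C * (1 + \<bar>t * (df v - df c)\<bar> powr \<gamma>) \<longrightarrow>
      \<bar>v - c\<bar> \<le> C' * t powr - ((1 - \<gamma>) / (2 - \<gamma> + a * (1 - \<gamma>)))"
proof -
  obtain k K where kK: "k > 0" "K \<ge> 0"
    "\<And>v. \<bar>v\<bar> \<le> B \<Longrightarrow> k * \<bar>v - c\<bar> powr (2 + a) \<le> breg c v"
    "\<And>v. \<bar>v\<bar> \<le> B \<Longrightarrow> \<bar>df v - df c\<bar> \<le> K * \<bar>v - c\<bar> powr (1 + a)"
    using flux_global_bounds[OF a, where B = B] by metis
  show ?thesis
  proof (intro exI allI impI)
    fix t v :: real
    assume t: "t \<ge> 1" and v: "\<bar>v\<bar> \<le> B"
      and le: "t * breg c v \<le> C * (1 + \<bar>t * (df v - df c)\<bar> powr \<gamma>)"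
    have "t * (k * \<bar>v - c\<bar> powr (2 + a)) \<le> t * breg c v"
      using kK(3)[OF v] t by (intro mult_left_mono) auto
    also note le
    also have "C * (1 + \<bar>t * (df v - df c)\<bar> powr \<gamma>)
        \<le> C * (1 + (t * (K * \<bar>v - c\<bar> powr (1 + a))) powr \<gamma>)"
      using kK(4)[OF v] t \<gamma> C by (intro mult_left_mono add_left_mono powr_mono2) (auto simp: abs_mult)
    finally show "\<bar>v - c\<bar> \<le> max 1 (C * (1 + K powr \<gamma>) / k) *
        t powr - ((1 - \<gamma>) / (2 - \<gamma> + a * (1 - \<gamma>)))"
      using rate_of_power_bound[OF t abs_ge_zero kK(1,2) C a(1) \<gamma>] by blast
  qed
qed

end

section \<open>Deviation of the primitive from its mean growth\<close>

text \<open>The summand 1 covers displacements below the threshold of the asymptotic hypothesis, so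
  that the bound can hold for all pairs in \<open>S\<close>.\<close>

definition mean_deviation_le :: "(real \<Rightarrow> real) \<Rightarrow> real \<Rightarrow> real \<Rightarrow> real set \<Rightarrow> real \<Rightarrow> bool" where
  "mean_deviation_le F c \<gamma> S C \<longleftrightarrow> C \<ge> 0 \<and>
     (\<forall>y\<in>S. \<forall>z\<in>S. \<bar>(F z - c * z) - (F y - c * y)\<bar> \<le> C * (1 + \<bar>z - y\<bar> powr \<gamma>))"

text \<open>The one-sided bound for a single pair: \<open>x\<close> will be the foot of the
  competitor \<open>c\<close>, and \<open>y\<close> the foot of a maximizer.\<close>

definition excess_le :: "(real \<Rightarrow> real) \<Rightarrow> real \<Rightarrow> real \<Rightarrow> real \<Rightarrow> real \<Rightarrow> real \<Rightarrow> bool" where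
  "excess_le F c \<gamma> C x y \<longleftrightarrow> (F x - c * x) - (F y - c * y) \<le> C * (1 + \<bar>x - y\<bar> powr \<gamma>)"

lemma mean_deviation_le_reflect:
  assumes "mean_deviation_le F c \<gamma> S C"
  shows "mean_deviation_le (\<lambda>x. F (- x)) (- c) \<gamma> (uminus ` S) C"
  using assms unfolding mean_deviation_le_def by (auto simp: abs_minus_commute)

lemma excess_le_reflect:
  "excess_le (\<lambda>x. F (- x)) (- c) \<gamma> C x y \<longleftrightarrow> excess_le F c \<gamma> C (- x) (- y)"
  unfolding excess_le_def by (simp add: abs_minus_commute)

lemma excess_le_of_mean_deviation:
  "mean_deviation_le F c \<gamma> S C \<Longrightarrow> x \<in> S \<Longrightarrow> y \<in> S \<Longrightarrow> excess_le F c \<gamma> C x y"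
  unfolding mean_deviation_le_def excess_le_def by (meson abs_le_D1)

text \<open>Short displacements are handled by the Lipschitz bound. The half-line
  \<open>{0..}\<close> is replaced by \<open>{b..}\<close> because the splitting point will also be
  an end of a gap or the start of a characteristic.\<close>

lemma mean_deviation_right:
  fixes F :: "real \<Rightarrow> real"
  assumes lip: "\<And>x y. \<bar>F y - F x\<bar> \<le> M * \<bar>y - x\<bar>" and \<gamma>: "0 \<le> \<gamma>"
    and ev: "\<exists>C. \<forall>\<^sub>F x in at_top. \<forall>y\<ge>0. \<bar>F (y + x) - F y - c * x\<bar> \<le> C * x powr \<gamma>"
  shows "\<exists>C. mean_deviation_le F c \<gamma> {b..} C"
proof -
  obtain C where "\<forall>\<^sub>F x in at_top. \<forall>y\<ge>0. \<bar>F (y + x) - F y - c * x\<bar> \<le> C * x powr \<gamma>"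
    using ev by blast
  then obtain X where X: "\<And>x y. x \<ge> X \<Longrightarrow> y \<ge> 0 \<Longrightarrow> \<bar>F (y + x) - F y - c * x\<bar> \<le> C * x powr \<gamma>"
    by (auto simp: eventually_at_top_linorder)
  have M: "M \<ge> 0" using lip[of 1 0] by simp
  define L where "L = M + \<bar>c\<bar>"
  have "L \<ge> 0" using M by (simp add: L_def)
  have L: "\<bar>(F z - c * z) - (F y - c * y)\<bar> \<le> L * \<bar>z - y\<bar>" for y z
  proof -
    have "(F z - c * z) - (F y - c * y) = (F z - F y) - c * (z - y)" by (simp add: algebra_simps)
    also have "\<bar>\<dots>\<bar> \<le> \<bar>F z - F y\<bar> + \<bar>c\<bar> * \<bar>z - y\<bar>" by (metis abs_mult abs_triangle_ineq4)
    also have "\<dots> \<le> L * \<bar>z - y\<bar>" using lip[of z y] by (simp add: L_def distrib_right)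
    finally show ?thesis .
  qed
  define C1 where "C1 = \<bar>C\<bar> + L * \<bar>X\<bar>"
  have "C1 \<ge> 0" using \<open>L \<ge> 0\<close> by (simp add: C1_def)
  have pos: "\<bar>(F (y + x) - c * (y + x)) - (F y - c * y)\<bar> \<le> C1 * (1 + x powr \<gamma>)"
    if "x \<ge> 0" "y \<ge> 0" for x y
  proof (cases "x \<ge> X")
    case True
    have "\<bar>(F (y + x) - c * (y + x)) - (F y - c * y)\<bar> = \<bar>F (y + x) - F y - c * x\<bar>"
      by (simp add: algebra_simps)
    also have "\<dots> \<le> C * x powr \<gamma>" by (rule X[OF True that(2)])
    also have "\<dots> \<le> C1 * (1 + x powr \<gamma>)"
      using \<open>L \<ge> 0\<close> by (intro mult_mono) (auto simp: C1_def intro: add_increasing2)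
    finally show ?thesis .
  next
    case False
    have "\<bar>(F (y + x) - c * (y + x)) - (F y - c * y)\<bar> \<le> L * x"
      using L[of "y + x" y] that by simp
    also have "\<dots> \<le> L * \<bar>X\<bar>" using False \<open>L \<ge> 0\<close> by (intro mult_left_mono) auto
    also have "\<dots> \<le> C1 * (1 + x powr \<gamma>)"
      using mult_mono[of "L * \<bar>X\<bar>" C1 1 "1 + x powr \<gamma>"] \<open>C1 \<ge> 0\<close> by (simp add: C1_def)
    finally show ?thesis .
  qed
  have pos': "\<bar>(F z - c * z) - (F y - c * y)\<bar> \<le> C1 * (1 + \<bar>z - y\<bar> powr \<gamma>)"
    if "y \<ge> 0" "z \<ge> 0" for y z
    using pos[of "z - y" y] pos[of "y - z" z] that by (cases "y \<le> z") (auto simp: abs_minus_commute)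
  define C2 where "C2 = C1 + 2 * (L * \<bar>b\<bar>)"
  have "mean_deviation_le F c \<gamma> {b..} C2"
    unfolding mean_deviation_le_def
  proof (intro conjI ballI)
    show "C2 \<ge> 0" using \<open>C1 \<ge> 0\<close> \<open>L \<ge> 0\<close> by (simp add: C2_def)
    fix y z assume yz: "y \<in> {b..}" "z \<in> {b..}"
    \<comment> \<open>Projecting to \<open>{0..}\<close> moves a point of \<open>{b..}\<close> by at
      most \<open>\<bar>b\<bar>\<close> and does not increase distances.\<close>
    have near: "\<bar>(F (max w 0) - c * max w 0) - (F w - c * w)\<bar> \<le> L * \<bar>b\<bar>" if "w \<in> {b..}" for w
    proof -
      have "\<bar>(F (max w 0) - c * max w 0) - (F w - c * w)\<bar> \<le> L * \<bar>max w 0 - w\<bar>" by (rule L)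
      also have "\<dots> \<le> L * \<bar>b\<bar>" using that \<open>L \<ge> 0\<close> by (intro mult_left_mono) auto
      finally show ?thesis .
    qed
    have "\<bar>(F (max z 0) - c * max z 0) - (F (max y 0) - c * max y 0)\<bar>
        \<le> C1 * (1 + \<bar>max z 0 - max y 0\<bar> powr \<gamma>)" by (rule pos') auto
    also have "\<dots> \<le> C1 * (1 + \<bar>z - y\<bar> powr \<gamma>)"
      using \<gamma> \<open>C1 \<ge> 0\<close> by (intro mult_left_mono add_left_mono powr_mono2) linarith+
    finally have mid: "\<bar>(F (max z 0) - c * max z 0) - (F (max y 0) - c * max y 0)\<bar>
        \<le> C1 * (1 + \<bar>z - y\<bar> powr \<gamma>)" .
    have tri: "\<bar>q - p\<bar> \<le> d + 2 * e" if "\<bar>q' - p'\<bar> \<le> d" "\<bar>p' - p\<bar> \<le> e" "\<bar>q' - q\<bar> \<le> e"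
      for p q p' q' d e :: real
      using that by linarith
    have "\<bar>(F z - c * z) - (F y - c * y)\<bar> \<le> C1 * (1 + \<bar>z - y\<bar> powr \<gamma>) + 2 * (L * \<bar>b\<bar>)"
      by (rule tri[OF mid near[OF yz(1)] near[OF yz(2)]])
    also have "2 * (L * \<bar>b\<bar>) \<le> 2 * (L * \<bar>b\<bar>) * (1 + \<bar>z - y\<bar> powr \<gamma>)"
      using mult_left_mono[of 1 "1 + \<bar>z - y\<bar> powr \<gamma>" "2 * (L * \<bar>b\<bar>)"] \<open>L \<ge> 0\<close> by simp
    finally show "\<bar>(F z - c * z) - (F y - c * y)\<bar> \<le> C2 * (1 + \<bar>z - y\<bar> powr \<gamma>)"
      by (simp add: C2_def algebra_simps)
  qed
  then show ?thesis by blast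
qed

lemma mean_deviation_left:
  fixes F :: "real \<Rightarrow> real"
  assumes lip: "\<And>x y. \<bar>F y - F x\<bar> \<le> M * \<bar>y - x\<bar>" and \<gamma>: "0 \<le> \<gamma>"
    and ev: "\<exists>C. \<forall>\<^sub>F x in at_bot. \<forall>y\<le>0. \<bar>F (y + x) - F y - c * x\<bar> \<le> C * (- x) powr \<gamma>"
  shows "\<exists>C. mean_deviation_le F c \<gamma> {..b} C"
proof -
  obtain C where C: "\<forall>\<^sub>F x in at_top. \<forall>y\<le>0. \<bar>F (y - x) - F y + c * x\<bar> \<le> C * x powr \<gamma>"
    using ev by (auto simp: at_bot_mirror eventually_filtermap)
  have "\<exists>C. mean_deviation_le (\<lambda>x. F (- x)) (- c) \<gamma> {- b..} C"
  proof (rule mean_deviation_right)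
    show "\<bar>F (- y) - F (- x)\<bar> \<le> M * \<bar>y - x\<bar>" for x y
      using lip[of "- x" "- y"] by (simp add: abs_minus_commute)
    show "\<exists>C. \<forall>\<^sub>F x in at_top. \<forall>y\<ge>0. \<bar>F (- (y + x)) - F (- y) - - c * x\<bar> \<le> C * x powr \<gamma>"
    proof (rule exI)
      show "\<forall>\<^sub>F x in at_top. \<forall>y\<ge>0. \<bar>F (- (y + x)) - F (- y) - - c * x\<bar> \<le> C * x powr \<gamma>"
        using C
      proof eventually_elim
        case (elim x)
        show ?case
        proof (intro allI impI)
          fix y :: real assume "y \<ge> 0"
          then show "\<bar>F (- (y + x)) - F (- y) - - c * x\<bar> \<le> C * x powr \<gamma>"
            using elim[rule_format, of "- y"] by simp
        qed
      qed
    qed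
  qed (use \<gamma> in simp)
  then obtain C where "mean_deviation_le (\<lambda>x. F (- x)) (- c) \<gamma> {- b..} C" by blast
  from mean_deviation_le_reflect[OF this] show ?thesis by auto
qed

text \<open>A foot \<open>y\<close> beyond \<open>e\<close> can be replaced by \<open>e\<close>: the
  supporting line makes \<open>F e - c * e\<close> no larger than \<open>F y - c * y\<close>, and
  \<open>e\<close> is closer to \<open>x\<close>.\<close>

lemma excess_right_of_support:
  assumes s: "supports F c e" and dev: "mean_deviation_le F c \<gamma> {e..} C" and \<gamma>: "0 \<le> \<gamma>"
    and x: "x \<ge> e"
  shows "excess_le F c \<gamma> C x y"
proof (cases "y \<ge> e")
  case True
  then show ?thesis using excess_le_of_mean_deviation[OF dev] x by simp
next
  case False
  have "(F x - c * x) - (F y - c * y) \<le> (F x - c * x) - (F e - c * e)"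
    using supportsD[OF s, of y] by (simp add: algebra_simps)
  also have "\<dots> \<le> C * (1 + \<bar>x - e\<bar> powr \<gamma>)"
    using excess_le_of_mean_deviation[OF dev, of x e] x by (simp add: excess_le_def)
  also have "\<dots> \<le> C * (1 + \<bar>x - y\<bar> powr \<gamma>)"
    using dev x False \<gamma> by (intro mult_left_mono add_left_mono powr_mono2) (auto simp: mean_deviation_le_def)
  finally show ?thesis by (simp add: excess_le_def)
qed

lemma excess_left_of_support:
  assumes s: "supports F c h" and dev: "mean_deviation_le F c \<gamma> {..h} C" and \<gamma>: "0 \<le> \<gamma>"
    and x: "x \<le> h"
  shows "excess_le F c \<gamma> C x y"
proof -
  have "excess_le (\<lambda>x. F (- x)) (- c) \<gamma> C (- x) (- y)"
    using excess_right_of_support[of "\<lambda>x. F (- x)" "- c" "- h" \<gamma> C "- x" "- y"]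
      mean_deviation_le_reflect[OF dev] s \<gamma> x by (simp add: supports_reflect)
  then show ?thesis by (simp add: excess_le_reflect)
qed

lemma sublinear_minus_linear_bounded:
  fixes C \<kappa> \<gamma> :: real
  assumes "C \<ge> 0" "\<kappa> > 0" "0 \<le> \<gamma>" "\<gamma> < 1"
  shows "\<exists>A\<ge>0. \<forall>d\<ge>0. C * (1 + d powr \<gamma>) - \<kappa> * d \<le> A"
proof -
  have "((\<lambda>d. C * d powr (\<gamma> - 1)) \<longlongrightarrow> C * 0) at_top"
    using assms by (intro tendsto_intros tendsto_neg_powr filterlim_ident) auto
  then have "\<forall>\<^sub>F d in at_top. C * d powr (\<gamma> - 1) < \<kappa>"
    by (rule order_tendstoD) (use assms in simp)
  then obtain R0 where R0: "\<And>d. d \<ge> R0 \<Longrightarrow> C * d powr (\<gamma> - 1) < \<kappa>"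
    by (auto simp: eventually_at_top_linorder)
  define R where "R = max R0 1"
  show ?thesis
  proof (intro exI[of _ "C * (1 + R powr \<gamma>)"] conjI allI impI)
    show "0 \<le> C * (1 + R powr \<gamma>)" using assms by simp
    fix d :: real assume d: "0 \<le> d"
    show "C * (1 + d powr \<gamma>) - \<kappa> * d \<le> C * (1 + R powr \<gamma>)"
    proof (cases "d \<le> R")
      case True
      then have "C * (1 + d powr \<gamma>) \<le> C * (1 + R powr \<gamma>)"
        using assms d by (intro mult_left_mono add_left_mono powr_mono2) auto
      moreover have "\<kappa> * d \<ge> 0" using assms d by simp
      ultimately show ?thesis by simp
    next
      case False
      then have dd: "d > 0" "d \<ge> R0" by (auto simp: R_def)
      have "C * d powr \<gamma> = (C * d powr (\<gamma> - 1)) * d" using dd by (simp add: powr_diff)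
      also have "\<dots> \<le> \<kappa> * d" using R0[OF dd(2)] dd by (intro mult_right_mono) auto
      finally have "C * (1 + d powr \<gamma>) - \<kappa> * d \<le> C * 1" by (simp add: algebra_simps)
      also have "\<dots> \<le> C * (1 + R powr \<gamma>)" using assms by (intro mult_left_mono) auto
      finally show ?thesis .
    qed
  qed
qed

text \<open>If the mean slope \<open>l\<close> on the left exceeds \<open>r\<close>, then \<open>F - r x\<close> is bounded above to the left
  of \<open>b\<close>.\<close>

lemma excess_right_of_larger_left_slope:
  assumes dr: "mean_deviation_le F r \<gamma> {b..} C" and dl: "mean_deviation_le F l \<gamma>' {..b} C'"
    and "r < l" and \<gamma>: "0 \<le> \<gamma>" "0 \<le> \<gamma>'" "\<gamma>' < 1"
  shows "\<exists>C\<ge>0. \<forall>x y. b \<le> y \<longrightarrow> excess_le F r \<gamma> C x y"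
proof -
  have C: "C \<ge> 0" "C' \<ge> 0" using dr dl by (auto simp: mean_deviation_le_def)
  obtain A where A: "A \<ge> 0" "\<And>d. d \<ge> 0 \<Longrightarrow> C' * (1 + d powr \<gamma>') - (l - r) * d \<le> A"
    using sublinear_minus_linear_bounded[OF C(2), of "l - r" \<gamma>'] \<open>r < l\<close> \<gamma> by auto
  have "excess_le F r \<gamma> (A + C) x y" if y: "b \<le> y" for x y
  proof (cases "b \<le> x")
    case True
    have "(F x - r * x) - (F y - r * y) \<le> C * (1 + \<bar>x - y\<bar> powr \<gamma>)"
      using excess_le_of_mean_deviation[OF dr, of x y] True y by (simp add: excess_le_def)
    also have "\<dots> \<le> (A + C) * (1 + \<bar>x - y\<bar> powr \<gamma>)"
      using A by (intro mult_right_mono) auto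
    finally show ?thesis by (simp add: excess_le_def)
  next
    case False
    have "(F x - l * x) - (F b - l * b) \<le> C' * (1 + \<bar>x - b\<bar> powr \<gamma>')"
      using excess_le_of_mean_deviation[OF dl, of x b] False by (simp add: excess_le_def)
    moreover have "C' * (1 + \<bar>x - b\<bar> powr \<gamma>') - (l - r) * \<bar>x - b\<bar> \<le> A" by (rule A(2)) simp
    moreover have "(F x - r * x) - (F b - r * b) = (F x - l * x) - (F b - l * b) - (l - r) * \<bar>x - b\<bar>"
      using False by (simp add: algebra_simps)
    ultimately have "(F x - r * x) - (F b - r * b) \<le> A" by linarith
    \<comment> \<open>With \<open>x\<close> to the left of \<open>b\<close> the comparison passes
      through \<open>b\<close>, which is closer to \<open>y\<close> than \<open>x\<close>
      is.\<close>
    moreover have "(F b - r * b) - (F y - r * y) \<le> C * (1 + \<bar>b - y\<bar> powr \<gamma>)"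
      using excess_le_of_mean_deviation[OF dr, of b y] y by (simp add: excess_le_def)
    moreover have "C * (1 + \<bar>b - y\<bar> powr \<gamma>) \<le> C * (1 + \<bar>x - y\<bar> powr \<gamma>)"
      using C \<gamma> y False by (intro mult_left_mono add_left_mono powr_mono2) auto
    moreover have "A * 1 \<le> A * (1 + \<bar>x - y\<bar> powr \<gamma>)" using A by (intro mult_left_mono) auto
    ultimately show ?thesis by (simp add: excess_le_def distrib_right)
  qed
  then show ?thesis using A(1) C(1) by (intro exI[of _ "A + C"]) auto
qed

lemma excess_left_of_smaller_right_slope:
  assumes dr: "mean_deviation_le F r \<gamma>' {b..} C'" and dl: "mean_deviation_le F l \<gamma> {..b} C"
    and "r < l" and \<gamma>: "0 \<le> \<gamma>" "0 \<le> \<gamma>'" "\<gamma>' < 1"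
  shows "\<exists>C\<ge>0. \<forall>x y. y \<le> b \<longrightarrow> excess_le F l \<gamma> C x y"
proof -
  have "\<exists>C\<ge>0. \<forall>x y. - b \<le> y \<longrightarrow> excess_le (\<lambda>x. F (- x)) (- l) \<gamma> C x y"
    using mean_deviation_le_reflect[OF dr] mean_deviation_le_reflect[OF dl] \<open>r < l\<close> \<gamma>
    by (intro excess_right_of_larger_left_slope[where r = "- l" and l = "- r" and \<gamma>' = \<gamma>']) auto
  then obtain C where C: "C \<ge> 0" "\<And>x y. - b \<le> y \<Longrightarrow> excess_le F l \<gamma> C (- x) (- y)"
    by (auto simp: excess_le_reflect)
  have "excess_le F l \<gamma> C x y" if "y \<le> b" for x y
    using C(2)[of "- y" "- x"] that by simp
  then show ?thesis using C(1) by blast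
qed

text \<open>Pairs on opposite sides of 0 are compared through 0. The smaller exponent is raised to
  the larger one at the price of an additive 1, which pays for displacements below 1.\<close>

lemma excess_le_of_common_slope:
  assumes dr: "mean_deviation_le F c \<gamma>r {0..} Cr" and dl: "mean_deviation_le F c \<gamma>l {..0} Cl"
    and \<gamma>: "0 \<le> \<gamma>r" "0 \<le> \<gamma>l"
  shows "\<exists>C\<ge>0. \<forall>x y. excess_le F c (max \<gamma>r \<gamma>l) C x y"
proof -
  define \<gamma> where "\<gamma> = max \<gamma>r \<gamma>l"
  have C: "Cr \<ge> 0" "Cl \<ge> 0" using dr dl by (auto simp: mean_deviation_le_def)
  have pw: "d powr g \<le> 1 + e powr \<gamma>" if "0 \<le> d" "d \<le> e" "0 \<le> g" "g \<le> \<gamma>" for d e g :: real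
  proof (cases "d \<le> 1")
    case True
    then have "d powr g \<le> 1" using that powr_mono2[of g d 1] by simp
    then show ?thesis by (rule order_trans) simp
  next
    case False
    then have "d powr g \<le> d powr \<gamma>" using that by (intro powr_mono) auto
    also have "\<dots> \<le> e powr \<gamma>" using that by (intro powr_mono2) auto
    finally show ?thesis by simp
  qed
  define g where "g x = F x - c * x" for x
  have one: "g x - g y \<le> K * (2 + D powr \<gamma>)"
    if "mean_deviation_le F c \<gamma>' S K" "x \<in> S" "y \<in> S" "\<bar>x - y\<bar> \<le> D" "0 \<le> \<gamma>'" "\<gamma>' \<le> \<gamma>"
    for x y \<gamma>' S K D
  proof -
    have "g x - g y \<le> K * (1 + \<bar>x - y\<bar> powr \<gamma>')"
      using excess_le_of_mean_deviation[OF that(1-3)] by (simp add: excess_le_def g_def)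
    also have "\<dots> \<le> K * (1 + (1 + D powr \<gamma>))"
      using that by (intro mult_left_mono add_left_mono pw) (auto simp: mean_deviation_le_def)
    finally show ?thesis by simp
  qed
  have "excess_le F c \<gamma> (2 * (Cr + Cl)) x y" for x y
  proof -
    define D where "D = \<bar>x - y\<bar>"
    have K: "0 \<le> Cr * (2 + D powr \<gamma>)" "0 \<le> Cl * (2 + D powr \<gamma>)" using C by auto
    have "g x - g y \<le> Cr * (2 + D powr \<gamma>) + Cl * (2 + D powr \<gamma>)"
    proof -
      consider "0 \<le> x" "0 \<le> y" | "x \<le> 0" "y \<le> 0" | "0 \<le> x" "y \<le> 0" | "x \<le> 0" "0 \<le> y" by linarith
      then show ?thesis
      proof cases
        case 1
        then show ?thesis using one[OF dr, of x y D] \<gamma> K by (simp add: D_def \<gamma>_def)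
      next
        case 2
        then show ?thesis using one[OF dl, of x y D] \<gamma> K by (simp add: D_def \<gamma>_def)
      next
        case 3
        then show ?thesis using one[OF dr, of x 0 D] one[OF dl, of 0 y D] \<gamma> by (simp add: D_def \<gamma>_def)
      next
        case 4
        then show ?thesis using one[OF dl, of x 0 D] one[OF dr, of 0 y D] \<gamma> by (simp add: D_def \<gamma>_def)
      qed
    qed
    also have "\<dots> = (Cr + Cl) * (2 + D powr \<gamma>)" by (simp add: algebra_simps)
    also have "\<dots> \<le> (Cr + Cl) * (2 * (1 + D powr \<gamma>))" using C by (intro mult_left_mono) auto
    finally show ?thesis by (simp add: excess_le_def g_def D_def algebra_simps)
  qed
  then show ?thesis using C unfolding \<gamma>_def by (intro exI[of _ "2 * (Cr + Cl)"]) auto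
qed

section \<open>Decay rates\<close>

context convex_flux
begin

context
  fixes \<phi> :: "real \<Rightarrow> real" and M :: real
  assumes bound: "ess_bound \<phi> M"
begin

text \<open>With \<open>c\<close> itself as competitor, every rate except the one for bounded gaps
  reduces to an excess bound between two feet. The constant is uniform in \<open>x\<close>, in
  \<open>t \<ge> 1\<close> and in the maximizer.\<close>

lemma maximizer_rate:
  assumes a: "a \<ge> 0" "N > 0" "((\<lambda>v. ddf v / \<bar>v - c\<bar> powr a) \<longlongrightarrow> N) (at c)"
    and \<gamma>: "0 \<le> \<gamma>" "\<gamma> < 1" and C: "C \<ge> 0"
  shows "\<exists>C'. \<forall>t\<ge>1. \<forall>x. \<forall>u\<in>maximizers f \<phi> x t.
      excess_le (Phi \<phi>) c \<gamma> C (x - t * df c) (x - t * df u) \<longrightarrow>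
      \<bar>u - c\<bar> \<le> C' * t powr - ((1 - \<gamma>) / (2 - \<gamma> + a * (1 - \<gamma>)))"
proof -
  obtain C' where C': "\<And>t v. t \<ge> 1 \<Longrightarrow> \<bar>v\<bar> \<le> M \<Longrightarrow>
      t * breg c v \<le> C * (1 + \<bar>t * (df v - df c)\<bar> powr \<gamma>) \<Longrightarrow>
      \<bar>v - c\<bar> \<le> C' * t powr - ((1 - \<gamma>) / (2 - \<gamma> + a * (1 - \<gamma>)))"
    using flux_rate[OF a \<gamma> C, of M] by blast
  show ?thesis
  proof (intro exI allI impI ballI)
    fix t x u assume t: "t \<ge> (1::real)" and u: "u \<in> maximizers f \<phi> x t"
      and ex: "excess_le (Phi \<phi>) c \<gamma> C (x - t * df c) (x - t * df u)"
    have t0: "t > 0" using t by simp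
    have "x - t * df c - (x - t * df u) = t * (df u - df c)" by (simp add: algebra_simps)
    then have "t * breg c u \<le> C * (1 + \<bar>t * (df u - df c)\<bar> powr \<gamma>)"
      using breg_le_of_maximizer[OF bound t0 u, of c c] ex by (simp add: excess_le_def)
    then show "\<bar>u - c\<bar> \<le> C' * t powr - ((1 - \<gamma>) / (2 - \<gamma> + a * (1 - \<gamma>)))"
      by (rule C'[OF t maximizers_bounded[OF bound t0 u]])
  qed
qed

text \<open>At least one end point of the gap is reachable from \<open>(x, t)\<close> by a displacement of at most
  half the gap length relative to the speed \<open>f' c\<close>, and a maximizer costs no more than that.\<close>

lemma gap_breg_le:
  assumes se: "supports (Phi \<phi>) c e" and sh: "supports (Phi \<phi>) c h"
    and \<delta>: "\<delta> > 0" and t: "t > 0"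
    and small: "(h - e) / 2 / t \<le> df (c + \<delta>) - df c" "(h - e) / 2 / t \<le> df c - df (c - \<delta>)"
    and x: "e + t * df c < x" "x < h + t * df c" and u: "u \<in> maximizers f \<phi> x t"
  obtains v where "\<bar>v - c\<bar> \<le> \<delta>" "\<bar>df v - df c\<bar> \<le> (h - e) / 2 / t" "breg c u \<le> breg c v"
proof -
  define r where "r = (h - e) / 2"
  have "\<bar>x - t * df c - e\<bar> \<le> r \<or> \<bar>x - t * df c - h\<bar> \<le> r"
    using x unfolding r_def by argo
  then obtain z where z: "z = e \<or> z = h" and zr: "\<bar>x - t * df c - z\<bar> \<le> r" by blast
  \<comment> \<open>The speed relative to \<open>df c\<close> that sends the backward characteristic
    from \<open>(x, t)\<close> to \<open>z\<close>.\<close>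
  define p where "p = (x - t * df c - z) / t"
  have p: "\<bar>p\<bar> \<le> r / t" using zr t by (simp add: p_def divide_right_mono)
  have "df (c - \<delta>) \<le> df c + p" "df c + p \<le> df (c + \<delta>)"
    using p small by (auto simp: r_def)
  then obtain v where v: "c - \<delta> \<le> v" "v \<le> c + \<delta>" "df v = df c + p" by (rule df_IVT)
  have sz: "supports (Phi \<phi>) c z" and Pz: "Phi \<phi> z = Phi \<phi> e + c * (z - e)"
  proof -
    show "supports (Phi \<phi>) c z" using z se sh by blast
    have "Phi \<phi> h = Phi \<phi> e + c * (h - e)"
      using supportsD[OF se, of h] supportsD[OF sh, of e] by (simp add: algebra_simps)
    then show "Phi \<phi> z = Phi \<phi> e + c * (z - e)" using z by auto
  qed
  have "t * p = x - t * df c - z" using t by (simp add: p_def)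
  then have "x - t * df v = z" by (simp add: v(3) distrib_left)
  then have "t * breg c u \<le> t * breg c v"
    using breg_le_of_maximizer[OF bound t u, of c v] supportsD[OF sz, of "x - t * df u"]
    by (simp add: algebra_simps)
  then have "breg c u \<le> breg c v" using t by simp
  moreover have "\<bar>df v - df c\<bar> \<le> (h - e) / 2 / t" using p by (simp add: v(3) r_def)
  ultimately show ?thesis using that[of v] v(1,2) by auto
qed

text \<open>Comparing divergences of order \<open>2 + a\<close> bounds
  \<open>\<bar>u - c\<bar>\<close> by \<open>\<bar>v - c\<bar>\<close> up to a factor tending to 1,
  and the speed of the competitor, of order \<open>1 + a\<close>, bounds
  \<open>\<bar>v - c\<bar>\<close>; so the exponent is that of the speed.\<close>

lemma gap_rate:
  assumes se: "supports (Phi \<phi>) c e" and sh: "supports (Phi \<phi>) c h" and "e < h"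
    and a: "a \<ge> 0" and N: "N > 0" and lim: "((\<lambda>v. ddf v / \<bar>v - c\<bar> powr a) \<longlongrightarrow> N) (at c)"
    and "\<epsilon> > 0"
  shows "\<forall>\<^sub>F t in at_top. \<forall>x. e + t * df c < x \<and> x < h + t * df c \<longrightarrow>
      (\<forall>u\<in>maximizers f \<phi> x t. \<bar>u - c\<bar> \<le> (1 + \<epsilon>) * (((1 + a) / N) powr (1 / (1 + a)) *
        ((h - e) / 2) powr (1 / (1 + a)) * t powr (- (1 / (1 + a)))))"
proof -
  define r where "r = (h - e) / 2"
  have r: "r > 0" using \<open>e < h\<close> by (simp add: r_def)
  \<comment> \<open>Collects the losses from replacing \<open>N\<close> by \<open>N - \<eta>\<close>
    or \<open>N + \<eta>\<close> in both comparisons; it tends to 1 with \<open>\<eta>\<close>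
    tending to 0.\<close>
  define q where "q \<eta> = ((N + \<eta>) / (N - \<eta>)) powr (1 / (2 + a)) * (N / (N - \<eta>)) powr (1 / (1 + a))"
    for \<eta>
  have "(q \<longlongrightarrow> ((N + 0) / (N - 0)) powr (1 / (2 + a)) * (N / (N - 0)) powr (1 / (1 + a))) (at_right 0)"
    unfolding q_def using N a by (intro tendsto_intros) auto
  then have "(q \<longlongrightarrow> 1) (at_right 0)" using N by simp
  then have "\<forall>\<^sub>F \<eta> in at_right 0. q \<eta> < 1 + \<epsilon>"
    by (rule order_tendstoD) (use \<open>\<epsilon> > 0\<close> in simp)
  moreover have "\<forall>\<^sub>F \<eta> in at_right 0. 0 < \<eta> \<and> \<eta> < N"
    using eventually_at_right_real[OF N] by simp
  ultimately have "\<forall>\<^sub>F \<eta> in at_right 0. q \<eta> < 1 + \<epsilon> \<and> 0 < \<eta> \<and> \<eta> < N"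
    by eventually_elim simp
  then obtain \<eta> where \<eta>: "q \<eta> < 1 + \<epsilon>" "0 < \<eta>" "\<eta> < N"
    using eventually_happens[of _ "at_right (0::real)"] by fastforce
  obtain \<delta> where \<delta>: "\<delta> > 0"
    "\<And>v. \<bar>v - c\<bar> < \<delta> \<Longrightarrow> (N - \<eta>) / (1 + a) * \<bar>v - c\<bar> powr (1 + a) \<le> \<bar>df v - df c\<bar>"
    "\<And>v. \<bar>v - c\<bar> < \<delta> \<Longrightarrow> (N - \<eta>) / (2 + a) * \<bar>v - c\<bar> powr (2 + a) \<le> breg c v"
    "\<And>v. \<bar>v - c\<bar> < \<delta> \<Longrightarrow> breg c v \<le> (N + \<eta>) / (2 + a) * \<bar>v - c\<bar> powr (2 + a)"
    using flux_asymp[OF a lim \<eta>(2)] by metis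
  have root: "(R * w powr k) powr (1 / k) = R powr (1 / k) * w"
    if "k > 0" "R \<ge> 0" "w \<ge> 0" for R w k :: real
    using that by (simp add: powr_mult powr_powr)
  define d where "d = \<delta> / 2"
  have d: "0 < d" "d < \<delta>" using \<delta>(1) by (auto simp: d_def)
  define \<rho> where "\<rho> = min (df (c + d) - df c) (df c - df (c - d))"
  \<comment> \<open>A divergence below \<open>m\<close> forces a state within \<open>d\<close> of
    \<open>c\<close>. The condition \<open>r / t < m / d\<close> makes the competitor's divergence
    that small, which localizes the maximizer before the asymptotics are applied to it.\<close>
  define m where "m = min (breg c (c + d)) (breg c (c - d))"
  have "\<rho> > 0" using d df_strict_mono by (simp add: \<rho>_def)
  have "m > 0" using d breg_pos by (simp add: m_def)
  have "((\<lambda>t. r * inverse t) \<longlongrightarrow> r * 0) at_top"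
    by (intro tendsto_intros tendsto_inverse_0_at_top filterlim_ident)
  then have "\<forall>\<^sub>F t in at_top. r * inverse t < min \<rho> (m / d)"
    by (rule order_tendstoD) (use \<open>\<rho> > 0\<close> \<open>m > 0\<close> d in simp)
  then show ?thesis using eventually_gt_at_top[of 0]
  proof eventually_elim
    case (elim t)
    then have rt: "r / t < \<rho>" "r / t < m / d" by (auto simp: divide_inverse)
    show ?case
    proof (intro allI impI ballI)
      fix x u assume x: "e + t * df c < x \<and> x < h + t * df c" and u: "u \<in> maximizers f \<phi> x t"
      obtain v where v: "\<bar>v - c\<bar> \<le> d" "\<bar>df v - df c\<bar> \<le> r / t" "breg c u \<le> breg c v"
        by (rule gap_breg_le[OF se sh d(1) \<open>t > 0\<close> _ _ _ _ u])
           (use rt x in \<open>auto simp: \<rho>_def r_def\<close>)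
      have "breg c v \<le> d * (r / t)"
        using breg_le[of c v] mult_mono[OF v(1,2)] d by simp
      also have "\<dots> < m" using rt(2) d by (simp add: pos_less_divide_eq mult.commute)
      finally have um: "breg c u < m" using v(3) by simp
      have "\<bar>u - c\<bar> < d"
      proof (rule ccontr)
        assume "\<not> \<bar>u - c\<bar> < d"
        then have "c + d \<le> u \<or> u \<le> c - d" by linarith
        then have "m \<le> breg c u"
          using breg_mono_right[of c "c + d" u] breg_mono_left[of u "c - d" c] d
          by (auto simp: m_def min_le_iff_disj)
        then show False using um by simp
      qed
      then have ud: "\<bar>u - c\<bar> < \<delta>" using d by simp
      have vd: "\<bar>v - c\<bar> < \<delta>" using v(1) d by simp
      have "(N - \<eta>) / (2 + a) * \<bar>u - c\<bar> powr (2 + a) \<le> (N + \<eta>) / (2 + a) * \<bar>v - c\<bar> powr (2 + a)"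
        using \<delta>(3)[OF ud] \<delta>(4)[OF vd] v(3) by linarith
      then have "(N - \<eta>) * \<bar>u - c\<bar> powr (2 + a) \<le> (N + \<eta>) * \<bar>v - c\<bar> powr (2 + a)"
        using a by (simp add: divide_le_cancel)
      then have "\<bar>u - c\<bar> powr (2 + a) \<le> (N + \<eta>) / (N - \<eta>) * \<bar>v - c\<bar> powr (2 + a)"
        using \<eta> by (simp add: field_simps)
      then have "(\<bar>u - c\<bar> powr (2 + a)) powr (1 / (2 + a))
          \<le> ((N + \<eta>) / (N - \<eta>) * \<bar>v - c\<bar> powr (2 + a)) powr (1 / (2 + a))"
        using a by (intro powr_mono2) auto
      then have uv: "\<bar>u - c\<bar> \<le> ((N + \<eta>) / (N - \<eta>)) powr (1 / (2 + a)) * \<bar>v - c\<bar>"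
        using root[of "2 + a" 1 "\<bar>u - c\<bar>"] root[of "2 + a" "(N + \<eta>) / (N - \<eta>)" "\<bar>v - c\<bar>"] \<eta> a
        by simp
      have "(N - \<eta>) / (1 + a) * \<bar>v - c\<bar> powr (1 + a) \<le> r / t"
        using \<delta>(2)[OF vd] v(2) by linarith
      moreover have "w \<le> (1 + a) / (N - \<eta>) * s" if "(N - \<eta>) / (1 + a) * w \<le> s" for w s
        using that \<eta> a by (simp add: field_simps)
      ultimately have "\<bar>v - c\<bar> powr (1 + a) \<le> (1 + a) / (N - \<eta>) * (r / t)" by blast
      also have "\<dots> = N / (N - \<eta>) * ((1 + a) / N * r * (1 / t))" using N by simp
      finally have "(\<bar>v - c\<bar> powr (1 + a)) powr (1 / (1 + a))
          \<le> (N / (N - \<eta>) * ((1 + a) / N * r * (1 / t))) powr (1 / (1 + a))"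
        using a by (intro powr_mono2) auto
      then have vt: "\<bar>v - c\<bar> \<le> (N / (N - \<eta>)) powr (1 / (1 + a)) *
          (((1 + a) / N) powr (1 / (1 + a)) * r powr (1 / (1 + a)) * t powr (- (1 / (1 + a))))"
        using \<eta> a N r \<open>t > 0\<close> by (simp add: powr_mult powr_powr powr_minus_divide powr_divide)
      have "\<bar>u - c\<bar> \<le> q \<eta> *
          (((1 + a) / N) powr (1 / (1 + a)) * r powr (1 / (1 + a)) * t powr (- (1 / (1 + a))))"
        using order_trans[OF uv mult_left_mono[OF vt]] by (simp add: q_def mult.assoc)
      also have "\<dots> \<le> (1 + \<epsilon>) *
          (((1 + a) / N) powr (1 / (1 + a)) * r powr (1 / (1 + a)) * t powr (- (1 / (1 + a))))"
        using \<eta>(1) by (intro mult_right_mono) auto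
      finally show "\<bar>u - c\<bar> \<le> (1 + \<epsilon>) * (((1 + a) / N) powr (1 / (1 + a)) *
        ((h - e) / 2) powr (1 / (1 + a)) * t powr (- (1 / (1 + a))))"
        by (simp add: r_def)
    qed
  qed
qed

text \<open>The backward triangles \<open>\<Delta>\<^sub>I\<close> along a characteristic are nested, so that the one at
  \<open>(X t, t)\<close> reaches the axis on both sides of \<open>X 0\<close>.\<close>

lemma fwd_gen_char_feet:
  assumes X: "fwd_gen_char_from_axis f \<phi> x0 X" and t: "t > 0"
  shows "X t - t * df (u_minus f \<phi> (X t) t) \<le> x0" "x0 \<le> X t - t * df (u_plus f \<phi> (X t) t)"
proof -
  define w where "w s = u_plus f \<phi> (X s) s" for s
  have le: "u_plus f \<phi> y s \<le> u_minus f \<phi> y s" if "s > 0" for y s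
    unfolding u_plus_def u_minus_def
    using Inf_mem_maximizers[OF bound that] maximizers_bounded[OF bound that]
    by (intro cSup_upper bdd_aboveI[of _ M]) (auto simp: abs_le_iff)
  \<comment> \<open>A point of the triangle at \<open>(X s, s)\<close> at half height, because
    \<open>Delta_I\<close> excludes the axis. Speeds of maximizers are bounded, so it tends to
    \<open>x0\<close> as \<open>s\<close> tends to 0.\<close>
  define \<xi> where "\<xi> s = X s + (s / 2 - s) * df (w s)" for s
  have foot: "X t + (s / 2 - t) * df (u_minus f \<phi> (X t) t) \<le> \<xi> s
      \<and> \<xi> s \<le> X t + (s / 2 - t) * df (u_plus f \<phi> (X t) t)" if s: "0 < s" "s < t" for s
  proof -
    have "(\<xi> s, s / 2) \<in> Delta_I f \<phi> (X s) s"
      using s le[of s "X s"] by (auto simp: Delta_I_def \<xi>_def w_def)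
    moreover have "fwd_gen_char f \<phi> (X (s / 2)) (s / 2) X"
      using X s unfolding fwd_gen_char_from_axis_def by simp
    then have "Delta_I f \<phi> (X s) s \<subseteq> Delta_I f \<phi> (X t) t"
      using s unfolding fwd_gen_char_def by simp
    ultimately have "(\<xi> s, s / 2) \<in> Delta_I f \<phi> (X t) t" by blast
    then obtain v where "u_plus f \<phi> (X t) t \<le> v" "v \<le> u_minus f \<phi> (X t) t"
      "\<xi> s = X t + (s / 2 - t) * df v" by (auto simp: Delta_I_def)
    then show ?thesis using s df_mono by (auto intro!: mult_left_mono_neg)
  qed
  have "(X \<longlongrightarrow> X 0) (at_right 0)"
  proof -
    have "continuous_on {0..} X" using X by (simp add: fwd_gen_char_from_axis_def)
    then have "(X \<longlongrightarrow> X 0) (at 0 within {0..})" by (simp add: continuous_on_def)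
    then show ?thesis by (rule tendsto_within_subset) auto
  qed
  moreover have "((\<lambda>s. (s / 2 - s) * df (w s)) \<longlongrightarrow> 0) (at_right 0)"
  proof (rule Lim_null_comparison)
    define B where "B = max \<bar>df M\<bar> \<bar>df (-M)\<bar>"
    show "((\<lambda>s. \<bar>s\<bar> * B) \<longlongrightarrow> 0) (at_right 0)"
      by (auto intro!: tendsto_eq_intros)
    show "\<forall>\<^sub>F s in at_right 0. norm ((s / 2 - s) * df (w s)) \<le> \<bar>s\<bar> * B"
      using eventually_at_right_less[of "0::real"]
    proof eventually_elim
      case (elim s)
      have "\<bar>w s\<bar> \<le> M"
        unfolding w_def u_plus_def
        by (rule maximizers_bounded[OF bound elim Inf_mem_maximizers[OF bound elim]])
      then have "df (-M) \<le> df (w s)" "df (w s) \<le> df M" using df_mono by auto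
      then have "\<bar>df (w s)\<bar> \<le> B" unfolding B_def by linarith
      then show ?case using elim by (auto simp: abs_mult intro!: mult_mono)
    qed
  qed
  ultimately have "(\<xi> \<longlongrightarrow> X 0 + 0) (at_right 0)"
    unfolding \<xi>_def by (rule tendsto_add)
  then have \<xi>: "(\<xi> \<longlongrightarrow> x0) (at_right 0)" using X by (simp add: fwd_gen_char_from_axis_def)
  have lin: "((\<lambda>s. X t + (s / 2 - t) * k) \<longlongrightarrow> X t - t * k) (at_right 0)" for k
    by (auto intro!: tendsto_eq_intros)
  have ev: "\<forall>\<^sub>F s in at_right 0. 0 < s \<and> s < t"
    using eventually_at_right_real[OF t] by simp
  show "X t - t * df (u_minus f \<phi> (X t) t) \<le> x0"
    by (rule tendsto_le[OF _ \<xi> lin]) (use ev foot in \<open>auto elim!: eventually_mono\<close>)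
  show "x0 \<le> X t - t * df (u_plus f \<phi> (X t) t)"
    by (rule tendsto_le[OF _ lin \<xi>]) (use ev foot in \<open>auto elim!: eventually_mono\<close>)
qed

text \<open>Feet are ordered like the points at time \<open>t\<close>, and those of the extreme
  maximizers at \<open>(X t, t)\<close> lie on either side of \<open>x0\<close>: the largest state
  has the leftmost foot.\<close>

lemma fwd_gen_char_separates:
  assumes X: "fwd_gen_char_from_axis f \<phi> x0 X" and t: "t > 0" and u: "u \<in> maximizers f \<phi> x t"
  shows "x < X t \<Longrightarrow> x - t * df u \<le> x0" "X t < x \<Longrightarrow> x0 \<le> x - t * df u"
  using fwd_gen_char_feet[OF X t] maximizers_feet_mono[OF bound t _ u Sup_mem_maximizers[OF bound t]]
    maximizers_feet_mono[OF bound t _ Inf_mem_maximizers[OF bound t] u]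
  by (auto simp: u_minus_def u_plus_def intro: order_trans)

end

end

section \<open>Mean slopes as limits, and the decay theorem\<close>

lemma mean_deviation_tendsto_right:
  assumes dev: "mean_deviation_le F c \<gamma> {0..} C" and "F 0 = 0" "\<gamma> < 1"
  shows "((\<lambda>y. F y / y) \<longlongrightarrow> c) at_top"
proof (rule LIM_zero_cancel, rule Lim_null_comparison)
  have "((\<lambda>y. C * (inverse y + y powr (\<gamma> - 1))) \<longlongrightarrow> C * (0 + 0)) at_top"
    using \<open>\<gamma> < 1\<close> by (intro tendsto_intros tendsto_inverse_0_at_top tendsto_neg_powr filterlim_ident) auto
  then show "((\<lambda>y. C * (inverse y + y powr (\<gamma> - 1))) \<longlongrightarrow> 0) at_top" by simp
  show "\<forall>\<^sub>F y in at_top. norm (F y / y - c) \<le> C * (inverse y + y powr (\<gamma> - 1))"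
    using eventually_gt_at_top[of 0]
  proof eventually_elim
    case (elim y)
    have "\<bar>(F z - c * z) - (F 0 - c * 0)\<bar> \<le> C * (1 + \<bar>z - 0\<bar> powr \<gamma>)" if "z \<in> {0..}" for z
      using dev[unfolded mean_deviation_le_def, THEN conjunct2, rule_format, of 0 z] that by simp
    from this[of y] have "\<bar>F y - c * y\<bar> \<le> C * (1 + y powr \<gamma>)"
      using elim \<open>F 0 = 0\<close> by simp
    then have "\<bar>F y - c * y\<bar> / y \<le> C * (1 + y powr \<gamma>) / y"
      using elim by (intro divide_right_mono) auto
    moreover have "\<bar>F y - c * y\<bar> / y = norm (F y / y - c)"
    proof -
      have "F y / y - c = (F y - c * y) / y" using elim by (simp add: diff_divide_distrib)
      then show ?thesis using elim by simp
    qed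
    moreover have "C * (1 + y powr \<gamma>) / y = C * (inverse y + y powr (\<gamma> - 1))"
    proof -
      have "y powr (\<gamma> - 1) = y powr \<gamma> / y" using elim by (simp add: powr_diff)
      then show ?thesis by (simp add: divide_inverse distrib_right)
    qed
    ultimately show ?case by simp
  qed
qed

lemma mean_deviation_tendsto_left:
  assumes dev: "mean_deviation_le F c \<gamma> {..0} C" and "F 0 = 0" "\<gamma> < 1"
  shows "((\<lambda>y. F y / y) \<longlongrightarrow> c) at_bot"
proof -
  have "((\<lambda>y. F (- y) / y) \<longlongrightarrow> - c) at_top"
    using mean_deviation_le_reflect[OF dev] assms(2,3)
    by (intro mean_deviation_tendsto_right[where \<gamma> = \<gamma> and C = C]) auto
  then have "((\<lambda>y. - (F (- y) / y)) \<longlongrightarrow> - (- c)) at_top" by (rule tendsto_minus)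
  then show ?thesis by (simp add: filterlim_at_bot_mirror)
qed

theorem theorem7p4:
  fixes f \<phi> :: "real \<Rightarrow> real"
    and \<gamma>\<^sub>r \<gamma>\<^sub>l \<alpha> \<beta> N\<^sub>r N\<^sub>l :: real
    and u u_tilde :: "real \<Rightarrow> real \<Rightarrow> real"
  assumes f_C2: "C2 f"
    and f_convex: "\<And>s. deriv (deriv f) s \<ge> 0"
    and f_null: "emeasure lebesgue {s. deriv (deriv f) s = 0} = 0"
    and phi: "L_infinity \<phi>"
    and u: "u = entropy_sol f \<phi>"
    and u_tilde: "u_tilde = entropy_sol f (phi_bar \<phi>)"
    and ur: "u_r_up \<phi> = u_r_low \<phi>"
    and ul: "u_l_up \<phi> = u_l_low \<phi>"
    and gamma_r: "0 \<le> \<gamma>\<^sub>r" "\<gamma>\<^sub>r < 1"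
    and gamma_l: "0 \<le> \<gamma>\<^sub>l" "\<gamma>\<^sub>l < 1"
    and mean_r: "\<exists>C. \<forall>\<^sub>F x in at_top. \<forall>y\<ge>0.
        \<bar>(LINT \<xi>=ereal y..ereal (y + x)|lebesgue. (\<phi> \<xi>)) - u_r_low \<phi> * x\<bar> \<le> C * x powr \<gamma>\<^sub>r"
    and mean_l: "\<exists>C. \<forall>\<^sub>F x in at_bot. \<forall>y\<le>0.
        \<bar>(LINT \<xi>=ereal y..ereal (y + x)|lebesgue. (\<phi> \<xi>)) - u_l_up \<phi> * x\<bar> \<le> C * (- x) powr \<gamma>\<^sub>l"
    and alpha: "\<alpha> \<ge> 0" "N\<^sub>r > 0"
      "((\<lambda>v. deriv (deriv f) v / \<bar>v - u_r_low \<phi>\<bar> powr \<alpha>) \<longlongrightarrow> N\<^sub>r) (at (u_r_low \<phi>))"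
    and beta: "\<beta> \<ge> 0" "N\<^sub>l > 0"
      "((\<lambda>v. deriv (deriv f) v / \<bar>v - u_l_up \<phi>\<bar> powr \<beta>) \<longlongrightarrow> N\<^sub>l) (at (u_l_up \<phi>))"
  shows
   "\<comment> \<open>(i)\<close>
    (u_l_up \<phi> < u_r_low \<phi> \<or> u_l_up \<phi> = u_r_low \<phi> \<and> K0 \<phi> \<noteq> {} \<longrightarrow>
      UNIV \<times> {0<..} = K_set f \<phi> \<union> (\<Union>{H_region f \<phi> e h | e h. is_gap \<phi> e h}) \<and>
      \<comment> \<open>(a)\<close>
      (\<forall>c x0. is_divide f \<phi> c x0 \<longrightarrow> x0 \<in> K0 \<phi> \<and>
         (\<forall>(x, t) \<in> ray f c x0.
            u x t = u_tilde x t \<and> u_tilde x t = inv (deriv f) ((x - x0) / t))) \<and>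
      (\<forall>(x, t) \<in> K_set f \<phi>. u x t - u_tilde x t = 0) \<and>
      \<comment> \<open>(b)\<close>
      (\<forall>e h a N::real. is_gap \<phi> (ereal e) (ereal h) \<and> a \<ge> 0 \<and> N > 0 \<and>
         ((\<lambda>v. deriv (deriv f) v / \<bar>v - chord_slope \<phi> e h\<bar> powr a) \<longlongrightarrow> N)
           (at (chord_slope \<phi> e h)) \<longrightarrow>
         (\<forall>(x, t) \<in> H_region f \<phi> (ereal e) (ereal h).
            \<bar>u x t - u_tilde x t\<bar> = \<bar>u x t - chord_slope \<phi> e h\<bar>) \<and>
         (\<forall>\<epsilon>>0. \<forall>\<^sub>F t in at_top. \<forall>x. (x, t) \<in> H_region f \<phi> (ereal e) (ereal h) \<longrightarrow>
            \<bar>u x t - chord_slope \<phi> e h\<bar>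
              \<le> (1 + \<epsilon>) * (((1 + a) / N) powr (1 / (1 + a)) *
                  ((h - e) / 2) powr (1 / (1 + a)) * t powr (- (1 / (1 + a)))))) \<and>
      \<comment> \<open>(c)\<close>
      (\<forall>e::real. is_gap \<phi> (ereal e) \<infinity> \<longrightarrow>
         (\<forall>(x, t) \<in> H_infty f \<phi>. \<bar>u x t - u_tilde x t\<bar> = \<bar>u x t - u_r_low \<phi>\<bar>) \<and>
         (\<exists>C. \<forall>\<^sub>F t in at_top. \<forall>x. (x, t) \<in> H_infty f \<phi> \<longrightarrow>
            \<bar>u x t - u_r_low \<phi>\<bar>
              \<le> C * t powr (- ((1 - \<gamma>\<^sub>r) / (2 - \<gamma>\<^sub>r + \<alpha> * (1 - \<gamma>\<^sub>r)))))) \<and>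
      \<comment> \<open>(d)\<close>
      (\<forall>h::real. is_gap \<phi> (-\<infinity>) (ereal h) \<longrightarrow>
         (\<forall>(x, t) \<in> H_minus_infty f \<phi>. \<bar>u x t - u_tilde x t\<bar> = \<bar>u x t - u_l_up \<phi>\<bar>) \<and>
         (\<exists>C. \<forall>\<^sub>F t in at_top. \<forall>x. (x, t) \<in> H_minus_infty f \<phi> \<longrightarrow>
            \<bar>u x t - u_l_up \<phi>\<bar>
              \<le> C * t powr (- ((1 - \<gamma>\<^sub>l) / (2 - \<gamma>\<^sub>l + \<beta> * (1 - \<gamma>\<^sub>l)))))))
    \<and>
    \<comment> \<open>(ii)\<close>
    (u_l_up \<phi> > u_r_low \<phi> \<or> u_l_up \<phi> = u_r_low \<phi> \<and> K0 \<phi> = {} \<longrightarrow>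
      \<comment> \<open>(a)\<close>
      (u_l_up \<phi> = u_r_low \<phi> \<longrightarrow>
         (\<exists>C. \<forall>\<^sub>F t in at_top. \<forall>x. \<bar>u x t - u_r_low \<phi>\<bar>
            \<le> C * t powr (- ((1 - max \<gamma>\<^sub>r \<gamma>\<^sub>l) /
                  (2 - max \<gamma>\<^sub>r \<gamma>\<^sub>l + \<alpha> * (1 - max \<gamma>\<^sub>r \<gamma>\<^sub>l)))))) \<and>
      \<comment> \<open>(b)\<close>
      (u_l_up \<phi> > u_r_low \<phi> \<longrightarrow>
         (\<forall>x0 X. fwd_gen_char_from_axis f \<phi> x0 X \<longrightarrow>
            (\<exists>C. \<forall>\<^sub>F t in at_top. \<forall>x < X t. \<bar>u x t - u_l_up \<phi>\<bar>
               \<le> C * t powr (- ((1 - \<gamma>\<^sub>l) / (2 - \<gamma>\<^sub>l + \<beta> * (1 - \<gamma>\<^sub>l))))) \<and>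
            (\<exists>C. \<forall>\<^sub>F t in at_top. \<forall>x > X t. \<bar>u x t - u_r_low \<phi>\<bar>
               \<le> C * t powr (- ((1 - \<gamma>\<^sub>r) / (2 - \<gamma>\<^sub>r + \<alpha> * (1 - \<gamma>\<^sub>r))))))))"
proof -
  interpret convex_flux f
    by unfold_locales (rule f_C2 f_convex f_null)+
  obtain M where bound: "ess_bound \<phi> M"
    using phi unfolding L_infinity_def ess_bound_def by blast
  define r l where "r = u_r_low \<phi>" and "l = u_l_up \<phi>"
  have lip: "\<bar>Phi \<phi> y - Phi \<phi> x\<bar> \<le> M * \<bar>y - x\<bar>" for x y by (rule Phi_lipschitz[OF bound])
  have Phi0: "Phi \<phi> 0 = 0" using LINT_interval_eq_Phi[OF bound, of 0 0] by (simp add: Phi_def)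
  have dev_r: "\<exists>C. mean_deviation_le (Phi \<phi>) r \<gamma>\<^sub>r {b..} C" for b
    using mean_deviation_right[OF lip gamma_r(1), of r b] mean_r
    by (simp only: LINT_interval_eq_Phi[OF bound] r_def)
  have dev_l: "\<exists>C. mean_deviation_le (Phi \<phi>) l \<gamma>\<^sub>l {..b} C" for b
    using mean_deviation_left[OF lip gamma_l(1), of l b] mean_l
    by (simp only: LINT_interval_eq_Phi[OF bound] l_def)
  have lim_r: "((\<lambda>y. Phi \<phi> y / y) \<longlongrightarrow> r) at_top"
    using dev_r[of 0] mean_deviation_tendsto_right[where F = "Phi \<phi>", OF _ Phi0 gamma_r(2)] by blast
  have lim_l: "((\<lambda>y. Phi \<phi> y / y) \<longlongrightarrow> l) at_bot"
    using dev_l[of 0] mean_deviation_tendsto_left[where F = "Phi \<phi>", OF _ Phi0 gamma_l(2)] by blast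
  have u_mem: "u x t \<in> maximizers f \<phi> x t" if "t > 0" for x t
    unfolding u using entropy_sol_mem[OF bound that] .
  note rate_r = maximizer_rate[OF bound alpha[folded r_def] gamma_r]
  note rate_l = maximizer_rate[OF bound beta[folded l_def] gamma_l]
  define E\<^sub>r E\<^sub>l where "E\<^sub>r = - ((1 - \<gamma>\<^sub>r) / (2 - \<gamma>\<^sub>r + \<alpha> * (1 - \<gamma>\<^sub>r)))"
    and "E\<^sub>l = - ((1 - \<gamma>\<^sub>l) / (2 - \<gamma>\<^sub>l + \<beta> * (1 - \<gamma>\<^sub>l)))"

  \<comment> \<open>Divides and gaps: \<open>l < r\<close>, or \<open>l = r\<close> with contact
    points\<close>
  have part_i: "UNIV \<times> {0<..} = K_set f \<phi> \<union> (\<Union>{H_region f \<phi> e h | e h. is_gap \<phi> e h}) \<and>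
      (\<forall>c x0. is_divide f \<phi> c x0 \<longrightarrow> x0 \<in> K0 \<phi> \<and>
         (\<forall>(x, t) \<in> ray f c x0.
            u x t = u_tilde x t \<and> u_tilde x t = inv (deriv f) ((x - x0) / t))) \<and>
      (\<forall>(x, t) \<in> K_set f \<phi>. u x t - u_tilde x t = 0) \<and>
      (\<forall>e h a N::real. is_gap \<phi> (ereal e) (ereal h) \<and> a \<ge> 0 \<and> N > 0 \<and>
         ((\<lambda>v. deriv (deriv f) v / \<bar>v - chord_slope \<phi> e h\<bar> powr a) \<longlongrightarrow> N)
           (at (chord_slope \<phi> e h)) \<longrightarrow>
         (\<forall>(x, t) \<in> H_region f \<phi> (ereal e) (ereal h).
            \<bar>u x t - u_tilde x t\<bar> = \<bar>u x t - chord_slope \<phi> e h\<bar>) \<and>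
         (\<forall>\<epsilon>>0. \<forall>\<^sub>F t in at_top. \<forall>x. (x, t) \<in> H_region f \<phi> (ereal e) (ereal h) \<longrightarrow>
            \<bar>u x t - chord_slope \<phi> e h\<bar>
              \<le> (1 + \<epsilon>) * (((1 + a) / N) powr (1 / (1 + a)) *
                  ((h - e) / 2) powr (1 / (1 + a)) * t powr (- (1 / (1 + a)))))) \<and>
      (\<forall>e::real. is_gap \<phi> (ereal e) \<infinity> \<longrightarrow>
         (\<forall>(x, t) \<in> H_infty f \<phi>. \<bar>u x t - u_tilde x t\<bar> = \<bar>u x t - r\<bar>) \<and>
         (\<exists>C. \<forall>\<^sub>F t in at_top. \<forall>x. (x, t) \<in> H_infty f \<phi> \<longrightarrow> \<bar>u x t - r\<bar> \<le> C * t powr E\<^sub>r)) \<and>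
      (\<forall>h::real. is_gap \<phi> (-\<infinity>) (ereal h) \<longrightarrow>
         (\<forall>(x, t) \<in> H_minus_infty f \<phi>. \<bar>u x t - u_tilde x t\<bar> = \<bar>u x t - l\<bar>) \<and>
         (\<exists>C. \<forall>\<^sub>F t in at_top. \<forall>x. (x, t) \<in> H_minus_infty f \<phi> \<longrightarrow> \<bar>u x t - l\<bar> \<le> C * t powr E\<^sub>l))"
    if case_i: "l < r \<or> l = r \<and> K0 \<phi> \<noteq> {}"
  proof -
    \<comment> \<open>For \<open>l < r\<close> an intermediate slope supplies a contact
      point.\<close>
    have K0: "K0 \<phi> \<noteq> {}"
      using case_i ex_supports_of_limits[OF continuous_on_Phi[OF bound] _ lim_r lim_l]
        mem_K0_iff[OF bound] by blast
    \<comment> \<open>Used at contact points and inside gaps alike: there the hull has a supporting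
      line of the asserted slope at the foot.\<close>
    have tilde: "u_tilde x t = c" if "supports (Phi_hull \<phi>) c (x - t * df c)" "t > 0" for x t c
      unfolding u_tilde using entropy_sol_phi_bar[OF bound K0 that] by simp
    have divide: "x0 \<in> K0 \<phi> \<and> (\<forall>(x, t) \<in> ray f c x0.
            u x t = u_tilde x t \<and> u_tilde x t = inv (deriv f) ((x - x0) / t))"
      if "is_divide f \<phi> c x0" for c x0
    proof
      have s: "supports (Phi \<phi>) c x0" using that is_divide_iff[OF bound] by blast
      then show "x0 \<in> K0 \<phi>" using mem_K0_iff[OF bound] by blast
      have sh: "supports (Phi_hull \<phi>) c x0"
        by (rule supports_hull_of_Phi[OF bound K0 s]) (simp add: hull_le[OF bound K0])
      show "\<forall>(x, t) \<in> ray f c x0.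
            u x t = u_tilde x t \<and> u_tilde x t = inv (deriv f) ((x - x0) / t)"
      proof clarify
        fix x t assume "(x, t) \<in> ray f c x0"
        then have x: "x = x0 + t * df c" "t > 0" by (auto simp: ray_def)
        have "u x t = c" unfolding u x(1) by (rule entropy_sol_supports[OF bound s x(2)])
        moreover have "u_tilde x t = c" by (rule tilde) (use sh x in auto)
        moreover have "inv (deriv f) ((x - x0) / t) = c"
          using x inv_f_f[OF df_inj, of c] by simp
        ultimately show "u x t = u_tilde x t \<and> u_tilde x t = inv (deriv f) ((x - x0) / t)" by simp
      qed
    qed
    have cov: "UNIV \<times> {0<..} = K_set f \<phi> \<union> (\<Union>{H_region f \<phi> e h | e h. is_gap \<phi> e h})"
    proof (intro equalityI subsetI)
      fix p :: "real \<times> real" assume "p \<in> UNIV \<times> {0<..}"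
      then show "p \<in> K_set f \<phi> \<union> (\<Union>{H_region f \<phi> e h | e h. is_gap \<phi> e h})"
        using cover[OF bound K0 _ lim_r[unfolded r_def] lim_l[unfolded l_def], of "snd p" "fst p"]
        by (cases p) auto
    next
      fix p assume "p \<in> K_set f \<phi> \<union> (\<Union>{H_region f \<phi> e h | e h. is_gap \<phi> e h})"
      then show "p \<in> UNIV \<times> {0<..}"
        by (cases p) (auto simp: K_set_def ray_def H_region_def H_infty_def H_minus_infty_def
            H_bounded_def split: if_splits)
    qed
    have K_zero: "\<forall>(x, t) \<in> K_set f \<phi>. u x t - u_tilde x t = 0"
      using divide by (fastforce simp: K_set_def)
    have bounded: "(\<forall>(x, t) \<in> H_region f \<phi> (ereal e) (ereal h).
            \<bar>u x t - u_tilde x t\<bar> = \<bar>u x t - chord_slope \<phi> e h\<bar>) \<and>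
         (\<forall>\<epsilon>>0. \<forall>\<^sub>F t in at_top. \<forall>x. (x, t) \<in> H_region f \<phi> (ereal e) (ereal h) \<longrightarrow>
            \<bar>u x t - chord_slope \<phi> e h\<bar>
              \<le> (1 + \<epsilon>) * (((1 + a) / N) powr (1 / (1 + a)) *
                  ((h - e) / 2) powr (1 / (1 + a)) * t powr (- (1 / (1 + a)))))"
      if gap: "is_gap \<phi> (ereal e) (ereal h)" and a: "a \<ge> 0" "N > 0"
        "((\<lambda>v. deriv (deriv f) v / \<bar>v - chord_slope \<phi> e h\<bar> powr a) \<longlongrightarrow> N)
           (at (chord_slope \<phi> e h))" for e h a N :: real
    proof (intro conjI allI impI)
      define c where "c = chord_slope \<phi> e h"
      note sup = bounded_gap_supports[OF bound gap, folded c_def]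
      have mem: "(x, t) \<in> H_region f \<phi> (ereal e) (ereal h) \<longleftrightarrow>
          t > 0 \<and> e + t * df c < x \<and> x < h + t * df c" for x t
        by (simp add: H_region_def H_bounded_def c_def)
      show "\<forall>(x, t) \<in> H_region f \<phi> (ereal e) (ereal h).
            \<bar>u x t - u_tilde x t\<bar> = \<bar>u x t - chord_slope \<phi> e h\<bar>"
        unfolding c_def[symmetric]
      proof clarify
        fix x t assume "(x, t) \<in> H_region f \<phi> (ereal e) (ereal h)"
        then have "u_tilde x t = c" by (intro tilde sup(4)) (auto simp: mem)
        then show "\<bar>u x t - u_tilde x t\<bar> = \<bar>u x t - c\<bar>" by simp
      qed
      fix \<epsilon> :: real assume "\<epsilon> > 0"
      show "\<forall>\<^sub>F t in at_top. \<forall>x. (x, t) \<in> H_region f \<phi> (ereal e) (ereal h) \<longrightarrow>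
            \<bar>u x t - chord_slope \<phi> e h\<bar>
              \<le> (1 + \<epsilon>) * (((1 + a) / N) powr (1 / (1 + a)) *
                  ((h - e) / 2) powr (1 / (1 + a)) * t powr (- (1 / (1 + a))))"
        using gap_rate[OF bound sup(2,3,1) a[folded c_def] \<open>\<epsilon> > 0\<close>]
        unfolding c_def[symmetric]
        by (rule eventually_mono) (use u_mem mem in blast)
    qed
    have right: "(\<forall>(x, t) \<in> H_infty f \<phi>. \<bar>u x t - u_tilde x t\<bar> = \<bar>u x t - r\<bar>) \<and>
         (\<exists>C. \<forall>\<^sub>F t in at_top. \<forall>x. (x, t) \<in> H_infty f \<phi> \<longrightarrow> \<bar>u x t - r\<bar> \<le> C * t powr E\<^sub>r)"
      if gap: "is_gap \<phi> (ereal e) \<infinity>" for e :: real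
    proof
      note sup = right_gap_supports[OF bound gap lim_r]
      \<comment> \<open>Membership says that the foot of the competitor \<open>r\<close> lies in the
        gap; the foot of the maximizer may lie anywhere.\<close>
      have mem: "(x, t) \<in> H_infty f \<phi> \<longleftrightarrow> t > 0 \<and> e < x - t * df r" for x t
        using is_gap_Sup[OF gap] by (auto simp: H_infty_def r_def)
      show "\<forall>(x, t) \<in> H_infty f \<phi>. \<bar>u x t - u_tilde x t\<bar> = \<bar>u x t - r\<bar>"
      proof clarify
        fix x t assume "(x, t) \<in> H_infty f \<phi>"
        then have "u_tilde x t = r" by (intro tilde sup(2)) (auto simp: mem)
        then show "\<bar>u x t - u_tilde x t\<bar> = \<bar>u x t - r\<bar>" by simp
      qed
      obtain C where C: "mean_deviation_le (Phi \<phi>) r \<gamma>\<^sub>r {e..} C" using dev_r by blast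
      then have "C \<ge> 0" by (simp add: mean_deviation_le_def)
      then obtain C' where C': "\<And>t x v. t \<ge> 1 \<Longrightarrow> v \<in> maximizers f \<phi> x t \<Longrightarrow>
          excess_le (Phi \<phi>) r \<gamma>\<^sub>r C (x - t * df r) (x - t * df v) \<Longrightarrow> \<bar>v - r\<bar> \<le> C' * t powr E\<^sub>r"
        using rate_r unfolding E\<^sub>r_def by blast
      have "\<forall>\<^sub>F t in at_top. \<forall>x. (x, t) \<in> H_infty f \<phi> \<longrightarrow> \<bar>u x t - r\<bar> \<le> C' * t powr E\<^sub>r"
        using eventually_ge_at_top[of 1]
      proof eventually_elim
        case (elim t)
        then show ?case
          using C' u_mem mem excess_right_of_support[OF sup(1) C gamma_r(1)] by (meson less_imp_le)
      qed
      then show "\<exists>C. \<forall>\<^sub>F t in at_top. \<forall>x. (x, t) \<in> H_infty f \<phi> \<longrightarrow> \<bar>u x t - r\<bar> \<le> C * t powr E\<^sub>r" ..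
    qed
    have left: "(\<forall>(x, t) \<in> H_minus_infty f \<phi>. \<bar>u x t - u_tilde x t\<bar> = \<bar>u x t - l\<bar>) \<and>
         (\<exists>C. \<forall>\<^sub>F t in at_top. \<forall>x. (x, t) \<in> H_minus_infty f \<phi> \<longrightarrow> \<bar>u x t - l\<bar> \<le> C * t powr E\<^sub>l)"
      if gap: "is_gap \<phi> (-\<infinity>) (ereal h)" for h :: real
    proof
      note sup = left_gap_supports[OF bound gap lim_l]
      have mem: "(x, t) \<in> H_minus_infty f \<phi> \<longleftrightarrow> t > 0 \<and> x - t * df l < h" for x t
        using is_gap_Inf[OF gap] by (auto simp: H_minus_infty_def l_def)
      show "\<forall>(x, t) \<in> H_minus_infty f \<phi>. \<bar>u x t - u_tilde x t\<bar> = \<bar>u x t - l\<bar>"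
      proof clarify
        fix x t assume "(x, t) \<in> H_minus_infty f \<phi>"
        then have "u_tilde x t = l" by (intro tilde sup(2)) (auto simp: mem)
        then show "\<bar>u x t - u_tilde x t\<bar> = \<bar>u x t - l\<bar>" by simp
      qed
      obtain C where C: "mean_deviation_le (Phi \<phi>) l \<gamma>\<^sub>l {..h} C" using dev_l by blast
      then have "C \<ge> 0" by (simp add: mean_deviation_le_def)
      then obtain C' where C': "\<And>t x v. t \<ge> 1 \<Longrightarrow> v \<in> maximizers f \<phi> x t \<Longrightarrow>
          excess_le (Phi \<phi>) l \<gamma>\<^sub>l C (x - t * df l) (x - t * df v) \<Longrightarrow> \<bar>v - l\<bar> \<le> C' * t powr E\<^sub>l"
        using rate_l unfolding E\<^sub>l_def by blast
      have "\<forall>\<^sub>F t in at_top. \<forall>x. (x, t) \<in> H_minus_infty f \<phi> \<longrightarrow> \<bar>u x t - l\<bar> \<le> C' * t powr E\<^sub>l"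
        using eventually_ge_at_top[of 1]
      proof eventually_elim
        case (elim t)
        then show ?case
          using C' u_mem mem excess_left_of_support[OF sup(1) C gamma_l(1)] by (meson less_imp_le)
      qed
      then show "\<exists>C. \<forall>\<^sub>F t in at_top. \<forall>x. (x, t) \<in> H_minus_infty f \<phi> \<longrightarrow> \<bar>u x t - l\<bar> \<le> C * t powr E\<^sub>l" ..
    qed
    show ?thesis
      by (intro conjI allI impI cov divide K_zero bounded right left; (elim conjE)?) auto
  qed

  \<comment> \<open>Equal mean slopes\<close>
  have part_iia: "\<exists>C. \<forall>\<^sub>F t in at_top. \<forall>x. \<bar>u x t - r\<bar>
            \<le> C * t powr (- ((1 - max \<gamma>\<^sub>r \<gamma>\<^sub>l) /
                  (2 - max \<gamma>\<^sub>r \<gamma>\<^sub>l + \<alpha> * (1 - max \<gamma>\<^sub>r \<gamma>\<^sub>l))))"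
    if "l = r"
  proof -
    have \<gamma>: "0 \<le> max \<gamma>\<^sub>r \<gamma>\<^sub>l" "max \<gamma>\<^sub>r \<gamma>\<^sub>l < 1" using gamma_r gamma_l by auto
    obtain Cr where "mean_deviation_le (Phi \<phi>) r \<gamma>\<^sub>r {0..} Cr" using dev_r by blast
    moreover obtain Cl where "mean_deviation_le (Phi \<phi>) r \<gamma>\<^sub>l {..0} Cl"
      using dev_l \<open>l = r\<close> by blast
    ultimately obtain C where C: "C \<ge> 0" "\<And>x y. excess_le (Phi \<phi>) r (max \<gamma>\<^sub>r \<gamma>\<^sub>l) C x y"
      using excess_le_of_common_slope gamma_r(1) gamma_l(1) by blast
    then obtain C' where C': "\<And>t x v. t \<ge> 1 \<Longrightarrow> v \<in> maximizers f \<phi> x t \<Longrightarrow>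
        \<bar>v - r\<bar> \<le> C' * t powr (- ((1 - max \<gamma>\<^sub>r \<gamma>\<^sub>l) /
                  (2 - max \<gamma>\<^sub>r \<gamma>\<^sub>l + \<alpha> * (1 - max \<gamma>\<^sub>r \<gamma>\<^sub>l))))"
      using maximizer_rate[OF bound alpha[folded r_def] \<gamma> C(1)] by blast
    show ?thesis
    proof (intro exI eventually_mono[OF eventually_ge_at_top[of 1]] allI)
      fix t x :: real assume "1 \<le> t"
      then show "\<bar>u x t - r\<bar> \<le> C' * t powr (- ((1 - max \<gamma>\<^sub>r \<gamma>\<^sub>l) /
                  (2 - max \<gamma>\<^sub>r \<gamma>\<^sub>l + \<alpha> * (1 - max \<gamma>\<^sub>r \<gamma>\<^sub>l))))"
        using C'[OF \<open>1 \<le> t\<close> u_mem[of t x]] by simp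
    qed
  qed

  \<comment> \<open>Decreasing mean slopes: the two sides of a characteristic\<close>
  have part_iib: "(\<exists>C. \<forall>\<^sub>F t in at_top. \<forall>x < X t. \<bar>u x t - l\<bar> \<le> C * t powr E\<^sub>l) \<and>
      (\<exists>C. \<forall>\<^sub>F t in at_top. \<forall>x > X t. \<bar>u x t - r\<bar> \<le> C * t powr E\<^sub>r)"
    if "l > r" and X: "fwd_gen_char_from_axis f \<phi> x0 X" for x0 X
  proof
    \<comment> \<open>Both deviations are split at \<open>x0\<close>, which separates the feet of
      maximizers on the two sides of the curve; the foot of the competitor may still fall on the
      other side.\<close>
    obtain Cr where Cr: "mean_deviation_le (Phi \<phi>) r \<gamma>\<^sub>r {x0..} Cr" using dev_r by blast
    obtain Cl where Cl: "mean_deviation_le (Phi \<phi>) l \<gamma>\<^sub>l {..x0} Cl" using dev_l by blast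
    obtain C where C: "C \<ge> 0" "\<And>x y. y \<le> x0 \<Longrightarrow> excess_le (Phi \<phi>) l \<gamma>\<^sub>l C x y"
      using excess_left_of_smaller_right_slope[OF Cr Cl \<open>l > r\<close> gamma_l(1) gamma_r] by blast
    then obtain C' where C': "\<And>t x v. t \<ge> 1 \<Longrightarrow> v \<in> maximizers f \<phi> x t \<Longrightarrow>
        x - t * df v \<le> x0 \<Longrightarrow> \<bar>v - l\<bar> \<le> C' * t powr E\<^sub>l"
      using rate_l[OF C(1)] unfolding E\<^sub>l_def by blast
    have "\<forall>\<^sub>F t in at_top. \<forall>x < X t. \<bar>u x t - l\<bar> \<le> C' * t powr E\<^sub>l"
      using eventually_ge_at_top[of 1]
    proof eventually_elim
      case (elim t)
      then have "t > 0" by simp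
      then show ?case
        using C'[OF elim u_mem fwd_gen_char_separates(1)[OF bound X _ u_mem]] by blast
    qed
    then show "\<exists>C. \<forall>\<^sub>F t in at_top. \<forall>x < X t. \<bar>u x t - l\<bar> \<le> C * t powr E\<^sub>l" ..
    obtain D where D: "D \<ge> 0" "\<And>x y. x0 \<le> y \<Longrightarrow> excess_le (Phi \<phi>) r \<gamma>\<^sub>r D x y"
      using excess_right_of_larger_left_slope[OF Cr Cl \<open>l > r\<close> gamma_r(1) gamma_l] by blast
    then obtain D' where D': "\<And>t x v. t \<ge> 1 \<Longrightarrow> v \<in> maximizers f \<phi> x t \<Longrightarrow>
        x0 \<le> x - t * df v \<Longrightarrow> \<bar>v - r\<bar> \<le> D' * t powr E\<^sub>r"
      using rate_r[OF D(1)] unfolding E\<^sub>r_def by blast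
    have "\<forall>\<^sub>F t in at_top. \<forall>x > X t. \<bar>u x t - r\<bar> \<le> D' * t powr E\<^sub>r"
      using eventually_ge_at_top[of 1]
    proof eventually_elim
      case (elim t)
      then have "t > 0" by simp
      then show ?case
        using D'[OF elim u_mem fwd_gen_char_separates(2)[OF bound X _ u_mem]] by blast
    qed
    then show "\<exists>C. \<forall>\<^sub>F t in at_top. \<forall>x > X t. \<bar>u x t - r\<bar> \<le> C * t powr E\<^sub>r" ..
  qed

  show ?thesis
    unfolding r_def[symmetric] l_def[symmetric] E\<^sub>r_def[symmetric] E\<^sub>l_def[symmetric]
    by (intro conjI[OF impI impI] part_i conjI[OF impI impI[OF allI[OF allI[OF impI]]]]
        part_iia part_iib)
qed

end
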